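(* Let $n\ge2$, $0<\alpha<n-1$, $1<\rho<n$, and let $\Omega\in L^\rho(\mathbb{S}^{n-1})$ be real-valued with $\int_{\mathbb{S}^{n-1}}\Omega\,d\sigma=0$. Let $$T^\alpha(\phi)(x)=\mathrm{p.v.}\int_{\mathbb{R}^n}\frac{\Omega(y/|y|)}{|y|^{n-\alpha}}\phi(x-y)\,dy .$$ Let $q$ satisfy $$1<\frac{\rho n}{\rho n+\rho-n}<q<\frac{n}{1+\alpha},$$ and put $\mathfrak{s}=\frac{qn}{n-q(1+\alpha)}>1$. Then there is a constant $C>0$, independent of $\phi$, such that for every smooth function $\phi:\mathbb{R}^n\to\mathbb{R}$ with $\nabla\phi\in L^q(\mathbb{R}^n)$, $$\|T^\alpha(\phi)\|_{L^{\mathfrak{s}}(\mathbb{R}^n)}\le C\,\|\nabla\phi\|_{L^q(\mathbb{R}^n)} .$$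
   Context: The principal value is $\mathrm{p.v.}\int=\lim_{\varepsilon\to0,\,R\to\infty}\int_{\varepsilon<|y|<R}$, taken for almost every $x\in\mathbb{R}^n$. $\sigma$ is the surface measure on the unit sphere $\mathbb{S}^{n-1}$. *)

theory Defs
  imports "HOL-Analysis.Analysis"
begin

text \<open>
  Surface measure on the unit sphere, as the completion of the cone measure
  \<open>A \<mapsto> n * vol {x. 0 < norm x < 1 \<and> x / norm x \<in> A}\<close>
  (the normalisation making \<open>dy = r\<^sup>n\<^sup>-\<^sup>1 dr d\<sigma>\<close> in polar coordinates).
  It is completed, so that arbitrary a.e.-representatives of \<open>L\<^sup>p\<close> functions
  on the sphere are measurable.
\<close>

definition surface_measure :: "'a::euclidean_space measure" where
  "surface_measure = completion
     (scale_measure (of_nat DIM('a))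
       (distr (restrict_space lborel (ball 0 1 - {0})) (restrict_space borel (sphere 0 1))
         (\<lambda>x. x /\<^sub>R norm x)))"

lemma space_surface_measure [simp]: "space surface_measure = sphere (0::'a::euclidean_space) 1"
  by (simp add: surface_measure_def space_scale_measure space_restrict_space)

lemma radial_projection_measurable:
  "(\<lambda>x::'a::euclidean_space. x /\<^sub>R norm x)
     \<in> restrict_space lborel (ball 0 1 - {0}) \<rightarrow>\<^sub>M restrict_space borel (sphere 0 1)"
  by (intro measurable_restrict_space2 measurable_restrict_space1)
    (auto simp: space_restrict_space)

lemma emeasure_surface_measure:
  fixes A :: "'a::euclidean_space set"
  assumes "A \<in> sets borel" "A \<subseteq> sphere 0 1"
  shows "emeasure surface_measure A =
    of_nat DIM('a) * emeasure lborel {x. 0 < norm x \<and> norm x < 1 \<and> x /\<^sub>R norm x \<in> A}"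
proof -
  have A: "A \<in> sets (restrict_space borel (sphere 0 1))"
    using assms by (auto simp: sets_restrict_space_iff)
  let ?B = "{x. x \<noteq> 0 \<and> norm x < 1 \<and> x /\<^sub>R norm x \<in> A}"
  have eq: "(\<lambda>x. x /\<^sub>R norm x) -` A \<inter> (ball 0 1 - {0}) = ?B"
    by auto
  have "emeasure (restrict_space lborel (ball 0 1 - {0})) ?B = emeasure lborel ?B"
    by (rule emeasure_restrict_space) auto
  then show ?thesis
    unfolding surface_measure_def
    using A by (subst emeasure_completion)
      (auto simp: emeasure_distr radial_projection_measurable space_restrict_space eq)
qed

definition in_Lp :: "'a measure \<Rightarrow> real \<Rightarrow> ('a \<Rightarrow> 'b::real_normed_vector) \<Rightarrow> bool" where
  "in_Lp M p f \<longleftrightarrow> f \<in> borel_measurable M \<and> integrable M (\<lambda>x. norm (f x) powr p)"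

definition Lp_norm :: "'a measure \<Rightarrow> real \<Rightarrow> ('a \<Rightarrow> 'b::real_normed_vector) \<Rightarrow> real" where
  "Lp_norm M p f = (\<integral>x. norm (f x) powr p \<partial>M) powr (1 / p)"

primrec Ck :: "nat \<Rightarrow> ('a::real_normed_vector \<Rightarrow> 'b::real_normed_vector) \<Rightarrow> bool" where
  "Ck 0 f \<longleftrightarrow> continuous_on UNIV f"
| "Ck (Suc k) f \<longleftrightarrow> (\<forall>x. f differentiable (at x)) \<and>
     (\<forall>v. Ck k (\<lambda>x. frechet_derivative f (at x) v))"

definition smooth :: "('a::real_normed_vector \<Rightarrow> 'b::real_normed_vector) \<Rightarrow> bool" where
  "smooth f \<longleftrightarrow> (\<forall>k. Ck k f)"

definition grad :: "('a::real_inner \<Rightarrow> real) \<Rightarrow> 'a \<Rightarrow> 'a" where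
  "grad f x = (THE D. GDERIV f x :> D)"

text \<open>
  The limits \<open>\<epsilon> \<rightarrow> 0\<close> and \<open>R \<rightarrow> \<infinity>\<close> are taken
  jointly. The Bochner integral of a non-integrable function is 0 by convention, so
  integrability over each annulus is part of the notion.
\<close>

definition has_pv :: "('a::euclidean_space \<Rightarrow> real) \<Rightarrow> real \<Rightarrow> bool" where
  "has_pv f l \<longleftrightarrow>
     (\<forall>\<epsilon> R. 0 < \<epsilon> \<longrightarrow> set_integrable lebesgue {y. \<epsilon> < norm y \<and> norm y < R} f) \<and>
     ((\<lambda>(\<epsilon>, R). LINT y:{y. \<epsilon> < norm y \<and> norm y < R}|lebesgue. f y) \<longlongrightarrow> l)
       (at_right 0 \<times>\<^sub>F at_top)"

definition pv :: "('a::euclidean_space \<Rightarrow> real) \<Rightarrow> real" where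
  "pv f = (THE l. has_pv f l)"

definition T_integrand ::
  "('a::euclidean_space \<Rightarrow> real) \<Rightarrow> real \<Rightarrow> ('a \<Rightarrow> real) \<Rightarrow> 'a \<Rightarrow> 'a \<Rightarrow> real" where
  "T_integrand \<Omega> \<alpha> \<phi> x y =
     \<Omega> (y /\<^sub>R norm y) / norm y powr (real DIM('a) - \<alpha>) * \<phi> (x - y)"

definition T_op ::
  "('a::euclidean_space \<Rightarrow> real) \<Rightarrow> real \<Rightarrow> ('a \<Rightarrow> real) \<Rightarrow> 'a \<Rightarrow> real" where
  "T_op \<Omega> \<alpha> \<phi> x = pv (T_integrand \<Omega> \<alpha> \<phi> x)"

end

theory Submission
  imports Defs
begin

text \<open>
  As \<open>\<Omega>\<close> has mean zero, constants may be subtracted from \<open>\<phi>\<close> on each annulus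
  \<open>a < norm y < b\<close> with \<open>b \<le> 2 * a\<close>. Since \<open>q\<close> exceeds \<open>\<rho> n / (\<rho> n + \<rho> - n)\<close>, there is
  \<open>1 < p < q\<close> for which a subcritical Sobolev--Poincare inequality pairs \<open>L\<^sup>\<rho>\<close> with gradients in \<open>L\<^sup>p\<close>,
  and the annulus contributes at most a multiple of \<open>b\<^sup>1\<^sup>+\<^sup>\<alpha> A b\<close>, where \<open>A r\<close> is the \<open>L\<^sup>p\<close> mean of
  \<open>norm (grad \<phi>)\<close> over the ball of radius \<open>r\<close> around \<open>x\<close>. Summed dyadically, this bounds the truncated
  integrals by \<open>F x = \<integral> r\<^sup>\<alpha> A r dr\<close>: finiteness of \<open>F x\<close> gives the principal value, and
  the bound \<open>L\<^sup>q \<rightarrow> L\<^sup>s\<close> for \<open>F\<close> follows from the layer cake formula by truncating, for each level, the radius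
  and the height of the gradient; as \<open>p < q\<close>, no maximal function is needed.
\<close>

subsection \<open>A truncated Young inequality\<close>

text \<open>As \<open>\<Omega>\<close> is merely in L^\<rho>, the kernel offers neither a pointwise
  bound on spheres nor regularity: cancellation has to come from its mean and smoothness from
  \<open>\<phi>\<close>. The estimate on one annulus starts from |\<psi> y - \<psi> v| \<le> |v - y|
  times the integral of the gradient along the segment. Averaging over v at segment parameter \<tau>
  costs a Jacobian \<tau>^(-n) but confines the point to a ball of radius 2 \<tau> around y, and
  Young's inequality with that ball as third factor returns \<tau>^(n t), where t = 2 - 1/\<rho> -
  1/p. So \<tau>^(n t - n) must be integrable at 0, which is 1/\<rho> + 1/p < 1 + 1/n. This is the
  origin of the lower bound on q, and its strictness lets Young's inequality replace a fractional
  integration theorem. The upper bound on q is the convergence at infinity of the integral of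
  r^(\<alpha> - n/q), since ball means of an L^q function decay like r^(-n/q). The gap p < q makes
  the layer cake integral converge at level 0, at the price of a factor q / (q - p).\<close>

lemma weighted_amgm3:
  fixes x y z a b c :: real
  assumes "x \<ge> 0" "y \<ge> 0" "z \<ge> 0" "a \<ge> 0" "b \<ge> 0" "c \<ge> 0" "a + b + c = 1"
  shows "x powr a * y powr b * z powr c \<le> a * x + b * y + c * z"
proof (cases "x = 0 \<or> y = 0 \<or> z = 0")
  case True
  then show ?thesis using assms by auto
next
  case False
  then have pos: "x > 0" "y > 0" "z > 0" using assms by auto
  let ?c = "\<lambda>i::nat. if i = 0 then a else if i = 1 then b else c"
  let ?l = "\<lambda>i::nat. if i = 0 then ln x else if i = 1 then ln y else ln z"
  have "exp (\<Sum>i\<in>{0,1,2}. ?c i *\<^sub>R ?l i) \<le> (\<Sum>i\<in>{0,1,2}. ?c i * exp (?l i))"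
    by (rule convex_on_sum[OF _ _ exp_convex]) (use assms in auto)
  then show ?thesis
    using pos by (simp add: powr_def exp_add algebra_simps)
qed

lemma nn_integral_powr_from_0:
  fixes p L :: real
  assumes "p > -1" "L \<ge> 0"
  shows "(\<integral>\<^sup>+t. ennreal (t powr p) * indicator {0<..<L} t \<partial>lborel) = ennreal (L powr (p + 1) / (p + 1))"
proof -
  have "(\<integral>\<^sup>+t. ennreal (t powr p) * indicator {0<..<L} t \<partial>lborel)
    = (\<integral>\<^sup>+t. ennreal (t powr p) * indicator {0..L} t \<partial>lborel)"
    by (intro nn_integral_cong_AE eventually_mono[OF AE_lborel_singleton[of L]])
      (auto simp: indicator_def)
  also have "\<dots> = ennreal (L powr (p + 1) / (p + 1))"
    by (rule nn_integral_has_integral_lebesgue'[OF _ has_integral_powr_from_0[OF assms]]) auto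
  finally show ?thesis .
qed

lemma nn_integral_powr_to_inf:
  fixes p R :: real
  assumes "p < -1" "R > 0"
  shows "(\<integral>\<^sup>+t. ennreal (t powr p) * indicator {R..} t \<partial>lborel) = ennreal (R powr (p + 1) / (- p - 1))"
proof -
  have "- (R powr (p + 1)) / (p + 1) = R powr (p + 1) / (- p - 1)"
    using assms by (simp add: field_simps)
  with nn_integral_has_integral_lebesgue'[OF _ has_integral_powr_to_inf[OF assms]]
  show ?thesis by auto
qed

lemma nn_integral_lborel_affine:
  fixes f :: "'a::euclidean_space \<Rightarrow> ennreal"
  assumes [measurable]: "f \<in> borel_measurable borel" and "c \<noteq> 0"
  shows "(\<integral>\<^sup>+x. f x \<partial>lborel) = ennreal (\<bar>c\<bar> ^ DIM('a)) * (\<integral>\<^sup>+x. f (t + c *\<^sub>R x) \<partial>lborel)"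
  by (subst lborel_affine[OF \<open>c \<noteq> 0\<close>, of t])
    (simp add: nn_integral_density nn_integral_distr nn_integral_cmult)

lemma integral_lborel_affine:
  fixes f :: "'a::euclidean_space \<Rightarrow> real"
  assumes [measurable]: "f \<in> borel_measurable borel" and "c \<noteq> 0"
  shows "(\<integral>x. f x \<partial>lborel) = \<bar>c\<bar> ^ DIM('a) * (\<integral>x. f (t + c *\<^sub>R x) \<partial>lborel)"
  by (subst lborel_affine[OF \<open>c \<noteq> 0\<close>, of t])
    (simp add: integral_density integral_distr)

lemma content_ball_scale:
  "r > 0 \<Longrightarrow> c > 0 \<Longrightarrow> measure lborel (ball (x::'a::euclidean_space) (c * r)) = c ^ DIM('a) * measure lborel (ball (y::'a) r)"
  by (simp add: content_ball power_mult_distrib)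

lemma emeasure_ball_eq: "emeasure lborel (ball (x::'a::euclidean_space) r) = ennreal (measure lborel (ball (0::'a) r))"
  by (cases "r \<ge> 0") (auto simp: content_ball emeasure_ball ball_empty)

text \<open>The integrand is a geometric mean of f^\<rho> G^p, f^\<rho> 1_B and G^p 1_B. Dividing
  each by the bound for its double integral and applying weighted AM-GM pointwise avoids Hoelder.
  The power of the volume is the norm of the indicator of the ball in L^(1/t), t = 2 - 1/\<rho> -
  1/p, as in Young's convolution inequality.\<close>

lemma young_truncated:
  fixes f G :: "'a::euclidean_space \<Rightarrow> real"
  assumes [measurable]: "f \<in> borel_measurable borel" "G \<in> borel_measurable borel"
    and nonneg: "\<And>y. f y \<ge> 0" "\<And>y. G y \<ge> 0"
    and exps: "1 < \<rho>" "1 < p" "1 \<le> 1 / \<rho> + 1 / p"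
    and F: "(\<integral>\<^sup>+y. ennreal (f y powr \<rho>) \<partial>lborel) \<le> ennreal F" "F > 0"
    and I: "(\<integral>\<^sup>+y. ennreal (G y powr p) \<partial>lborel) \<le> ennreal I" "I > 0"
    and "r > 0"
  shows "(\<integral>\<^sup>+y. \<integral>\<^sup>+z. ennreal (f y * G z) * indicator (ball y r) z \<partial>lborel \<partial>lborel)
    \<le> ennreal (measure lborel (ball (0::'a) r) powr (2 - 1 / \<rho> - 1 / p) * F powr (1 / \<rho>) * I powr (1 / p))"
proof -
  define V where "V = measure lborel (ball (0::'a) r)"
  \<comment> \<open>The weights solve a + b = 1/\<rho>, a + c = 1/p and a + b + c = 1, so that u v =
    (u^\<rho> v^p)^a (u^\<rho>)^b (v^p)^c. The condition 1 \<le> 1/\<rho> + 1/p is a \<ge>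
    0.\<close>
  define a b c where "a = 1 / \<rho> + 1 / p - 1" and "b = 1 - 1 / p" and "c = 1 - 1 / \<rho>"
  have abc: "a \<ge> 0" "b \<ge> 0" "c \<ge> 0" "a + b + c = 1" "a + b = 1 / \<rho>" "a + c = 1 / p" "b + c = 2 - 1/\<rho> - 1/p"
    using exps by (auto simp: a_def b_def c_def)
  have V: "V > 0" using \<open>r > 0\<close> by (simp add: V_def)
  \<comment> \<open>This is (F I)^a (F V)^b (I V)^c, the factor lost when the three terms are
    normalised.\<close>
  define K where "K = V powr (b + c) * F powr (1 / \<rho>) * I powr (1 / p)"
  have K: "K > 0" using V F I by (simp add: K_def)
  have key: "u * v \<le> K * (a * (u powr \<rho> * v powr p / (F * I)) + b * (u powr \<rho> / (F * V)) + c * (v powr p / (I * V)))"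
    if uv: "u \<ge> 0" "v \<ge> 0" for u v
  proof (cases "u = 0 \<or> v = 0")
    case True
    then show ?thesis using K F I V abc by auto
  next
    case False
    then have "u > 0" "v > 0" using uv by auto
    then have up: "u powr (\<rho> * a) * u powr (\<rho> * b) = u" "v powr (p * a) * v powr (p * c) = v"
      using abc(5,6) exps by (auto simp flip: powr_add distrib_left)
    have FI: "F powr (1/\<rho>) = F powr a * F powr b" "I powr (1/p) = I powr a * I powr c"
      by (auto simp flip: powr_add abc(5,6))
    have "K * ((u powr \<rho> * v powr p / (F * I)) powr a * (u powr \<rho> / (F * V)) powr b * (v powr p / (I * V)) powr c)
      = (u powr (\<rho> * a) * u powr (\<rho> * b)) * (v powr (p * a) * v powr (p * c))"
      using \<open>u > 0\<close> \<open>v > 0\<close> F I V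
      by (simp add: K_def FI powr_mult powr_divide powr_powr powr_add field_simps)
    also have "\<dots> = u * v" by (simp add: up)
    finally have "u * v = K * ((u powr \<rho> * v powr p / (F * I)) powr a * (u powr \<rho> / (F * V)) powr b * (v powr p / (I * V)) powr c)"
      by simp
    also have "\<dots> \<le> K * (a * (u powr \<rho> * v powr p / (F * I)) + b * (u powr \<rho> / (F * V)) + c * (v powr p / (I * V)))"
      using K F I V abc by (intro mult_left_mono weighted_amgm3) auto
    finally show ?thesis .
  qed
  have emV: "emeasure lborel (ball y r) = ennreal V" for y :: 'a
    unfolding V_def by (rule emeasure_ball_eq)
  have [measurable]: "Measurable.pred (borel \<Otimes>\<^sub>M borel) (\<lambda>(y::'a,z). z \<in> ball y r)"
    unfolding mem_ball by measurable
  have ind: "(\<lambda>(y::'a,z). indicator (ball y r) z :: ennreal) \<in> borel_measurable (borel \<Otimes>\<^sub>M borel)"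
    unfolding indicator_def mem_ball by measurable
  note [measurable] = ind[unfolded measurable_split_conv]
  define k1 k2 k3 where "k1 = ennreal (K * a / (F * I))" and "k2 = ennreal (K * b / (F * V))"
    and "k3 = ennreal (K * c / (I * V))"
  let ?f = "\<lambda>y. ennreal (f y powr \<rho>)" and ?G = "\<lambda>z. ennreal (G z powr p)"
  have "(\<integral>\<^sup>+y. \<integral>\<^sup>+z. ennreal (f y * G z) * indicator (ball y r) z \<partial>lborel \<partial>lborel)
    \<le> (\<integral>\<^sup>+y. \<integral>\<^sup>+z. k1 * (?f y * ?G z) + k2 * (?f y * indicator (ball y r) z)
         + k3 * (?G z * indicator (ball y r) z) \<partial>lborel \<partial>lborel)"
  proof (intro nn_integral_mono)
    fix y z :: 'a
    show "ennreal (f y * G z) * indicator (ball y r) z \<le> k1 * (?f y * ?G z) + k2 * (?f y * indicator (ball y r) z)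
         + k3 * (?G z * indicator (ball y r) z)"
    proof (cases "z \<in> ball y r")
      case True
      have "ennreal (f y * G z) \<le> ennreal (K * a / (F * I) * (f y powr \<rho> * G z powr p)
          + K * b / (F * V) * (f y powr \<rho>) + K * c / (I * V) * G z powr p)"
        using key[OF nonneg(1)[of y] nonneg(2)[of z]] by (intro ennreal_leI) (simp add: algebra_simps)
      also have "\<dots> = k1 * (?f y * ?G z) + k2 * ?f y + k3 * ?G z"
        using K F I V abc
        by (simp add: k1_def k2_def k3_def ennreal_mult'' ennreal_plus flip: ennreal_mult'')
      finally show ?thesis using True by simp
    qed simp
  qed
  also have "\<dots> = k1 * ((\<integral>\<^sup>+y. ?f y \<partial>lborel) * (\<integral>\<^sup>+z. ?G z \<partial>lborel))
     + k2 * ((\<integral>\<^sup>+y. ?f y \<partial>lborel) * ennreal V)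
     + k3 * (\<integral>\<^sup>+y. \<integral>\<^sup>+z. ?G z * indicator (ball y r) z \<partial>lborel \<partial>lborel)"
    by (simp add: nn_integral_add nn_integral_cmult nn_integral_multc emV)
  also have "(\<integral>\<^sup>+y. \<integral>\<^sup>+z. ?G z * indicator (ball y r) z \<partial>lborel \<partial>lborel)
    = (\<integral>\<^sup>+z. \<integral>\<^sup>+y. ?G z * indicator (ball z r) y \<partial>lborel \<partial>lborel)"
    by (subst lborel_pair.Fubini') (auto simp: indicator_def dist_commute intro!: nn_integral_cong)
  also have "\<dots> = (\<integral>\<^sup>+z. ?G z \<partial>lborel) * ennreal V"
    by (simp add: nn_integral_cmult nn_integral_multc emV)
  also have "k1 * ((\<integral>\<^sup>+y. ?f y \<partial>lborel) * (\<integral>\<^sup>+z. ?G z \<partial>lborel))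
     + k2 * ((\<integral>\<^sup>+y. ?f y \<partial>lborel) * ennreal V) + k3 * ((\<integral>\<^sup>+z. ?G z \<partial>lborel) * ennreal V)
    \<le> k1 * (ennreal F * ennreal I) + k2 * (ennreal F * ennreal V) + k3 * (ennreal I * ennreal V)"
    using F I by (intro add_mono mult_mono) auto
  also have "\<dots> = ennreal (K * a / (F * I) * (F * I) + K * b / (F * V) * (F * V) + K * c / (I * V) * (I * V))"
    using K F I V abc
    by (simp add: k1_def k2_def k3_def ennreal_plus del: times_divide_eq_right times_divide_eq_left flip: ennreal_mult)
  also have "K * a / (F * I) * (F * I) + K * b / (F * V) * (F * V) + K * c / (I * V) * (I * V) = K * (a + b + c)"
    using F I V by (simp add: field_simps)
  finally show ?thesis
    unfolding abc(4) K_def abc(7) V_def by simp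
qed

subsection \<open>Sobolev--Poincare pairing on the unit ball\<close>

lemma ball_in_sets_borel [measurable]: "ball (x::'a::euclidean_space) r \<in> sets borel"
  by simp

lemma continuous_on_compact_abs_bound:
  fixes f :: "'a::topological_space \<Rightarrow> real"
  assumes "compact S" "continuous_on S f"
  obtains M where "\<And>y. y \<in> S \<Longrightarrow> \<bar>f y\<bar> \<le> M"
proof -
  have "bounded (f ` S)" using assms by (intro compact_imp_bounded compact_continuous_image)
  then obtain M where "\<forall>u \<in> f ` S. norm u \<le> M" unfolding bounded_iff by blast
  then show ?thesis using that[of M] by simp
qed

lemma emeasure_ball_less_top: "emeasure lborel (ball (x::'a::euclidean_space) r) < \<infinity>"
  by (simp add: emeasure_ball_eq)

lemma mean_value_nn_integral:
  fixes \<psi> :: "'a::euclidean_space \<Rightarrow> real" and D :: "'a \<Rightarrow> 'a"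
  assumes der: "\<And>y. (\<psi> has_derivative (\<lambda>h. D y \<bullet> h)) (at y)" and cont: "continuous_on UNIV D"
  shows "ennreal \<bar>\<psi> y - \<psi> v\<bar> \<le>
    (\<integral>\<^sup>+\<tau>. ennreal (norm (v - y) * norm (D (y + \<tau> *\<^sub>R (v - y)))) * indicator {0<..<1} \<tau> \<partial>lborel)"
proof -
  let ?p = "\<lambda>\<tau>. y + \<tau> *\<^sub>R (v - y)"
  have "((\<lambda>\<tau>. \<psi> (?p \<tau>)) has_vector_derivative D (?p \<tau>) \<bullet> (v - y)) (at \<tau> within {0..1})" for \<tau>
  proof -
    have "((\<lambda>\<tau>. \<psi> (?p \<tau>)) has_derivative (\<lambda>h. D (?p \<tau>) \<bullet> (h *\<^sub>R (v - y)))) (at \<tau> within {0..1})"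
      by (rule has_derivative_compose[OF _ der]) (auto intro!: derivative_eq_intros)
    then show ?thesis by (simp add: has_vector_derivative_def)
  qed
  then have int1: "((\<lambda>\<tau>. D (?p \<tau>) \<bullet> (v - y)) has_integral (\<psi> (?p 1) - \<psi> (?p 0))) {0..1}"
    by (intro fundamental_theorem_of_calculus) auto
  have contD: "continuous_on {0..1} (\<lambda>\<tau>. D (?p \<tau>))"
    by (rule continuous_on_compose2[OF cont]) (auto intro!: continuous_intros)
  let ?g = "\<lambda>\<tau>. norm (v - y) * norm (D (?p \<tau>))"
  have int2: "(?g has_integral integral {0..1} ?g) {0..1}"
    by (intro integrable_integral integrable_continuous_interval continuous_intros contD)
  have "\<bar>\<psi> v - \<psi> y\<bar> \<le> integral {0..1} ?g"
    using int1 int2 integral_norm_bound_integral[of "\<lambda>\<tau>. D (?p \<tau>) \<bullet> (v - y)" "{0..1}" ?g]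
    by (force simp: integral_unique has_integral_integrable mult.commute[of "norm (v - y)"] Cauchy_Schwarz_ineq2)
  then have "ennreal \<bar>\<psi> y - \<psi> v\<bar> \<le> ennreal (integral {0..1} ?g)"
    by (intro ennreal_leI) (simp add: abs_minus_commute)
  also have "\<dots> = (\<integral>\<^sup>+\<tau>. ennreal (?g \<tau>) * indicator {0..1} \<tau> \<partial>lborel)"
    by (rule nn_integral_has_integral_lebesgue'[OF _ int2, symmetric]) auto
  \<comment> \<open>The endpoints are dropped because \<tau> = 0 has to be excluded when the
    substitution in \<open>segment_average_bound\<close> divides by \<tau>.\<close>
  also have "\<dots> = (\<integral>\<^sup>+\<tau>. ennreal (?g \<tau>) * indicator {0<..<1} \<tau> \<partial>lborel)"
  proof (intro nn_integral_cong_AE)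
    show "AE \<tau> in lborel. ennreal (?g \<tau>) * indicator {0..1} \<tau> = ennreal (?g \<tau>) * indicator {0<..<1} \<tau>"
      using AE_lborel_singleton[of "0::real"] AE_lborel_singleton[of "1::real"]
      by eventually_elim (auto simp: indicator_def)
  qed
  finally show ?thesis .
qed

text \<open>The substitution z = y + \<tau> (v - y) in v has Jacobian \<tau>^n, and v - y is shorter
  than 2 when both points lie in the unit ball. The small radius 2 \<tau> is what later pays for the
  factor \<tau>^(-n).\<close>

lemma segment_average_bound:
  fixes G :: "'a::euclidean_space \<Rightarrow> real"
  assumes [measurable]: "G \<in> borel_measurable borel" and "\<And>z. G z \<ge> 0"
    and "0 < \<tau>" and y: "y \<in> ball 0 1"
  shows "(\<integral>\<^sup>+v. ennreal (G (y + \<tau> *\<^sub>R (v - y))) * indicator (ball 0 1) v \<partial>lborel)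
    \<le> ennreal (\<tau> powr - real DIM('a)) * (\<integral>\<^sup>+z. ennreal (G z) * indicator (ball y (2 * \<tau>)) z \<partial>lborel)"
proof -
  let ?h = "\<lambda>z. ennreal (G z) * indicator (ball y (2 * \<tau>)) z"
  have "(\<integral>\<^sup>+z. ?h z \<partial>lborel) = ennreal (\<bar>\<tau>\<bar> ^ DIM('a)) * (\<integral>\<^sup>+v. ?h ((y - \<tau> *\<^sub>R y) + \<tau> *\<^sub>R v) \<partial>lborel)"
    by (rule nn_integral_lborel_affine) (use \<open>0 < \<tau>\<close> in auto)
  then have "ennreal (\<tau> powr - real DIM('a)) * (\<integral>\<^sup>+z. ?h z \<partial>lborel)
    = ennreal (\<tau> powr - real DIM('a) * \<tau> ^ DIM('a)) * (\<integral>\<^sup>+v. ?h ((y - \<tau> *\<^sub>R y) + \<tau> *\<^sub>R v) \<partial>lborel)"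
    using \<open>0 < \<tau>\<close> by (simp add: ennreal_mult mult.assoc)
  also have "\<tau> powr - real DIM('a) * \<tau> ^ DIM('a) = 1"
    using \<open>0 < \<tau>\<close> by (simp add: powr_minus powr_realpow)
  finally have eq: "ennreal (\<tau> powr - real DIM('a)) * (\<integral>\<^sup>+z. ?h z \<partial>lborel)
    = (\<integral>\<^sup>+v. ?h ((y - \<tau> *\<^sub>R y) + \<tau> *\<^sub>R v) \<partial>lborel)" by simp
  show ?thesis unfolding eq
  proof (intro nn_integral_mono)
    fix v :: 'a
    have e: "(y - \<tau> *\<^sub>R y) + \<tau> *\<^sub>R v = y + \<tau> *\<^sub>R (v - y)" by (simp add: algebra_simps)
    have "norm (v - y) < 2" if "norm v < 1"
      using norm_triangle_ineq4[of v y] that y by simp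
    then have "y + \<tau> *\<^sub>R (v - y) \<in> ball y (2 * \<tau>)" if "norm v < 1"
      using that \<open>0 < \<tau>\<close> by (simp add: dist_norm)
    then show "ennreal (G (y + \<tau> *\<^sub>R (v - y))) * indicator (ball 0 1) v
      \<le> ?h ((y - \<tau> *\<^sub>R y) + \<tau> *\<^sub>R v)"
      unfolding e by (auto simp: indicator_def)
  qed
qed

text \<open>At segment parameter \<tau>, Young's inequality on balls of radius 2 \<tau> gives
  \<tau>^(n t), t = 2 - 1/\<rho> - 1/p, against the Jacobian \<tau>^(-n). The denominator 1 - n + n
  t comes from integrating \<tau>^(n t - n) over (0, 1) and is positive by the last exponent
  condition. The leading 2 bounds the distance of two points of the unit ball.\<close>

lemma sobolev_poincare_pairing:
  fixes f :: "'a::euclidean_space \<Rightarrow> real" and \<psi> :: "'a \<Rightarrow> real" and D :: "'a \<Rightarrow> 'a"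
  defines "n \<equiv> real DIM('a)"
  assumes der: "\<And>y. (\<psi> has_derivative (\<lambda>h. D y \<bullet> h)) (at y)" and cont: "continuous_on UNIV D"
    and f[measurable]: "f \<in> borel_measurable borel" and f0: "\<And>y. f y \<ge> 0" "\<And>y. y \<notin> ball 0 1 \<Longrightarrow> f y = 0"
    and exps: "1 < \<rho>" "1 < p" "1 \<le> 1 / \<rho> + 1 / p" "1 / \<rho> + 1 / p < 1 + 1 / n"
    and F: "(\<integral>\<^sup>+y. ennreal (f y powr \<rho>) \<partial>lborel) \<le> ennreal F" "F > 0"
    and I: "(\<integral>\<^sup>+y. ennreal (norm (D y) powr p) * indicator (ball 0 1) y \<partial>lborel) \<le> ennreal I" "I > 0"
  shows "(\<integral>\<^sup>+y. \<integral>\<^sup>+v. ennreal (f y * \<bar>\<psi> y - \<psi> v\<bar>) * indicator (ball 0 1) v \<partial>lborel \<partial>lborel)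
    \<le> ennreal (2 * measure lborel (ball (0::'a) 2) powr (2 - 1 / \<rho> - 1 / p) / (1 - n + n * (2 - 1 / \<rho> - 1 / p))
         * F powr (1 / \<rho>) * I powr (1 / p))"
proof -
  define t where "t = 2 - 1 / \<rho> - 1 / p"
  define V where "V = measure lborel (ball (0::'a) 2)"
  have n: "n > 0" by (simp add: n_def)
  have t: "1 - n + n * t > 0"
  proof -
    have "n * (1 / \<rho> + 1 / p) < n * (1 + 1 / n)" using exps(4) n by (rule mult_strict_left_mono)
    then show ?thesis using n by (simp add: t_def algebra_simps)
  qed
  have [measurable]: "D \<in> borel_measurable borel" using cont by (rule borel_measurable_continuous_onI)
  have "\<psi> differentiable (at y)" for y using der unfolding differentiable_def by blast
  then have "continuous_on UNIV \<psi>"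
    by (simp add: continuous_on_eq_continuous_within differentiable_imp_continuous_within)
  then have [measurable]: "\<psi> \<in> borel_measurable borel" by (rule borel_measurable_continuous_onI)
  \<comment> \<open>The cut-off loses nothing, as segments between points of the unit ball stay
    inside it. It makes the whole-space Young inequality see only the gradient on that ball.\<close>
  define G where "G z = norm (D z) * indicator (ball 0 1) z" for z
  have G[measurable]: "G \<in> borel_measurable borel" unfolding G_def mem_ball indicator_def by measurable
  have G0: "G z \<ge> 0" for z by (simp add: G_def)
  have "(\<integral>\<^sup>+y. ennreal (G y powr p) \<partial>lborel) = (\<integral>\<^sup>+y. ennreal (norm (D y) powr p) * indicator (ball 0 1) y \<partial>lborel)"
    by (intro nn_integral_cong) (auto simp: G_def indicator_def)
  with I have GI: "(\<integral>\<^sup>+y. ennreal (G y powr p) \<partial>lborel) \<le> ennreal I" by simp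
  let ?i = "\<lambda>\<tau>. \<integral>\<^sup>+y. \<integral>\<^sup>+v. ennreal (f y) * (ennreal (G (y + \<tau> *\<^sub>R (v - y))) * indicator (ball 0 1) v) \<partial>lborel \<partial>lborel"
  have step: "?i \<tau> \<le> ennreal (V powr t * F powr (1 / \<rho>) * I powr (1 / p)) * ennreal (\<tau> powr (n * t - n))"
    if \<tau>: "0 < \<tau>" for \<tau>
  proof -
    have [measurable]: "Measurable.pred (borel \<Otimes>\<^sub>M borel) (\<lambda>(y::'a,z). z \<in> ball y (2 * \<tau>))"
      unfolding mem_ball by measurable
    have ind: "(\<lambda>(y::'a,z). indicator (ball y (2 * \<tau>)) z :: ennreal) \<in> borel_measurable (borel \<Otimes>\<^sub>M borel)"
      unfolding indicator_def mem_ball by measurable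
    note [measurable] = ind[unfolded measurable_split_conv]
    have "?i \<tau> \<le> (\<integral>\<^sup>+y. ennreal (f y) * (ennreal (\<tau> powr - n) *
        (\<integral>\<^sup>+z. ennreal (G z) * indicator (ball y (2 * \<tau>)) z \<partial>lborel)) \<partial>lborel)"
    proof (intro nn_integral_mono)
      fix y :: 'a
      have "(\<integral>\<^sup>+v. ennreal (f y) * (ennreal (G (y + \<tau> *\<^sub>R (v - y))) * indicator (ball 0 1) v) \<partial>lborel)
        = ennreal (f y) * (\<integral>\<^sup>+v. ennreal (G (y + \<tau> *\<^sub>R (v - y))) * indicator (ball 0 1) v \<partial>lborel)"
        by (rule nn_integral_cmult) measurable
      also have "\<dots> \<le> ennreal (f y) * (ennreal (\<tau> powr - n) *
        (\<integral>\<^sup>+z. ennreal (G z) * indicator (ball y (2 * \<tau>)) z \<partial>lborel))"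
      proof (cases "y \<in> ball 0 1")
        case True
        then show ?thesis unfolding n_def
          by (intro mult_left_mono segment_average_bound) (use G0 \<tau> in auto)
      qed (simp add: f0)
      finally show "(\<integral>\<^sup>+v. ennreal (f y) * (ennreal (G (y + \<tau> *\<^sub>R (v - y))) * indicator (ball 0 1) v) \<partial>lborel) \<le> \<dots>" .
    qed
    also have "\<dots> = ennreal (\<tau> powr - n) * (\<integral>\<^sup>+y. \<integral>\<^sup>+z. ennreal (f y * G z) * indicator (ball y (2 * \<tau>)) z \<partial>lborel \<partial>lborel)"
      using f0 G0 by (simp add: ennreal_mult nn_integral_cmult mult.assoc mult.left_commute[of _ "ennreal (\<tau> powr - n)"])
    also have "\<dots> \<le> ennreal (\<tau> powr - n) * ennreal (measure lborel (ball (0::'a) (2 * \<tau>)) powr t * F powr (1 / \<rho>) * I powr (1 / p))"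
      unfolding t_def using f0 G0 F GI I exps \<tau>
      by (intro mult_left_mono young_truncated) auto
    also have "measure lborel (ball (0::'a) (2 * \<tau>)) = \<tau> ^ DIM('a) * V"
      using content_ball_scale[of 2 \<tau> "0::'a" 0] \<tau> by (simp add: V_def mult.commute)
    also have "\<tau> ^ DIM('a) = \<tau> powr n" using \<tau> by (simp add: n_def powr_realpow)
    also have "ennreal (\<tau> powr - n) * ennreal ((\<tau> powr n * V) powr t * F powr (1 / \<rho>) * I powr (1 / p))
      = ennreal (V powr t * F powr (1 / \<rho>) * I powr (1 / p)) * ennreal (\<tau> powr (n * t - n))"
      using \<tau> by (simp add: V_def powr_mult powr_powr powr_diff powr_minus divide_inverse mult_ac flip: ennreal_mult')
    finally show ?thesis .
  qed
  have "(\<integral>\<^sup>+y. \<integral>\<^sup>+v. ennreal (f y * \<bar>\<psi> y - \<psi> v\<bar>) * indicator (ball 0 1) v \<partial>lborel \<partial>lborel)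
    \<le> (\<integral>\<^sup>+y. \<integral>\<^sup>+v. \<integral>\<^sup>+\<tau>. 2 * (ennreal (f y) * (ennreal (G (y + \<tau> *\<^sub>R (v - y))) * indicator (ball 0 1) v))
         * indicator {0<..<1} \<tau> \<partial>lborel \<partial>lborel \<partial>lborel)"
  proof (intro nn_integral_mono)
    fix y v :: 'a
    show "ennreal (f y * \<bar>\<psi> y - \<psi> v\<bar>) * indicator (ball 0 1) v \<le>
      (\<integral>\<^sup>+\<tau>. 2 * (ennreal (f y) * (ennreal (G (y + \<tau> *\<^sub>R (v - y))) * indicator (ball 0 1) v))
         * indicator {0<..<1} \<tau> \<partial>lborel)"
    proof (cases "y \<in> ball 0 1 \<and> v \<in> ball 0 1")
      case True
      then have yv: "norm (v - y) \<le> 2"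
        using norm_triangle_ineq4[of v y] by simp
      have inB: "y + \<tau> *\<^sub>R (v - y) \<in> ball 0 1" if "\<tau> \<in> {0<..<1}" for \<tau>
      proof -
        have "(1 - \<tau>) *\<^sub>R y + \<tau> *\<^sub>R v \<in> ball 0 1"
          using that True by (intro convexD[OF convex_ball]) auto
        then show ?thesis by (simp add: algebra_simps)
      qed
      have "ennreal (f y * \<bar>\<psi> y - \<psi> v\<bar>) \<le> ennreal (f y) * (\<integral>\<^sup>+\<tau>. ennreal (norm (v - y) * norm (D (y + \<tau> *\<^sub>R (v - y)))) * indicator {0<..<1} \<tau> \<partial>lborel)"
        unfolding ennreal_mult''[OF abs_ge_zero]
        by (intro mult_left_mono mean_value_nn_integral der cont) simp
      also have "\<dots> \<le> ennreal (f y) * (\<integral>\<^sup>+\<tau>. 2 * ennreal (G (y + \<tau> *\<^sub>R (v - y))) * indicator {0<..<1} \<tau> \<partial>lborel)"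
      proof (intro mult_left_mono nn_integral_mono)
        fix \<tau> :: real
        have "ennreal (norm (v - y) * norm (D (y + \<tau> *\<^sub>R (v - y)))) \<le> 2 * ennreal (G (y + \<tau> *\<^sub>R (v - y)))"
          if "\<tau> \<in> {0<..<1}"
        proof -
          have "ennreal (norm (v - y) * norm (D (y + \<tau> *\<^sub>R (v - y)))) \<le> ennreal (2 * G (y + \<tau> *\<^sub>R (v - y)))"
            using inB[OF that] yv by (intro ennreal_leI) (auto simp: G_def intro!: mult_right_mono)
          then show ?thesis by (simp add: ennreal_mult')
        qed
        then show "ennreal (norm (v - y) * norm (D (y + \<tau> *\<^sub>R (v - y)))) * indicator {0<..<1} \<tau>
          \<le> 2 * ennreal (G (y + \<tau> *\<^sub>R (v - y))) * indicator {0<..<1} \<tau>"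
          by (auto simp: indicator_def)
      qed simp
      also have "\<dots> = (\<integral>\<^sup>+\<tau>. ennreal (f y) * (2 * ennreal (G (y + \<tau> *\<^sub>R (v - y))) * indicator {0<..<1} \<tau>) \<partial>lborel)"
        by (rule nn_integral_cmult[symmetric]) measurable
      finally show ?thesis using True by (simp add: mult_ac)
    qed (auto simp: f0)
  qed
  \<comment> \<open>Tonelli is applied twice, first under y and then across y, to bring the segment
    parameter outermost, where \<open>step\<close> applies for each fixed \<tau>.\<close>
  also have "\<dots> = (\<integral>\<^sup>+y. \<integral>\<^sup>+\<tau>. \<integral>\<^sup>+v. 2 * (ennreal (f y) * (ennreal (G (y + \<tau> *\<^sub>R (v - y))) * indicator (ball 0 1) v))
         * indicator {0<..<1} \<tau> \<partial>lborel \<partial>lborel \<partial>lborel)"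
    by (intro nn_integral_cong lborel_pair.Fubini') measurable
  also have "\<dots> = (\<integral>\<^sup>+\<tau>. \<integral>\<^sup>+y. \<integral>\<^sup>+v. 2 * (ennreal (f y) * (ennreal (G (y + \<tau> *\<^sub>R (v - y))) * indicator (ball 0 1) v))
         * indicator {0<..<1} \<tau> \<partial>lborel \<partial>lborel \<partial>lborel)"
    by (intro lborel_pair.Fubini') measurable
  also have "\<dots> = (\<integral>\<^sup>+\<tau>. 2 * ?i \<tau> * indicator {0<..<1} \<tau> \<partial>lborel)"
    by (simp add: nn_integral_cmult nn_integral_multc)
  also have "\<dots> \<le> (\<integral>\<^sup>+\<tau>. 2 * ennreal (V powr t * F powr (1 / \<rho>) * I powr (1 / p)) * (ennreal (\<tau> powr (n * t - n)) * indicator {0<..<1} \<tau>) \<partial>lborel)"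
    using step by (intro nn_integral_mono) (auto simp: indicator_def mult.assoc intro!: mult_left_mono)
  also have "\<dots> = 2 * ennreal (V powr t * F powr (1 / \<rho>) * I powr (1 / p)) * (\<integral>\<^sup>+\<tau>. ennreal (\<tau> powr (n * t - n)) * indicator {0<..<1} \<tau> \<partial>lborel)"
    by (rule nn_integral_cmult) measurable
  also have "(\<integral>\<^sup>+\<tau>. ennreal (\<tau> powr (n * t - n)) * indicator {0<..<1} \<tau> \<partial>lborel) = ennreal (1 / (1 - n + n * t))"
    using t by (subst nn_integral_powr_from_0) (auto simp: algebra_simps)
  also have "2 * ennreal (V powr t * F powr (1 / \<rho>) * I powr (1 / p)) * ennreal (1 / (1 - n + n * t))
    = ennreal (2 * V powr t / (1 - n + n * t) * F powr (1 / \<rho>) * I powr (1 / p))"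
    unfolding ennreal_numeral[symmetric] using t
    by (subst ennreal_mult'[symmetric], simp, subst ennreal_mult''[symmetric], simp) (simp add: mult_ac)
  finally show ?thesis unfolding t_def V_def .
qed

text \<open>As K has mean zero, \<psi> may be replaced by its deviation from c / \<kappa>, its mean
  over the unit ball, and \<kappa> \<psi> y - c is the integral of \<psi> y - \<psi> v over v in the
  ball. The volume \<kappa> stays on the left to avoid a division.\<close>

lemma mean_zero_pairing:
  fixes K f \<psi> :: "'a::euclidean_space \<Rightarrow> real"
  assumes [measurable]: "K \<in> borel_measurable borel" "f \<in> borel_measurable borel"
    and \<psi>: "continuous_on UNIV \<psi>"
    and Kf: "\<And>y. \<bar>K y\<bar> \<le> f y" and K0: "\<And>y. y \<notin> ball 0 1 \<Longrightarrow> K y = 0"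
    and intK: "integrable lborel K" "(\<integral>y. K y \<partial>lborel) = 0"
  shows "ennreal (measure lborel (ball (0::'a) 1) * \<bar>\<integral>y. K y * \<psi> y \<partial>lborel\<bar>)
    \<le> (\<integral>\<^sup>+y. \<integral>\<^sup>+v. ennreal (f y * \<bar>\<psi> y - \<psi> v\<bar>) * indicator (ball 0 1) v \<partial>lborel \<partial>lborel)"
proof -
  define \<kappa> where "\<kappa> = measure lborel (ball (0::'a) 1)"
  define c where "c = (\<integral>v. indicator (ball 0 1) v * \<psi> v \<partial>lborel)"
  have [measurable]: "\<psi> \<in> borel_measurable borel" using \<psi> by (rule borel_measurable_continuous_onI)
  obtain M where M: "\<And>y. y \<in> cball 0 1 \<Longrightarrow> \<bar>\<psi> y\<bar> \<le> M"
    using continuous_on_compact_abs_bound[OF compact_cball continuous_on_subset[OF \<psi> subset_UNIV]] by blast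
  have int1: "integrable lborel (\<lambda>v. indicator (ball 0 1) v * \<psi> v)"
  proof (rule Bochner_Integration.integrable_bound)
    show "integrable lborel (\<lambda>v::'a. indicator (ball 0 1) v * M)"
      by (intro integrable_mult_left integrable_real_indicator) (auto intro: emeasure_ball_less_top[unfolded infinity_ennreal_def])
    show "AE v in lborel. norm (indicator (ball 0 1) v * \<psi> v) \<le> norm (indicator (ball (0::'a) 1) v * M)"
      using M by (intro AE_I2) (auto simp: indicator_def intro: order_trans[OF _ abs_ge_self])
  qed measurable
  have int2: "integrable lborel (\<lambda>y. K y * \<psi> y)"
  proof (rule Bochner_Integration.integrable_bound)
    show "integrable lborel (\<lambda>y. K y * M)" using intK by simp
    have "\<bar>K y\<bar> * \<bar>\<psi> y\<bar> \<le> \<bar>K y\<bar> * \<bar>M\<bar>" for y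
    proof (cases "y \<in> ball 0 1")
      case True
      then have "\<bar>\<psi> y\<bar> \<le> \<bar>M\<bar>" using M[of y] by simp
      then show ?thesis by (rule mult_left_mono) simp
    qed (simp add: K0)
    then show "AE v in lborel. norm (K v * \<psi> v) \<le> norm (K v * M)"
      by (auto simp: abs_mult)
  qed measurable
  have "\<kappa> * (\<integral>y. K y * \<psi> y \<partial>lborel) = (\<integral>y. \<kappa> * (K y * \<psi> y) \<partial>lborel) - (\<integral>y. c * K y \<partial>lborel)"
    by (simp add: intK)
  also have "\<dots> = (\<integral>y. \<kappa> * (K y * \<psi> y) - c * K y \<partial>lborel)"
    by (rule Bochner_Integration.integral_diff[symmetric]) (use int2 intK in auto)
  finally have "ennreal (\<kappa> * \<bar>\<integral>y. K y * \<psi> y \<partial>lborel\<bar>) = ennreal (norm (\<integral>y. \<kappa> * (K y * \<psi> y) - c * K y \<partial>lborel))"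
    by (metis \<kappa>_def abs_mult abs_of_nonneg measure_nonneg real_norm_def)
  also have "\<dots> \<le> (\<integral>\<^sup>+y. ennreal (norm (\<kappa> * (K y * \<psi> y) - c * K y)) \<partial>lborel)"
    by (rule integral_norm_bound_ennreal) (use int2 intK in auto)
  also have "\<dots> \<le> (\<integral>\<^sup>+y. \<integral>\<^sup>+v. ennreal (f y * \<bar>\<psi> y - \<psi> v\<bar>) * indicator (ball 0 1) v \<partial>lborel \<partial>lborel)"
  proof (rule nn_integral_mono)
    fix y :: 'a
    have int3: "integrable lborel (\<lambda>v. indicator (ball 0 1) v * \<psi> y :: real)"
      by (intro integrable_mult_left integrable_real_indicator) (auto intro: emeasure_ball_less_top[unfolded infinity_ennreal_def])
    have e: "\<kappa> * \<psi> y - c = (\<integral>v. indicator (ball 0 1) v * \<psi> y - indicator (ball 0 1) v * \<psi> v \<partial>lborel)"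
      by (subst Bochner_Integration.integral_diff) (use int1 int3 in \<open>auto simp: c_def \<kappa>_def\<close>)
    have "ennreal \<bar>\<kappa> * \<psi> y - c\<bar> \<le> (\<integral>\<^sup>+v. ennreal (norm (indicator (ball 0 1) v * \<psi> y - indicator (ball 0 1) v * \<psi> v)) \<partial>lborel)"
      unfolding e real_norm_def[symmetric] by (rule integral_norm_bound_ennreal) (use int1 int3 in auto)
    also have "\<dots> = (\<integral>\<^sup>+v. ennreal \<bar>\<psi> y - \<psi> v\<bar> * indicator (ball 0 1) v \<partial>lborel)"
      by (intro nn_integral_cong) (auto simp: indicator_def)
    finally have b: "ennreal \<bar>\<kappa> * \<psi> y - c\<bar> \<le> \<dots>" .
    have "norm (\<kappa> * (K y * \<psi> y) - c * K y) = \<bar>K y\<bar> * \<bar>\<kappa> * \<psi> y - c\<bar>"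
      by (simp add: algebra_simps flip: abs_mult)
    also have "\<dots> \<le> f y * \<bar>\<kappa> * \<psi> y - c\<bar>" using Kf by (intro mult_right_mono) auto
    finally have "ennreal (norm (\<kappa> * (K y * \<psi> y) - c * K y)) \<le> ennreal (f y) * ennreal \<bar>\<kappa> * \<psi> y - c\<bar>"
      by (simp add: ennreal_leI flip: ennreal_mult'')
    also have "\<dots> \<le> ennreal (f y) * (\<integral>\<^sup>+v. ennreal \<bar>\<psi> y - \<psi> v\<bar> * indicator (ball 0 1) v \<partial>lborel)"
      using b by (rule mult_left_mono) simp
    also have "\<dots> = (\<integral>\<^sup>+v. ennreal (f y) * (ennreal \<bar>\<psi> y - \<psi> v\<bar> * indicator (ball 0 1) v) \<partial>lborel)"
      by (rule nn_integral_cmult[symmetric]) measurable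
    also have "\<dots> = (\<integral>\<^sup>+v. ennreal (f y * \<bar>\<psi> y - \<psi> v\<bar>) * indicator (ball 0 1) v \<partial>lborel)"
      by (simp add: ennreal_mult'' mult.assoc)
    finally show "ennreal (norm (\<kappa> * (K y * \<psi> y) - c * K y)) \<le> \<dots>" .
  qed
  finally show ?thesis unfolding \<kappa>_def .
qed

subsection \<open>Homogeneous kernels of mean zero\<close>

lemma homogeneous_ball_nn_integral:
  fixes h :: "'a::euclidean_space \<Rightarrow> ennreal"
  assumes [measurable]: "h \<in> borel_measurable borel"
    and hom: "\<And>c y. c > 0 \<Longrightarrow> h (c *\<^sub>R y) = h y" and "r > 0"
  shows "(\<integral>\<^sup>+y. h y * indicator (ball 0 r) y \<partial>lborel)
    = ennreal (r ^ DIM('a)) * (\<integral>\<^sup>+y. h y * indicator (ball 0 1) y \<partial>lborel)"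
proof -
  have "(\<integral>\<^sup>+y. h y * indicator (ball 0 r) y \<partial>lborel)
    = ennreal (\<bar>r\<bar> ^ DIM('a)) * (\<integral>\<^sup>+y. h (0 + r *\<^sub>R y) * indicator (ball 0 r) (0 + r *\<^sub>R y) \<partial>lborel)"
    by (rule nn_integral_lborel_affine) (use \<open>r > 0\<close> in auto)
  also have "(\<integral>\<^sup>+y. h (0 + r *\<^sub>R y) * indicator (ball 0 r) (0 + r *\<^sub>R y) \<partial>lborel)
    = (\<integral>\<^sup>+y. h y * indicator (ball 0 1) y \<partial>lborel)"
    using hom \<open>r > 0\<close> by (intro nn_integral_cong) (auto simp: indicator_def)
  finally show ?thesis using \<open>r > 0\<close> by simp
qed

text \<open>The push-forwards of the positive and the negative part of \<open>w\<close> under \<open>y \<mapsto> - norm y\<close>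
  agree on half-lines by homogeneity, hence everywhere.\<close>

lemma homogeneous_mean_zero_radial:
  fixes w :: "'a::euclidean_space \<Rightarrow> real" and k :: "real \<Rightarrow> real"
  assumes [measurable]: "w \<in> borel_measurable borel" "k \<in> borel_measurable borel"
    and hom: "\<And>c y. c > 0 \<Longrightarrow> w (c *\<^sub>R y) = w y"
    and int: "integrable lborel (\<lambda>y. indicator (ball 0 1) y * w y)"
    and zero: "(\<integral>y. indicator (ball 0 1) y * w y \<partial>lborel) = 0"
    and k: "\<And>r. k r \<ge> 0"
    and intk: "integrable lborel (\<lambda>y. indicator (ball 0 1) y * w y * k (norm y))"
  shows "(\<integral>y. indicator (ball 0 1) y * w y * k (norm y) \<partial>lborel) = 0"
proof -
  \<comment> \<open>\<open>ennreal\<close> sends negative reals to 0, so \<open>P w\<close> and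
    \<open>P (\<lambda>y. - w y)\<close> are the masses of the positive and the negative part;
    vanishing mean makes them equal.\<close>
  define P where "P u = (\<integral>\<^sup>+y. ennreal (u y) * indicator (ball 0 1) y \<partial>lborel)" for u :: "'a \<Rightarrow> real"
  have "(\<integral>\<^sup>+y. ennreal (indicator (ball 0 1) y * w y) \<partial>lborel) = P w"
    unfolding P_def by (intro nn_integral_cong) (auto simp: indicator_def)
  moreover have "(\<integral>\<^sup>+y. ennreal (- (indicator (ball 0 1) y * w y)) \<partial>lborel) = P (\<lambda>y. - w y)"
    unfolding P_def by (intro nn_integral_cong) (auto simp: indicator_def)
  ultimately have fin: "P w \<noteq> \<infinity>" "P (\<lambda>y. - w y) \<noteq> \<infinity>" and "enn2real (P w) = enn2real (P (\<lambda>y. - w y))"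
    using int zero by (auto simp: real_integrable_def real_lebesgue_integral_def[OF int])
  then have Peq: "P w = P (\<lambda>y. - w y)"
    by (metis ennreal_enn2real infinity_ennreal_def top.not_eq_extremum)
  \<comment> \<open>The sign is chosen because measures are compared on half-lines
    \<open>{x<..}\<close>: the preimage of such a half-line under \<open>- norm y\<close> is the
    ball of radius - x. The profile is then evaluated as \<open>k (- r)\<close>.\<close>
  define M where "M u = distr (density lborel (\<lambda>y. ennreal (u y) * indicator (ball 0 1) y)) borel (\<lambda>y. - norm y)"
    for u :: "'a \<Rightarrow> real"
  have emM: "emeasure (M u) {x<..} = (if x < 0 then ennreal ((min 1 (- x)) ^ DIM('a)) * P u else 0)"
    if [measurable]: "u \<in> borel_measurable borel" and homu: "\<And>c y. c > 0 \<Longrightarrow> u (c *\<^sub>R y) = u y" for u x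
  proof -
    have "(\<lambda>y::'a. - norm y) -` {x<..} = {y. x < - norm y}" by auto
    moreover have "{y::'a. x < - norm y} \<in> sets borel" by measurable
    ultimately have [measurable]: "(\<lambda>y::'a. - norm y) -` {x<..} \<in> sets borel" by simp
    have "emeasure (M u) {x<..} = (\<integral>\<^sup>+y. ennreal (u y) * indicator (ball 0 1) y * indicator ((\<lambda>y. - norm y) -` {x<..}) y \<partial>lborel)"
      unfolding M_def by (simp add: emeasure_distr emeasure_density)
    also have "\<dots> = (\<integral>\<^sup>+y. ennreal (u y) * indicator (ball 0 (min 1 (- x))) y \<partial>lborel)"
      by (intro nn_integral_cong) (auto simp: indicator_def)
    also have "\<dots> = (if x < 0 then ennreal ((min 1 (- x)) ^ DIM('a)) * P u else 0)"
    proof (cases "x < 0")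
      case True
      then show ?thesis unfolding P_def
        by (subst homogeneous_ball_nn_integral) (auto simp: homu)
    next
      case False
      then have empty: "ball (0::'a) (min 1 (- x)) = {}" by auto
      show ?thesis unfolding empty using False by simp
    qed
    finally show ?thesis .
  qed
  have "M w = M (\<lambda>y. - w y)"
  proof (rule measure_eqI_lessThan)
    show "emeasure (M w) {x<..} < \<infinity>" for x
      using fin by (subst emM) (auto simp: hom ennreal_mult_less_top less_top)
    show "emeasure (M w) {x<..} = emeasure (M (\<lambda>y. - w y)) {x<..}" for x
      by (subst (1 2) emM) (auto simp: hom Peq)
  qed (auto simp: M_def)
  moreover have "(\<integral>\<^sup>+r. ennreal (k (- r)) \<partial>M u) = (\<integral>\<^sup>+y. ennreal (indicator (ball 0 1) y * u y * k (norm y)) \<partial>lborel)"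
    if [measurable]: "u \<in> borel_measurable borel" for u
    unfolding M_def using k
    by (simp add: nn_integral_distr nn_integral_density)
      (intro nn_integral_cong, auto simp: indicator_def ennreal_mult'')
  from this[of w] this[of "\<lambda>y. - w y"] calculation
  have "(\<integral>\<^sup>+y. ennreal (indicator (ball 0 1) y * w y * k (norm y)) \<partial>lborel)
    = (\<integral>\<^sup>+y. ennreal (- (indicator (ball 0 1) y * w y * k (norm y))) \<partial>lborel)"
    by simp
  then show ?thesis by (simp add: real_lebesgue_integral_def[OF intk])
qed

text \<open>Data on the sphere are carried to the unit ball: for a function homogeneous of degree 0,
  the integral over the ball is 1/n times that over the sphere. \<open>W\<close> is a positive upper
  bound rather than the exact value, so that it can be divided by even if w vanishes almost
  everywhere.\<close>

locale homogeneous_kernel =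
  fixes w :: "'a::euclidean_space \<Rightarrow> real" and \<rho> W :: real
  assumes w_borel[measurable]: "w \<in> borel_measurable borel"
    and w_hom: "\<And>c y. c > 0 \<Longrightarrow> w (c *\<^sub>R y) = w y"
    and \<rho>: "1 < \<rho>"
    and w_Lp: "(\<integral>\<^sup>+y. ennreal (\<bar>w y\<bar> powr \<rho>) * indicator (ball 0 1) y \<partial>lborel) \<le> ennreal W"
    and W_pos: "W > 0"
    and w_mean: "(\<integral>y. indicator (ball 0 1) y * w y \<partial>lborel) = 0"
begin

lemma abs_w_integrable:
  assumes "r > 0"
  shows "integrable lborel (\<lambda>y. indicator (ball 0 r) y * \<bar>w y\<bar>)"
proof -
  have b: "u \<le> 1 + u powr \<rho>" if "u \<ge> 0" for u :: real
  proof (cases "u \<le> 1")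
    case False
    then have "u powr 1 \<le> u powr \<rho>" using \<rho> by (intro powr_mono) auto
    then show ?thesis using False by simp
  qed (simp add: add_increasing2)
  have "(\<integral>\<^sup>+y. ennreal \<bar>w y\<bar> * indicator (ball 0 1) y \<partial>lborel)
    \<le> (\<integral>\<^sup>+y. indicator (ball 0 1) y + ennreal (\<bar>w y\<bar> powr \<rho>) * indicator (ball 0 1) y \<partial>lborel)"
  proof (intro nn_integral_mono)
    fix y :: 'a
    have "ennreal \<bar>w y\<bar> \<le> ennreal (1 + \<bar>w y\<bar> powr \<rho>)" by (intro ennreal_leI b) simp
    then show "ennreal \<bar>w y\<bar> * indicator (ball 0 1) y
      \<le> indicator (ball 0 1) y + ennreal (\<bar>w y\<bar> powr \<rho>) * indicator (ball 0 1) y"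
      by (auto simp: indicator_def)
  qed
  also have "\<dots> = emeasure lborel (ball (0::'a) 1) + (\<integral>\<^sup>+y. ennreal (\<bar>w y\<bar> powr \<rho>) * indicator (ball 0 1) y \<partial>lborel)"
    by (subst nn_integral_add) auto
  also have "\<dots> < \<infinity>"
    using w_Lp emeasure_ball_less_top[of "0::'a" 1]
    by (auto simp: le_less_trans[OF w_Lp])
  finally have "(\<integral>\<^sup>+y. ennreal \<bar>w y\<bar> * indicator (ball 0 r) y \<partial>lborel) < \<infinity>"
    using \<open>r > 0\<close> by (subst homogeneous_ball_nn_integral) (auto simp: w_hom ennreal_mult_less_top)
  moreover have "(\<integral>\<^sup>+y. ennreal (norm (indicator (ball 0 r) y * \<bar>w y\<bar>)) \<partial>lborel)
    = (\<integral>\<^sup>+y. ennreal \<bar>w y\<bar> * indicator (ball 0 r) y \<partial>lborel)"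
    by (intro nn_integral_cong) (auto simp: indicator_def)
  ultimately show ?thesis
    by (intro integrableI_bounded) auto
qed

definition annulus :: "real \<Rightarrow> real \<Rightarrow> 'a set" where
  "annulus a b = {y. a < norm y \<and> norm y < b}"

lemma annulus_borel[measurable]: "annulus a b \<in> sets borel"
  unfolding annulus_def by measurable

text \<open>Away from the origin the factor multiplying w is continuous on a compact shell, hence
  bounded there, and w is integrable on balls.\<close>

lemma annulus_integrable:
  fixes \<psi> :: "'a \<Rightarrow> real"
  assumes "0 < a" and \<psi>: "continuous_on UNIV \<psi>"
  shows "integrable lborel (\<lambda>y. indicator (annulus a b) y * (w y * norm y powr - m * \<psi> y))"
proof (cases "a < b")
  case False
  then have "annulus a b = {}" by (auto simp: annulus_def)
  then show ?thesis by simp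
next
  case True
  then have "b > 0" using assms by simp
  have [measurable]: "\<psi> \<in> borel_measurable borel" using \<psi> by (rule borel_measurable_continuous_onI)
  let ?k = "\<lambda>y::'a. norm y powr - m * \<psi> y"
  let ?S = "cball (0::'a) b - ball 0 a"
  have "continuous_on ?S \<psi>" using \<psi> by (rule continuous_on_subset) simp
  then have "continuous_on ?S ?k" using \<open>0 < a\<close> by (auto intro!: continuous_intros)
  moreover have "compact ?S" by (intro compact_diff) auto
  ultimately obtain M where M: "\<And>y. y \<in> ?S \<Longrightarrow> \<bar>?k y\<bar> \<le> M"
    using continuous_on_compact_abs_bound by blast
  show ?thesis
  proof (rule Bochner_Integration.integrable_bound)
    show "integrable lborel (\<lambda>y. (indicator (ball 0 b) y * \<bar>w y\<bar>) * M)"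
      using abs_w_integrable[OF \<open>b > 0\<close>] by (rule integrable_mult_left)
    show "AE y in lborel. norm (indicator (annulus a b) y * (w y * norm y powr - m * \<psi> y))
      \<le> norm ((indicator (ball 0 b) y * \<bar>w y\<bar>) * M)"
    proof (rule AE_I2)
      fix y :: 'a
      show "norm (indicator (annulus a b) y * (w y * norm y powr - m * \<psi> y))
        \<le> norm ((indicator (ball 0 b) y * \<bar>w y\<bar>) * M)"
      proof (cases "y \<in> annulus a b")
        case True
        then have "\<bar>?k y\<bar> \<le> \<bar>M\<bar>" using M[of y] by (auto simp: annulus_def)
        then have "\<bar>w y\<bar> * \<bar>?k y\<bar> \<le> \<bar>w y\<bar> * \<bar>M\<bar>" by (rule mult_left_mono) simp
        then show ?thesis using True by (auto simp: annulus_def abs_mult mult.assoc)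
      qed simp
    qed
  qed measurable
qed

lemma annulus_kernel_mean_zero:
  assumes "0 < a"
  shows "(\<integral>y. indicator (annulus a 1) y * (w y * norm y powr - m) \<partial>lborel) = 0"
proof -
  \<comment> \<open>The inner cut-off and the power are both radial, so together they form a single
    profile for \<open>homogeneous_mean_zero_radial\<close>.\<close>
  have e: "indicator (annulus a 1) y * (w y * norm y powr - m)
    = indicator (ball 0 1) y * w y * (indicator {a<..} (norm y) * norm y powr - m)" for y
    by (auto simp: annulus_def indicator_def)
  have "integrable lborel (\<lambda>y. indicator (ball 0 1) y * w y)"
    using abs_w_integrable[of 1]
    by (rule Bochner_Integration.integrable_bound) (auto simp: indicator_def)
  moreover have "integrable lborel (\<lambda>y. indicator (annulus a 1) y * (w y * norm y powr - m))"
    using annulus_integrable[OF assms, of "\<lambda>_. 1" 1 m] by simp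
  ultimately show ?thesis
    unfolding e by (intro homogeneous_mean_zero_radial w_hom w_mean) auto
qed

text \<open>On an annulus with inner radius at least 1/2 the power of the norm is at most 2^m, so
  the kernel is dominated by a multiple of |w| and keeps its mean zero. The constant is quantified
  before \<psi>, D, a and I because it is reused for all rescalings.\<close>

lemma unit_annulus_bound:
  assumes p: "1 < p" "1 \<le> 1 / \<rho> + 1 / p" "1 / \<rho> + 1 / p < 1 + 1 / real DIM('a)" and m: "m \<ge> 0"
  shows "\<exists>C>0. \<forall>(\<psi>::'a \<Rightarrow> real) D a I. (\<forall>y. (\<psi> has_derivative (\<lambda>h. D y \<bullet> h)) (at y)) \<longrightarrow>
    continuous_on UNIV D \<longrightarrow> 1 / 2 \<le> a \<longrightarrow>
    (\<integral>\<^sup>+y. ennreal (norm (D y) powr p) * indicator (ball 0 1) y \<partial>lborel) \<le> ennreal I \<longrightarrow> I \<ge> 0 \<longrightarrow>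
    \<bar>\<integral>y. indicator (annulus a 1) y * (w y * norm y powr - m * \<psi> y) \<partial>lborel\<bar> \<le> C * I powr (1 / p)"
proof -
  define n where "n = real DIM('a)"
  define \<kappa> where "\<kappa> = measure lborel (ball (0::'a) 1)"
  have \<kappa>: "\<kappa> > 0" by (simp add: \<kappa>_def)
  define f where "f y = 2 powr m * \<bar>w y\<bar> * indicator (ball 0 1) y" for y
  have [measurable]: "f \<in> borel_measurable borel" unfolding f_def by measurable
  define F where "F = 2 powr (m * \<rho>) * W"
  have F0: "F > 0" using W_pos by (simp add: F_def)
  have "(\<integral>\<^sup>+y. ennreal (f y powr \<rho>) \<partial>lborel)
    = (\<integral>\<^sup>+y. ennreal (2 powr (m * \<rho>)) * (ennreal (\<bar>w y\<bar> powr \<rho>) * indicator (ball 0 1) y) \<partial>lborel)"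
    by (intro nn_integral_cong) (auto simp: f_def indicator_def powr_mult powr_powr ennreal_mult)
  also have "\<dots> = ennreal (2 powr (m * \<rho>)) * (\<integral>\<^sup>+y. ennreal (\<bar>w y\<bar> powr \<rho>) * indicator (ball 0 1) y \<partial>lborel)"
    by (rule nn_integral_cmult) measurable
  also have "\<dots> \<le> ennreal (2 powr (m * \<rho>)) * ennreal W"
    using w_Lp by (rule mult_left_mono) simp
  finally have F: "(\<integral>\<^sup>+y. ennreal (f y powr \<rho>) \<partial>lborel) \<le> ennreal F"
    unfolding F_def using W_pos by (simp add: ennreal_mult)
  define c where "c = 2 * measure lborel (ball (0::'a) 2) powr (2 - 1 / \<rho> - 1 / p) / (1 - n + n * (2 - 1 / \<rho> - 1 / p))"
  have "1 - n + n * (2 - 1 / \<rho> - 1 / p) > 0"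
  proof -
    have n: "n > 0" by (simp add: n_def)
    have "n * (1 / \<rho> + 1 / p) < n * (1 + 1 / n)" using p(3) n unfolding n_def[symmetric] by (rule mult_strict_left_mono)
    then show ?thesis using n by (simp add: algebra_simps)
  qed
  then have c: "c > 0" by (auto simp: c_def)
  define C where "C = c * F powr (1 / \<rho>) / \<kappa>"
  have C: "C > 0" using c F0 \<kappa> by (simp add: C_def)
  \<comment> \<open>The pairing divides by I, so this first version assumes I > 0.\<close>
  have pos_bound: "\<bar>\<integral>y. indicator (annulus a 1) y * (w y * norm y powr - m * \<psi> y) \<partial>lborel\<bar> \<le> C * I powr (1 / p)"
    if der: "\<forall>y. (\<psi> has_derivative (\<lambda>h. D y \<bullet> h)) (at y)" and cont: "continuous_on UNIV D" and a: "1 / 2 \<le> a"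
      and I: "(\<integral>\<^sup>+y. ennreal (norm (D y) powr p) * indicator (ball 0 1) y \<partial>lborel) \<le> ennreal I" "I > 0"
    for \<psi> :: "'a \<Rightarrow> real" and D and a I :: real
  proof -
    define K where "K y = indicator (annulus a 1) y * (w y * norm y powr - m)" for y
    have [measurable]: "K \<in> borel_measurable borel" unfolding K_def by measurable
    have "\<psi> differentiable (at y)" for y using der unfolding differentiable_def by blast
    then have cont\<psi>: "continuous_on UNIV \<psi>"
      by (simp add: continuous_on_eq_continuous_within differentiable_imp_continuous_within)
    have Kf: "\<bar>K y\<bar> \<le> f y" for y
    proof (cases "y \<in> annulus a 1")
      case True
      then have "norm y powr - m \<le> (1/2) powr - m"
        using m a by (intro powr_mono2') (auto simp: annulus_def)
      also have "\<dots> = 2 powr m" by (simp add: powr_minus powr_divide)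
      finally have "\<bar>w y\<bar> * norm y powr - m \<le> \<bar>w y\<bar> * 2 powr m" by (rule mult_left_mono) simp
      then show ?thesis using True by (simp add: K_def f_def annulus_def abs_mult mult.commute)
    qed (simp add: K_def f_def)
    have "ennreal (\<kappa> * \<bar>\<integral>y. K y * \<psi> y \<partial>lborel\<bar>)
      \<le> (\<integral>\<^sup>+y. \<integral>\<^sup>+v. ennreal (f y * \<bar>\<psi> y - \<psi> v\<bar>) * indicator (ball 0 1) v \<partial>lborel \<partial>lborel)"
      unfolding \<kappa>_def
    proof (rule mean_zero_pairing)
      show "integrable lborel K"
        using annulus_integrable[of a "\<lambda>_. 1" 1 m] a unfolding K_def by simp
      show "integral\<^sup>L lborel K = 0"
        using annulus_kernel_mean_zero[of a m] a unfolding K_def by simp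
    qed (use Kf cont\<psi> in \<open>auto simp: K_def annulus_def\<close>)
    also have "\<dots> \<le> ennreal (c * F powr (1 / \<rho>) * I powr (1 / p))"
      unfolding c_def n_def
      by (rule sobolev_poincare_pairing[where D = D]) (use der cont \<rho> p F F0 I in \<open>auto simp: f_def\<close>)
    finally have "\<kappa> * \<bar>\<integral>y. K y * \<psi> y \<partial>lborel\<bar> \<le> c * F powr (1 / \<rho>) * I powr (1 / p)"
      using c by (subst (asm) ennreal_le_iff) auto
    then show ?thesis
      using \<kappa> by (simp add: C_def K_def field_simps)
  qed
  show ?thesis
  proof (intro exI[of _ C] conjI C allI impI)
    fix \<psi> :: "'a \<Rightarrow> real" and D and a I :: real
    assume h: "\<forall>y. (\<psi> has_derivative (\<lambda>h. D y \<bullet> h)) (at y)" "continuous_on UNIV D" "1 / 2 \<le> a"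
      "(\<integral>\<^sup>+y. ennreal (norm (D y) powr p) * indicator (ball 0 1) y \<partial>lborel) \<le> ennreal I" "I \<ge> 0"
    \<comment> \<open>A bound I for the gradient integral is also bounded by every J > I, and J > 0.
      Letting J decrease to I covers I = 0, a gradient that vanishes on the ball.\<close>
    have ev: "\<forall>\<^sub>F J in at_right I. \<bar>\<integral>y. indicator (annulus a 1) y * (w y * norm y powr - m * \<psi> y) \<partial>lborel\<bar> \<le> C * J powr (1 / p)"
    proof (rule eventually_at_rightI[of I "I + 1"])
      fix J assume "J \<in> {I<..<I + 1}"
      then show "\<bar>\<integral>y. indicator (annulus a 1) y * (w y * norm y powr - m * \<psi> y) \<partial>lborel\<bar> \<le> C * J powr (1 / p)"
        using h by (intro pos_bound[where D = D]) (auto intro: order_trans[OF _ ennreal_leI])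
    qed simp
    have "((\<lambda>J. C * J powr (1 / p)) \<longlongrightarrow> C * I powr (1 / p)) (at_right I)"
    proof (intro tendsto_mult tendsto_const tendsto_powr')
      show "I \<noteq> 0 \<or> 0 < 1 / p \<and> (\<forall>\<^sub>F x in at_right I. 0 \<le> x)"
        using h(5) p by (auto intro: eventually_mono[OF eventually_at_right_less])
    qed auto
    then show "\<bar>\<integral>y. indicator (annulus a 1) y * (w y * norm y powr - m * \<psi> y) \<partial>lborel\<bar> \<le> C * I powr (1 / p)"
      by (rule tendsto_lowerbound[OF _ ev]) simp
  qed
qed

end

subsection \<open>Truncated singular integrals and ball means\<close>

lemma nn_integral_ball_continuous_finite:
  fixes h :: "'a::euclidean_space \<Rightarrow> real"
  assumes h: "continuous_on UNIV h"
  shows "(\<integral>\<^sup>+z. ennreal (h z) * indicator (ball c r) z \<partial>lborel) < \<infinity>"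
proof -
  obtain M where M: "\<And>y. y \<in> cball c r \<Longrightarrow> \<bar>h y\<bar> \<le> M"
    using continuous_on_compact_abs_bound[OF compact_cball continuous_on_subset[OF h subset_UNIV]] by blast
  have "(\<integral>\<^sup>+z. ennreal (h z) * indicator (ball c r) z \<partial>lborel) \<le> (\<integral>\<^sup>+z. ennreal M * indicator (ball c r) z \<partial>lborel)"
  proof (intro nn_integral_mono)
    fix z
    show "ennreal (h z) * indicator (ball c r) z \<le> ennreal M * indicator (ball c r) z"
      using M[of z] by (auto simp: indicator_def intro!: ennreal_leI)
  qed
  also have "\<dots> = ennreal M * emeasure lborel (ball c r)" by (simp add: nn_integral_cmult)
  also have "\<dots> < \<infinity>" using emeasure_ball_less_top[of c r] by (simp add: ennreal_mult_less_top)
  finally show ?thesis .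
qed

text \<open>The reflected argument x - z matches the convolution in the operator and keeps the ball
  centred at 0, so that translations act on g alone.\<close>

definition ball_integral :: "real \<Rightarrow> ('a::euclidean_space \<Rightarrow> real) \<Rightarrow> 'a \<Rightarrow> real \<Rightarrow> ennreal" where
  "ball_integral p g x r = (\<integral>\<^sup>+z. ennreal (g (x - z) powr p) * indicator (ball 0 r) z \<partial>lborel)"

text \<open>Up to the p-th root of the volume of the unit ball, this is the L^p average over the
  ball of radius r around x. For continuous nonnegative g and p > 0 the integral is finite, so
  \<open>enn2real\<close> then loses nothing.\<close>

definition ball_mean :: "real \<Rightarrow> ('a::euclidean_space \<Rightarrow> real) \<Rightarrow> 'a \<Rightarrow> real \<Rightarrow> real" where
  "ball_mean p g x r = (r powr - real DIM('a) * enn2real (ball_integral p g x r)) powr (1 / p)"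

text \<open>With p = 1 and all positive radii, Fubini would turn this into a multiple of the Riesz
  potential of order 1 + \<alpha> of g (for 1 + \<alpha> < n). The set A of radii is a parameter so
  that single annuli and tails can be charged to parts of the same integral.\<close>

definition mean_potential :: "real \<Rightarrow> real \<Rightarrow> ('a::euclidean_space \<Rightarrow> real) \<Rightarrow> 'a \<Rightarrow> real set \<Rightarrow> ennreal" where
  "mean_potential \<alpha> p g x A =
     (\<integral>\<^sup>+r. ennreal (r powr \<alpha> * ball_mean p g x r) * indicator A r \<partial>lborel)"

lemma ball_mean_nonneg: "ball_mean p g x r \<ge> 0"
  by (simp add: ball_mean_def)

lemma ball_integral_finite:
  assumes g: "continuous_on UNIV g" "\<And>z. g z \<ge> 0" and "p > 0"
  shows "ball_integral p g x r < \<infinity>"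
  unfolding ball_integral_def
proof (rule nn_integral_ball_continuous_finite)
  have "continuous_on UNIV (\<lambda>z. g (x - z))"
    by (rule continuous_on_compose2[OF g(1)]) (auto intro!: continuous_intros)
  then show "continuous_on UNIV (\<lambda>z. g (x - z) powr p)"
    using g(2) \<open>p > 0\<close> by (intro continuous_on_powr') (auto intro!: continuous_intros)
qed

lemma ball_integral_mono: "r \<le> r' \<Longrightarrow> ball_integral p g x r \<le> ball_integral p g x r'"
  unfolding ball_integral_def by (intro nn_integral_mono mult_left_mono) (auto simp: indicator_def)

lemma measurable_ball_integral[measurable]:
  fixes g :: "'a::euclidean_space \<Rightarrow> real"
  assumes [measurable]: "g \<in> borel_measurable borel"
  shows "(\<lambda>(x, r). ball_integral p g x r) \<in> borel_measurable (borel \<Otimes>\<^sub>M borel)"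
  unfolding ball_integral_def indicator_def mem_ball by measurable

lemma measurable_ball_mean[measurable]:
  fixes g :: "'a::euclidean_space \<Rightarrow> real"
  assumes [measurable]: "g \<in> borel_measurable borel"
  shows "(\<lambda>(x, r). ball_mean p g x r) \<in> borel_measurable (borel \<Otimes>\<^sub>M borel)"
  unfolding ball_mean_def by measurable

lemma measurable_mean_potential[measurable]:
  fixes g :: "'a::euclidean_space \<Rightarrow> real"
  assumes [measurable]: "g \<in> borel_measurable borel" "A \<in> sets borel"
  shows "(\<lambda>x. mean_potential \<alpha> p g x A) \<in> borel_measurable borel"
  unfolding mean_potential_def by measurable

text \<open>The integral over the ball grows with the radius, while the normalisation r^(-n) drops
  by at most 2^n; the p-th root gives 2^(n/p).\<close>

lemma ball_mean_doubling:
  fixes g :: "'a::euclidean_space \<Rightarrow> real"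
  assumes g: "continuous_on UNIV g" "\<And>z. g z \<ge> 0" and p: "p > 0" and r: "0 < b" "b \<le> r" "r \<le> 2 * b"
  shows "ball_mean p g x b \<le> 2 powr (real DIM('a) / p) * ball_mean p g x r"
proof -
  let ?n = "real DIM('a)"
  have "enn2real (ball_integral p g x b) \<le> enn2real (ball_integral p g x r)"
    using r ball_integral_finite[OF g p] by (intro enn2real_mono ball_integral_mono) auto
  moreover have "b powr - ?n \<le> 2 powr ?n * r powr - ?n"
  proof -
    have "(2 * b) powr - ?n \<le> r powr - ?n" using r by (intro powr_mono2') auto
    then show ?thesis using r by (simp add: powr_mult powr_minus field_simps)
  qed
  ultimately have "b powr - ?n * enn2real (ball_integral p g x b)
      \<le> (2 powr ?n * r powr - ?n) * enn2real (ball_integral p g x r)"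
    by (intro mult_mono) auto
  then have "ball_mean p g x b \<le> ((2 powr ?n * r powr - ?n) * enn2real (ball_integral p g x r)) powr (1 / p)"
    unfolding ball_mean_def using p by (intro powr_mono2) auto
  also have "\<dots> = 2 powr (?n / p) * ball_mean p g x r"
    unfolding ball_mean_def by (simp add: powr_mult powr_powr mult_ac)
  finally show ?thesis .
qed

context homogeneous_kernel
begin

definition annulus_integral :: "real \<Rightarrow> ('a \<Rightarrow> real) \<Rightarrow> 'a \<Rightarrow> real \<Rightarrow> real \<Rightarrow> real" where
  "annulus_integral m \<phi> x a b =
     (\<integral>y. indicator (annulus a b) y * (w y * norm y powr - m * \<phi> (x - y)) \<partial>lborel)"

lemma annulus_integral_rescale:
  assumes [measurable]: "\<phi> \<in> borel_measurable borel" and b: "b > 0"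
  shows "annulus_integral m \<phi> x a b = b powr (real DIM('a) - m) *
    (\<integral>y. indicator (annulus (a / b) 1) y * (w y * norm y powr - m * \<phi> (x - b *\<^sub>R y)) \<partial>lborel)"
proof -
  have "annulus_integral m \<phi> x a b = \<bar>b\<bar> ^ DIM('a) * (\<integral>y. indicator (annulus a b) (0 + b *\<^sub>R y)
      * (w (0 + b *\<^sub>R y) * norm (0 + b *\<^sub>R y) powr - m * \<phi> (x - (0 + b *\<^sub>R y))) \<partial>lborel)"
    unfolding annulus_integral_def using b by (intro integral_lborel_affine) auto
  also have "(\<integral>y. indicator (annulus a b) (0 + b *\<^sub>R y)
      * (w (0 + b *\<^sub>R y) * norm (0 + b *\<^sub>R y) powr - m * \<phi> (x - (0 + b *\<^sub>R y))) \<partial>lborel)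
    = (\<integral>y. b powr - m * (indicator (annulus (a / b) 1) y * (w y * norm y powr - m * \<phi> (x - b *\<^sub>R y))) \<partial>lborel)"
    using b by (intro Bochner_Integration.integral_cong)
      (auto simp: annulus_def indicator_def w_hom powr_mult field_simps)
  also have "\<bar>b\<bar> ^ DIM('a) = b powr real DIM('a)" using b by (simp add: powr_realpow)
  finally show ?thesis using b by (simp add: powr_diff powr_minus divide_inverse)
qed

text \<open>Everything is scaled to outer radius 1. The Jacobian and the kernel contribute b^(n -
  m), and the gradient of y \<mapsto> \<phi> (x - b y) carries one more factor b.\<close>

lemma annulus_integral_le_ball_mean:
  assumes p: "1 < p" "1 \<le> 1 / \<rho> + 1 / p" "1 / \<rho> + 1 / p < 1 + 1 / real DIM('a)" and m: "m \<ge> 0"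
  shows "\<exists>C>0. \<forall>(\<phi>::'a \<Rightarrow> real) D x a b. (\<forall>y. (\<phi> has_derivative (\<lambda>h. D y \<bullet> h)) (at y)) \<longrightarrow>
    continuous_on UNIV D \<longrightarrow> 0 < b \<longrightarrow> b / 2 \<le> a \<longrightarrow>
    \<bar>annulus_integral m \<phi> x a b\<bar> \<le> C * (b powr (real DIM('a) - m + 1) * ball_mean p (\<lambda>z. norm (D z)) x b)"
proof -
  obtain C where C: "C > 0" and bound: "\<And>(\<psi>::'a \<Rightarrow> real) D a I. (\<forall>y. (\<psi> has_derivative (\<lambda>h. D y \<bullet> h)) (at y)) \<Longrightarrow>
    continuous_on UNIV D \<Longrightarrow> 1 / 2 \<le> a \<Longrightarrow>
    (\<integral>\<^sup>+y. ennreal (norm (D y) powr p) * indicator (ball 0 1) y \<partial>lborel) \<le> ennreal I \<Longrightarrow> I \<ge> 0 \<Longrightarrow>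
    \<bar>\<integral>y. indicator (annulus a 1) y * (w y * norm y powr - m * \<psi> y) \<partial>lborel\<bar> \<le> C * I powr (1 / p)"
    using unit_annulus_bound[OF p m] by blast
  show ?thesis
  proof (intro exI[of _ C] conjI C allI impI)
    fix \<phi> :: "'a \<Rightarrow> real" and D x and a b :: real
    assume der: "\<forall>y. (\<phi> has_derivative (\<lambda>h. D y \<bullet> h)) (at y)" and cont: "continuous_on UNIV D"
      and b: "0 < b" "b / 2 \<le> a"
    have [measurable]: "D \<in> borel_measurable borel" using cont by (rule borel_measurable_continuous_onI)
    have "\<phi> differentiable (at y)" for y using der unfolding differentiable_def by blast
    then have "continuous_on UNIV \<phi>"
      by (simp add: continuous_on_eq_continuous_within differentiable_imp_continuous_within)
    then have \<phi>[measurable]: "\<phi> \<in> borel_measurable borel" by (rule borel_measurable_continuous_onI)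
    define D' where "D' y = - b *\<^sub>R D (x - b *\<^sub>R y)" for y
    let ?g = "\<lambda>z. norm (D z)"
    have cg: "continuous_on UNIV ?g" using cont by (intro continuous_intros)
    \<comment> \<open>J is the p-th power of the ball mean; the rescaled gradient has integral b^p J
      over the unit ball, whose p-th root is b times the ball mean.\<close>
    define J where "J = b powr - real DIM('a) * enn2real (ball_integral p ?g x b)"
    have J: "J \<ge> 0" by (simp add: J_def)
    have "\<bar>\<integral>y. indicator (annulus (a / b) 1) y * (w y * norm y powr - m * \<phi> (x - b *\<^sub>R y)) \<partial>lborel\<bar>
      \<le> C * (b powr p * J) powr (1 / p)"
    proof (rule bound[where D = D'])
      show "\<forall>y. ((\<lambda>y. \<phi> (x - b *\<^sub>R y)) has_derivative (\<lambda>h. D' y \<bullet> h)) (at y)"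
      proof
        fix y
        have "((\<lambda>y. \<phi> (x - b *\<^sub>R y)) has_derivative (\<lambda>h. D (x - b *\<^sub>R y) \<bullet> (- b *\<^sub>R h))) (at y)"
          by (rule has_derivative_compose[OF _ der[rule_format]]) (auto intro!: derivative_eq_intros)
        then show "((\<lambda>y. \<phi> (x - b *\<^sub>R y)) has_derivative (\<lambda>h. D' y \<bullet> h)) (at y)" by (simp add: D'_def)
      qed
      show "continuous_on UNIV D'" unfolding D'_def
        by (intro continuous_intros continuous_on_compose2[OF cont]) auto
      show "1 / 2 \<le> a / b" using b by (simp add: field_simps)
      show "b powr p * J \<ge> 0" using J by simp
      have "ball_integral p ?g x b = ennreal (\<bar>b\<bar> ^ DIM('a)) *
         (\<integral>\<^sup>+y. ennreal (?g (x - (0 + b *\<^sub>R y)) powr p) * indicator (ball 0 b) (0 + b *\<^sub>R y) \<partial>lborel)"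
        unfolding ball_integral_def using b by (intro nn_integral_lborel_affine) auto
      also have "(\<integral>\<^sup>+y. ennreal (?g (x - (0 + b *\<^sub>R y)) powr p) * indicator (ball 0 b) (0 + b *\<^sub>R y) \<partial>lborel)
        = (\<integral>\<^sup>+y. ennreal (?g (x - b *\<^sub>R y) powr p) * indicator (ball 0 1) y \<partial>lborel)"
        using b by (intro nn_integral_cong) (auto simp: indicator_def)
      finally have e1: "ball_integral p ?g x b = ennreal (b powr real DIM('a)) *
        (\<integral>\<^sup>+y. ennreal (?g (x - b *\<^sub>R y) powr p) * indicator (ball 0 1) y \<partial>lborel)"
        using b by (simp add: powr_realpow)
      have fin: "ball_integral p ?g x b < \<infinity>" using p cg by (intro ball_integral_finite) auto
      have "ennreal J = ennreal (b powr - real DIM('a)) * ball_integral p ?g x b"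
        unfolding J_def using fin by (simp add: ennreal_mult)
      also have "\<dots> = ennreal (b powr - real DIM('a) * b powr real DIM('a)) *
        (\<integral>\<^sup>+y. ennreal (?g (x - b *\<^sub>R y) powr p) * indicator (ball 0 1) y \<partial>lborel)"
        unfolding e1 by (simp add: ennreal_mult mult.assoc)
      also have "b powr - real DIM('a) * b powr real DIM('a) = 1"
        using b by (simp add: powr_minus)
      finally have e2: "ennreal J = (\<integral>\<^sup>+y. ennreal (?g (x - b *\<^sub>R y) powr p) * indicator (ball 0 1) y \<partial>lborel)"
        by simp
      have "(\<integral>\<^sup>+y. ennreal (norm (D' y) powr p) * indicator (ball 0 1) y \<partial>lborel)
        = (\<integral>\<^sup>+y. ennreal (b powr p) * (ennreal (?g (x - b *\<^sub>R y) powr p) * indicator (ball 0 1) y) \<partial>lborel)"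
        using b by (intro nn_integral_cong) (simp add: D'_def powr_mult ennreal_mult mult.assoc)
      also have "\<dots> = ennreal (b powr p) * ennreal J"
        unfolding e2 by (rule nn_integral_cmult) measurable
      finally show "(\<integral>\<^sup>+y. ennreal (norm (D' y) powr p) * indicator (ball 0 1) y \<partial>lborel) \<le> ennreal (b powr p * J)"
        using J by (simp add: ennreal_mult)
    qed
    also have "(b powr p * J) powr (1 / p) = b * ball_mean p ?g x b"
      using b p J by (simp add: powr_mult powr_powr ball_mean_def J_def)
    finally have "b powr (real DIM('a) - m) * \<bar>\<integral>y. indicator (annulus (a / b) 1) y * (w y * norm y powr - m * \<phi> (x - b *\<^sub>R y)) \<partial>lborel\<bar>
      \<le> b powr (real DIM('a) - m) * (C * (b * ball_mean p ?g x b))"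
      by (rule mult_left_mono) simp
    then show "\<bar>annulus_integral m \<phi> x a b\<bar> \<le> C * (b powr (real DIM('a) - m + 1) * ball_mean p ?g x b)"
      using b by (simp add: annulus_integral_rescale[OF \<phi>] abs_mult powr_add mult_ac)
  qed
qed

lemma annulus_integral_split:
  assumes "continuous_on UNIV \<phi>" and "0 < a" "a < c" "c < b"
  shows "annulus_integral m \<phi> x a b = annulus_integral m \<phi> x a c + annulus_integral m \<phi> x c b"
proof -
  have [measurable]: "\<phi> \<in> borel_measurable borel" using assms(1) by (rule borel_measurable_continuous_onI)
  have cont: "continuous_on UNIV (\<lambda>y. \<phi> (x - y))"
    by (rule continuous_on_compose2[OF assms(1)]) (auto intro!: continuous_intros)
  let ?k = "\<lambda>y. w y * norm y powr - m * \<phi> (x - y)"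
  \<comment> \<open>The sphere of radius c belongs to neither open annulus, so additivity holds only
    up to this null set.\<close>
  have "sphere (0::'a) c \<in> null_sets lborel"
    using negligible_sphere[of "0::'a" c] by (auto simp: null_sets_completion_iff negligible_iff_null_sets)
  then have "AE y in lborel. y \<notin> sphere (0::'a) c" by (rule AE_not_in)
  then have "annulus_integral m \<phi> x a b
    = (\<integral>y. indicator (annulus a c) y * ?k y + indicator (annulus c b) y * ?k y \<partial>lborel)"
    unfolding annulus_integral_def using assms
    by (intro integral_cong_AE) (measurable, auto elim!: eventually_mono simp: annulus_def indicator_def)
  also have "\<dots> = annulus_integral m \<phi> x a c + annulus_integral m \<phi> x c b"
    unfolding annulus_integral_def using assms
    by (intro Bochner_Integration.integral_add annulus_integrable cont) auto
  finally show ?thesis .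
qed

text \<open>An annulus of outer radius b and inner radius at least b/2 contributes a multiple of
  b^(1 + \<alpha>) times the ball mean at b. By doubling this is at most a multiple of the potential
  over radii in (b, 2b), an interval of length b. Successive halvings of b use disjoint intervals,
  so the pieces add up to one integral without a geometric series; the top interval is why 2b
  appears.\<close>

lemma annulus_integral_le_mean_potential:
  assumes p: "1 < p" "1 \<le> 1 / \<rho> + 1 / p" "1 / \<rho> + 1 / p < 1 + 1 / real DIM('a)"
    and \<alpha>: "0 \<le> \<alpha>" "\<alpha> \<le> real DIM('a)"
  shows "\<exists>C>0. \<forall>(\<phi>::'a \<Rightarrow> real) D x a b. (\<forall>y. (\<phi> has_derivative (\<lambda>h. D y \<bullet> h)) (at y)) \<longrightarrow>
    continuous_on UNIV D \<longrightarrow> 0 < a \<longrightarrow> a < b \<longrightarrow>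
    ennreal \<bar>annulus_integral (real DIM('a) - \<alpha>) \<phi> x a b\<bar>
      \<le> ennreal C * mean_potential \<alpha> p (\<lambda>z. norm (D z)) x {a<..<2 * b}"
proof -
  let ?n = "real DIM('a)" and ?m = "real DIM('a) - \<alpha>"
  have "?m \<ge> 0" using \<alpha> by simp
  from annulus_integral_le_ball_mean[OF p this]
  obtain C where C: "C > 0" and bound: "\<And>(\<phi>::'a \<Rightarrow> real) D x a b. (\<forall>y. (\<phi> has_derivative (\<lambda>h. D y \<bullet> h)) (at y)) \<Longrightarrow>
    continuous_on UNIV D \<Longrightarrow> 0 < b \<Longrightarrow> b / 2 \<le> a \<Longrightarrow>
    \<bar>annulus_integral ?m \<phi> x a b\<bar> \<le> C * (b powr (\<alpha> + 1) * ball_mean p (\<lambda>z. norm (D z)) x b)"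
    by (auto simp: add.commute)
  define C' where "C' = C * 2 powr (?n / p)"
  have C': "C' > 0" using C by (simp add: C'_def)
  show ?thesis
  proof (intro exI[of _ C'] conjI C' allI impI)
    fix \<phi> :: "'a \<Rightarrow> real" and D x and a b :: real
    assume der: "\<forall>y. (\<phi> has_derivative (\<lambda>h. D y \<bullet> h)) (at y)" and cont: "continuous_on UNIV D"
      and ab: "0 < a" "a < b"
    have "\<phi> differentiable (at y)" for y using der unfolding differentiable_def by blast
    then have cont\<phi>: "continuous_on UNIV \<phi>"
      by (simp add: continuous_on_eq_continuous_within differentiable_imp_continuous_within)
    have [measurable]: "D \<in> borel_measurable borel" using cont by (rule borel_measurable_continuous_onI)
    let ?g = "\<lambda>z. norm (D z)"
    let ?P = "mean_potential \<alpha> p ?g x"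
    have cg: "continuous_on UNIV ?g" using cont by (intro continuous_intros)
    \<comment> \<open>The charge goes to radii above b because the ball mean at b is controlled by
      means over larger balls.\<close>
    have single: "ennreal \<bar>annulus_integral ?m \<phi> x a b\<bar> \<le> ennreal C' * ?P {b<..<2 * b}"
      if ab: "0 < b" "b / 2 \<le> a" for a b
    proof -
      have "ennreal \<bar>annulus_integral ?m \<phi> x a b\<bar> \<le> ennreal (C * (b powr (\<alpha> + 1) * ball_mean p ?g x b))"
        using bound[OF der cont ab] by (rule ennreal_leI)
      also have "\<dots> = (\<integral>\<^sup>+r. ennreal (C * (b powr \<alpha> * ball_mean p ?g x b)) * indicator {b<..<2 * b} r \<partial>lborel)"
        using C ab by (subst nn_integral_cmult_indicator)
          (simp_all add: powr_add ball_mean_nonneg mult_ac flip: ennreal_mult'')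
      also have "\<dots> \<le> (\<integral>\<^sup>+r. ennreal C' * (ennreal (r powr \<alpha> * ball_mean p ?g x r) * indicator {b<..<2 * b} r) \<partial>lborel)"
      proof (intro nn_integral_mono)
        fix r
        show "ennreal (C * (b powr \<alpha> * ball_mean p ?g x b)) * indicator {b<..<2 * b} r
          \<le> ennreal C' * (ennreal (r powr \<alpha> * ball_mean p ?g x r) * indicator {b<..<2 * b} r)"
        proof (cases "r \<in> {b<..<2 * b}")
          case True
          have "b powr \<alpha> * ball_mean p ?g x b \<le> r powr \<alpha> * (2 powr (?n / p) * ball_mean p ?g x r)"
            using True ab \<alpha> p cg
            by (intro mult_mono powr_mono2 ball_mean_doubling) (auto simp: ball_mean_nonneg)
          then have "C * (b powr \<alpha> * ball_mean p ?g x b) \<le> C * (r powr \<alpha> * (2 powr (?n / p) * ball_mean p ?g x r))"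
            using C by (intro mult_left_mono) auto
          then show ?thesis using True C'
            by (simp add: C'_def mult_ac ennreal_leI flip: ennreal_mult')
        qed simp
      qed
      also have "\<dots> = ennreal C' * ?P {b<..<2 * b}"
        unfolding mean_potential_def by (rule nn_integral_cmult) measurable
      finally show ?thesis .
    qed
    have mono: "?P A \<le> ?P B" if "A \<subseteq> B" for A B
      unfolding mean_potential_def using that
      by (intro nn_integral_mono mult_left_mono) (auto simp: indicator_def)
    \<comment> \<open>Here k bounds the number of halvings; for k = 0 the annulus has ratio at most
      2 and \<open>single\<close> applies.\<close>
    have chain: "a < b \<Longrightarrow> b \<le> 2 ^ k * (2 * a) \<Longrightarrow>
      ennreal \<bar>annulus_integral ?m \<phi> x a b\<bar> \<le> ennreal C' * ?P {a<..<2 * b}" for k b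
    proof (induction k arbitrary: b)
      case 0
      then have "ennreal \<bar>annulus_integral ?m \<phi> x a b\<bar> \<le> ennreal C' * ?P {b<..<2 * b}"
        using ab by (intro single) auto
      also have "\<dots> \<le> ennreal C' * ?P {a<..<2 * b}"
        using 0 by (intro mult_left_mono mono) auto
      finally show ?case .
    next
      case (Suc k)
      show ?case
      proof (cases "b \<le> 2 * a")
        case True
        then have "ennreal \<bar>annulus_integral ?m \<phi> x a b\<bar> \<le> ennreal C' * ?P {b<..<2 * b}"
          using ab Suc.prems by (intro single) auto
        also have "\<dots> \<le> ennreal C' * ?P {a<..<2 * b}"
          using Suc.prems by (intro mult_left_mono mono) auto
        finally show ?thesis .
      next
        case False
        have "annulus_integral ?m \<phi> x a b = annulus_integral ?m \<phi> x a (b / 2) + annulus_integral ?m \<phi> x (b / 2) b"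
          using False ab by (intro annulus_integral_split cont\<phi>) auto
        then have "ennreal \<bar>annulus_integral ?m \<phi> x a b\<bar>
          \<le> ennreal \<bar>annulus_integral ?m \<phi> x a (b / 2)\<bar> + ennreal \<bar>annulus_integral ?m \<phi> x (b / 2) b\<bar>"
          by (simp flip: ennreal_plus add: ennreal_leI)
        \<comment> \<open>The hypothesis at b/2 uses radii in (a, b), the outermost piece those in
          (b, 2b), and the two intervals are disjoint.\<close>
        also have "\<dots> \<le> ennreal C' * ?P {a<..<2 * (b / 2)} + ennreal C' * ?P {b<..<2 * b}"
          using Suc False ab by (intro add_mono Suc.IH single) auto
        also have "\<dots> = ennreal C' * (?P {a<..<b} + ?P {b<..<2 * b})" by (simp add: distrib_left)
        also have "?P {a<..<b} + ?P {b<..<2 * b}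
          = (\<integral>\<^sup>+r. ennreal (r powr \<alpha> * ball_mean p ?g x r) * indicator {a<..<b} r
              + ennreal (r powr \<alpha> * ball_mean p ?g x r) * indicator {b<..<2 * b} r \<partial>lborel)"
          unfolding mean_potential_def by (rule nn_integral_add[symmetric]) measurable
        also have "\<dots> \<le> ?P {a<..<2 * b}"
          unfolding mean_potential_def using False ab by (intro nn_integral_mono) (auto simp: indicator_def)
        finally show ?thesis by (simp add: mult_left_mono)
      qed
    qed
    obtain k :: nat where "b / (2 * a) < 2 ^ k"
      using real_arch_pow[of 2 "b / (2 * a)"] by auto
    then have "b \<le> 2 ^ k * (2 * a)" using ab by (simp add: field_simps)
    with ab chain show "ennreal \<bar>annulus_integral ?m \<phi> x a b\<bar> \<le> ennreal C' * ?P {a<..<2 * b}" by blast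
  qed
qed

end

subsection \<open>Distribution of the potential of the ball means\<close>

lemma nn_integral_lborel_translate:
  fixes f :: "'a::euclidean_space \<Rightarrow> ennreal"
  assumes [measurable]: "f \<in> borel_measurable borel"
  shows "(\<integral>\<^sup>+x. f (x - z) \<partial>lborel) = (\<integral>\<^sup>+x. f x \<partial>lborel)"
  using nn_integral_lborel_affine[OF assms, of 1 "- z"] by simp

lemma nn_integral_lborel_reflect:
  fixes f :: "'a::euclidean_space \<Rightarrow> ennreal"
  assumes [measurable]: "f \<in> borel_measurable borel"
  shows "(\<integral>\<^sup>+z. f (x - z) \<partial>lborel) = (\<integral>\<^sup>+z. f z \<partial>lborel)"
  using nn_integral_lborel_affine[OF assms, of "-1" x] by simp

text \<open>Stands in for the Hoelder and Jensen inequalities; the height \<open>v\<close> is chosen at the point of use.\<close>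

lemma powr_le_split:
  fixes u v p q :: real
  assumes "u \<ge> 0" "v > 0" "0 < p" "p \<le> q"
  shows "u powr p \<le> v powr p + v powr (p - q) * u powr q"
proof (cases "u \<le> v")
  case True
  then have "u powr p \<le> v powr p" using assms by (intro powr_mono2) auto
  then show ?thesis by (simp add: add_increasing2)
next
  case False
  then have "u powr (p - q) \<le> v powr (p - q)" using assms by (intro powr_mono2') auto
  then have "u powr (p - q) * u powr q \<le> v powr (p - q) * u powr q" by (rule mult_right_mono) simp
  then show ?thesis using False assms by (simp add: powr_add[symmetric] add_increasing)
qed

text \<open>The constant part of the majorant yields a volume and the excess k stays an integral.
  The excess is a multiple of g^q in the global bound, and g^p above a height in the distribution
  estimate.\<close>

lemma ball_integral_le:
  fixes g :: "'a::euclidean_space \<Rightarrow> real"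
  assumes [measurable]: "g \<in> borel_measurable borel" and "r > 0" "c \<ge> 0"
    and [measurable]: "k \<in> borel_measurable borel"
    and le: "\<And>z. ennreal (g z powr p) \<le> ennreal c + k z"
  shows "ball_integral p g x r \<le> ennreal (measure lborel (ball (0::'a) 1) * r powr real DIM('a) * c)
    + (\<integral>\<^sup>+z. k (x - z) * indicator (ball 0 r) z \<partial>lborel)"
proof -
  have "ball_integral p g x r \<le> (\<integral>\<^sup>+z. ennreal c * indicator (ball 0 r) z + k (x - z) * indicator (ball 0 r) z \<partial>lborel)"
    unfolding ball_integral_def using le by (intro nn_integral_mono) (auto simp: indicator_def)
  also have "\<dots> = ennreal c * emeasure lborel (ball (0::'a) r) + (\<integral>\<^sup>+z. k (x - z) * indicator (ball 0 r) z \<partial>lborel)"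
    by (subst nn_integral_add) (auto simp: nn_integral_cmult)
  also have "emeasure lborel (ball (0::'a) r) = ennreal (r powr real DIM('a) * measure lborel (ball (0::'a) 1))"
    using content_ball_scale[of 1 r "0::'a" 0] \<open>r > 0\<close> by (simp add: emeasure_ball_eq powr_realpow)
  finally show ?thesis using assms by (simp add: mult_ac flip: ennreal_mult)
qed

lemma ball_mean_le_global:
  fixes g :: "'a::euclidean_space \<Rightarrow> real"
  assumes [measurable]: "g \<in> borel_measurable borel" and g0: "\<And>z. g z \<ge> 0"
    and pq: "0 < p" "p \<le> q" and r: "r > 0"
    and Q: "(\<integral>\<^sup>+z. ennreal (g z powr q) \<partial>lborel) \<le> ennreal (Q powr q)" "Q > 0"
  shows "ball_mean p g x r \<le> (measure lborel (ball (0::'a) 1) + 1) powr (1 / p) * (r powr - (real DIM('a) / q) * Q)"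
proof -
  let ?n = "real DIM('a)" and ?w = "measure lborel (ball (0::'a) 1)"
  \<comment> \<open>This height balances the two terms of \<open>powr_le_split\<close>: v^q = r^(-n)
    Q^q, so v^(p - q) Q^q = r^n v^p. The constant term contributes the volume of the unit ball and
    the other term 1, whence the factor \<open>?w + 1\<close>.\<close>
  define v where "v = r powr - (?n / q) * Q"
  have v: "v > 0" using r Q by (simp add: v_def)
  have "ball_integral p g x r \<le> ennreal (?w * r powr ?n * v powr p)
    + (\<integral>\<^sup>+z. ennreal (v powr (p - q) * g (x - z) powr q) * indicator (ball 0 r) z \<partial>lborel)"
    using powr_le_split[OF g0 v pq] r
    by (intro ball_integral_le) (auto simp flip: ennreal_plus intro!: ennreal_leI)
  also have "(\<integral>\<^sup>+z. ennreal (v powr (p - q) * g (x - z) powr q) * indicator (ball 0 r) z \<partial>lborel)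
    \<le> (\<integral>\<^sup>+z. ennreal (v powr (p - q)) * ennreal (g (x - z) powr q) \<partial>lborel)"
    by (intro nn_integral_mono) (auto simp: indicator_def ennreal_mult)
  also have "\<dots> = ennreal (v powr (p - q)) * (\<integral>\<^sup>+z. ennreal (g z powr q) \<partial>lborel)"
    using nn_integral_lborel_reflect[of "\<lambda>z. ennreal (g z powr q)" x] by (simp add: nn_integral_cmult)
  also have "\<dots> \<le> ennreal (v powr (p - q)) * ennreal (Q powr q)"
    using Q by (intro mult_left_mono) auto
  also have "\<dots> = ennreal (r powr ?n * v powr p)"
  proof -
    have "v powr (p - q) * Q powr q = v powr p * (Q powr q / v powr q)" by (simp add: powr_diff)
    also have "Q powr q / v powr q = r powr ?n"
    proof -
      have "v powr q = r powr - ?n * Q powr q"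
        using pq unfolding v_def by (subst powr_mult) (simp add: powr_powr)
      then show ?thesis using r Q by (simp add: powr_minus divide_inverse)
    qed
    finally show ?thesis by (simp add: mult.commute flip: ennreal_mult)
  qed
  finally have "ball_integral p g x r \<le> ennreal (?w * r powr ?n * v powr p + r powr ?n * v powr p)"
    by (simp add: add_mono)
  then have "enn2real (ball_integral p g x r) \<le> ?w * r powr ?n * v powr p + r powr ?n * v powr p"
    using enn2real_leI by fastforce
  then have "r powr - ?n * enn2real (ball_integral p g x r) \<le> r powr - ?n * (?w * r powr ?n * v powr p + r powr ?n * v powr p)"
    by (rule mult_left_mono) simp
  also have "\<dots> = (?w + 1) * v powr p" using r by (simp add: powr_minus field_simps)
  finally have "ball_mean p g x r \<le> ((?w + 1) * v powr p) powr (1 / p)"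
    unfolding ball_mean_def using pq by (intro powr_mono2) auto
  also have "\<dots> = (?w + 1) powr (1 / p) * v"
    using pq v by (simp add: powr_mult powr_powr)
  finally show ?thesis by (simp add: v_def)
qed

text \<open>Marcinkiewicz-type truncation: for the level \<open>l\<close>, radii above \<open>R\<close> contribute at most \<open>l / 3\<close> by
  the global bound and the part of \<open>g\<close> below \<open>\<mu>\<close> at most \<open>l / 3\<close>; Markov's inequality handles the rest.\<close>

lemma mean_potential_distribution:
  fixes \<alpha> p q :: real
  defines "n \<equiv> real DIM('a::euclidean_space)"
  defines "\<gamma> \<equiv> (1 + \<alpha>) / (n / q - 1 - \<alpha>)"
  assumes "1 < p" "p \<le> q" "\<alpha> > -1" "1 + \<alpha> < n / q"
  shows "\<exists>\<kappa>>0. \<forall>(g::'a \<Rightarrow> real) Q l. continuous_on UNIV g \<longrightarrow> (\<forall>z. g z \<ge> 0) \<longrightarrow>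
    (\<integral>\<^sup>+z. ennreal (g z powr q) \<partial>lborel) \<le> ennreal (Q powr q) \<longrightarrow> 0 < Q \<longrightarrow> 0 < l \<longrightarrow>
    emeasure lborel {x. ennreal l < mean_potential \<alpha> p g x {0<..}}
      \<le> (\<integral>\<^sup>+z. ennreal ((g z / (\<kappa> * l powr (1 + \<gamma>) * Q powr - \<gamma>)) powr p)
           * indicator {z. \<kappa> * l powr (1 + \<gamma>) * Q powr - \<gamma> < g z} z \<partial>lborel)"
proof -
  \<comment> \<open>The rate at which the far part decays: the integral of r^(\<alpha> - n/q) over r
    \<ge> R is R^(-\<beta>) / \<beta>. Hence \<gamma> = (1 + \<alpha>) / \<beta>.\<close>
  define \<beta> where "\<beta> = n / q - 1 - \<alpha>"
  have \<beta>: "\<beta> > 0" using assms by (simp add: \<beta>_def)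
  define \<omega> where "\<omega> = measure lborel (ball (0::'a) 1)"
  have \<omega>: "\<omega> > 0" by (simp add: \<omega>_def)
  define C1 where "C1 = (\<omega> + 1) powr (1 / p)"
  have C1: "C1 > 0" using \<omega> by (simp add: C1_def)
  define \<kappa> where "\<kappa> = (1 + \<alpha>) / (3 * (1 + \<omega>)) * (3 * C1 / \<beta>) powr - \<gamma>"
  have \<kappa>: "\<kappa> > 0" using assms \<omega> C1 \<beta> by (simp add: \<kappa>_def)
  show ?thesis
  proof (intro exI[of _ \<kappa>] conjI \<kappa> allI impI)
    fix g :: "'a \<Rightarrow> real" and Q l :: real
    assume cont: "continuous_on UNIV g" and g0: "\<forall>z. g z \<ge> 0"
      and Q: "(\<integral>\<^sup>+z. ennreal (g z powr q) \<partial>lborel) \<le> ennreal (Q powr q)" "0 < Q" and l: "0 < l"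
    have [measurable]: "g \<in> borel_measurable borel" using cont by (rule borel_measurable_continuous_onI)
    \<comment> \<open>Solves C1 Q R^(-\<beta>) / \<beta> = l / 3, so the radii beyond R take exactly
      a third of the level.\<close>
    define R where "R = (3 * C1 * Q / (\<beta> * l)) powr (1 / \<beta>)"
    have R: "R > 0" using C1 Q l \<beta> by (simp add: R_def)
    have R\<beta>: "C1 * Q * (R powr - \<beta> / \<beta>) = l / 3"
    proof -
      have "R powr - \<beta> = inverse (3 * C1 * Q / (\<beta> * l))"
        using C1 Q l \<beta> by (simp add: R_def powr_powr powr_minus)
      then show ?thesis using C1 Q \<beta> l by (simp add: field_simps)
    qed
    \<comment> \<open>With this R, R^(\<alpha> + 1) is a multiple of (Q / l)^\<gamma>. The height is
      the one for which the part of g below it takes the second third, which forces the powers of l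
      and Q and the value of \<kappa>.\<close>
    define \<mu> where "\<mu> = \<kappa> * l powr (1 + \<gamma>) * Q powr - \<gamma>"
    have \<mu>: "\<mu> > 0" using \<kappa> l Q by (simp add: \<mu>_def)
    have \<mu>R: "(1 + \<omega>) * \<mu> * (R powr (\<alpha> + 1) / (\<alpha> + 1)) = l / 3"
    proof -
      have "R powr (\<alpha> + 1) = (3 * C1 / \<beta> * (Q / l)) powr \<gamma>"
        by (simp add: R_def powr_powr \<gamma>_def \<beta>_def add.commute)
      also have "\<dots> = (3 * C1 / \<beta>) powr \<gamma> * (Q powr \<gamma> / l powr \<gamma>)"
        using C1 Q l \<beta> by (subst powr_mult) (auto simp: powr_divide)
      finally have RR: "R powr (\<alpha> + 1) = (3 * C1 / \<beta>) powr \<gamma> * (Q powr \<gamma> / l powr \<gamma>)" .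
      have "\<mu> * R powr (\<alpha> + 1) = (1 + \<alpha>) / (3 * (1 + \<omega>)) * l"
      proof -
        have nz: "(3 * C1 / \<beta>) powr \<gamma> \<noteq> 0" "Q powr \<gamma> \<noteq> 0" "l powr \<gamma> \<noteq> 0" "1 + \<omega> \<noteq> 0"
          using C1 Q l \<beta> \<omega> by auto
        have "c / d * inverse A * (l * L) * inverse B * (A * (B / L)) = c / d * l"
          if "A \<noteq> 0" "B \<noteq> 0" "L \<noteq> 0" for A B L c d :: real
          using that by (cases "d = 0") (auto simp: field_simps)
        from this[OF nz(1-3)] show ?thesis
          using RR l by (simp add: \<mu>_def \<kappa>_def powr_minus powr_add)
      qed
      then show ?thesis using assms(5) \<omega> by (simp add: field_simps)
    qed
    define k where "k z = ennreal (g z powr p) * indicator {z. \<mu> < g z} z" for z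
    have [measurable]: "k \<in> borel_measurable borel" unfolding k_def by measurable
    define H where "H x r = (\<integral>\<^sup>+z. k (x - z) * indicator (ball 0 r) z \<partial>lborel)" for x r
    have H[measurable]: "(\<lambda>(x, r). H x r) \<in> borel_measurable (borel \<Otimes>\<^sub>M borel)"
      unfolding H_def indicator_def mem_ball by measurable
    define X where "X x = (\<integral>\<^sup>+r. ennreal (\<mu> powr (1 - p) * r powr (\<alpha> - n)) * H x r * indicator {0<..<R} r \<partial>lborel)" for x
    have [measurable]: "X \<in> borel_measurable borel" unfolding X_def by measurable
    \<comment> \<open>The p-th root in the ball mean would block Fubini. Splitting with exponents 1
      and p at height \<mu> replaces the mean A by \<mu> + \<mu>^(1 - p) A^p, which is linear in the
      ball integral. One \<mu> comes from this splitting and \<omega> \<mu> from the part of g below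
      \<mu>.\<close>
    have near: "ennreal (r powr \<alpha> * ball_mean p g x r)
      \<le> ennreal ((1 + \<omega>) * \<mu>) * ennreal (r powr \<alpha>) + ennreal (\<mu> powr (1 - p) * r powr (\<alpha> - n)) * H x r"
      if r: "r > 0" for x r
    proof -
      have fin: "ball_integral p g x r < \<infinity>" using cont g0 assms(3) by (intro ball_integral_finite) auto
      have "ball_integral p g x r \<le> ennreal (\<omega> * r powr n * \<mu> powr p) + H x r"
        unfolding \<omega>_def n_def H_def
      proof (rule ball_integral_le)
        fix z
        show "ennreal (g z powr p) \<le> ennreal (\<mu> powr p) + k z"
          using g0 assms(3) \<mu> by (auto simp: k_def indicator_def not_less intro!: ennreal_leI powr_mono2)
      qed (use r in auto)
      then have bi: "ennreal (enn2real (ball_integral p g x r)) \<le> ennreal (\<omega> * r powr n * \<mu> powr p) + H x r"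
        using fin by simp
      have "ball_mean p g x r powr 1 \<le> \<mu> powr 1 + \<mu> powr (1 - p) * ball_mean p g x r powr p"
        using assms(3) \<mu> by (intro powr_le_split) (auto simp: ball_mean_nonneg)
      also have "ball_mean p g x r powr p = r powr - n * enn2real (ball_integral p g x r)"
        using assms(3) unfolding ball_mean_def n_def by (simp add: powr_powr)
      finally have "ball_mean p g x r \<le> \<mu> + \<mu> powr (1 - p) * (r powr - n * enn2real (ball_integral p g x r))"
        using \<mu> by (simp add: ball_mean_nonneg)
      then have "r powr \<alpha> * ball_mean p g x r \<le> r powr \<alpha> * (\<mu> + \<mu> powr (1 - p) * (r powr - n * enn2real (ball_integral p g x r)))"
        by (rule mult_left_mono) simp
      also have "\<dots> = \<mu> * r powr \<alpha> + \<mu> powr (1 - p) * r powr (\<alpha> - n) * enn2real (ball_integral p g x r)"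
        by (simp add: algebra_simps powr_diff powr_minus divide_inverse)
      finally have "ennreal (r powr \<alpha> * ball_mean p g x r)
        \<le> ennreal (\<mu> * r powr \<alpha>) + ennreal (\<mu> powr (1 - p) * r powr (\<alpha> - n)) * ennreal (enn2real (ball_integral p g x r))"
        using \<mu> by (simp add: ennreal_leI flip: ennreal_mult ennreal_plus)
      also have "\<dots> \<le> ennreal (\<mu> * r powr \<alpha>)
        + ennreal (\<mu> powr (1 - p) * r powr (\<alpha> - n)) * (ennreal (\<omega> * r powr n * \<mu> powr p) + H x r)"
        using bi by (intro add_left_mono mult_left_mono) auto
      also have "\<dots> = ennreal (\<mu> * r powr \<alpha>)
        + ennreal ((\<mu> powr (1 - p) * r powr (\<alpha> - n)) * (\<omega> * r powr n * \<mu> powr p)) + ennreal (\<mu> powr (1 - p) * r powr (\<alpha> - n)) * H x r"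
        using \<mu> \<omega> by (simp add: distrib_left add.assoc flip: ennreal_mult)
      also have "(\<mu> powr (1 - p) * r powr (\<alpha> - n)) * (\<omega> * r powr n * \<mu> powr p)
        = \<omega> * (\<mu> powr (1 - p) * \<mu> powr p) * (r powr (\<alpha> - n) * r powr n)" by (simp add: mult_ac)
      also have "\<dots> = \<omega> * \<mu> * r powr \<alpha>" using \<mu> by (simp flip: powr_add)
      also have "ennreal (\<mu> * r powr \<alpha>) + ennreal (\<omega> * \<mu> * r powr \<alpha>) = ennreal ((1 + \<omega>) * \<mu>) * ennreal (r powr \<alpha>)"
        using \<mu> \<omega> by (simp add: algebra_simps flip: ennreal_mult ennreal_plus)
      finally show ?thesis .
    qed
    have far: "(\<integral>\<^sup>+r. ennreal (r powr \<alpha> * ball_mean p g x r) * indicator {R..} r \<partial>lborel) \<le> ennreal (l / 3)" for x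
    proof -
      have "(\<integral>\<^sup>+r. ennreal (r powr \<alpha> * ball_mean p g x r) * indicator {R..} r \<partial>lborel)
        \<le> (\<integral>\<^sup>+r. ennreal (C1 * Q) * (ennreal (r powr (\<alpha> - n / q)) * indicator {R..} r) \<partial>lborel)"
      proof (intro nn_integral_mono)
        fix r
        show "ennreal (r powr \<alpha> * ball_mean p g x r) * indicator {R..} r
          \<le> ennreal (C1 * Q) * (ennreal (r powr (\<alpha> - n / q)) * indicator {R..} r)"
        proof (cases "r \<in> {R..}")
          case True
          then have "ball_mean p g x r \<le> C1 * (r powr - (n / q) * Q)"
            unfolding C1_def \<omega>_def n_def using R Q g0 assms(3,4)
            by (intro ball_mean_le_global) auto
          then have "r powr \<alpha> * ball_mean p g x r \<le> r powr \<alpha> * (C1 * (r powr - (n / q) * Q))"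
            by (rule mult_left_mono) simp
          then show ?thesis using True C1 Q
            by (simp add: powr_diff powr_minus divide_inverse mult_ac ennreal_leI flip: ennreal_mult)
        qed simp
      qed
      also have "\<dots> = ennreal (C1 * Q) * (\<integral>\<^sup>+r. ennreal (r powr (\<alpha> - n / q)) * indicator {R..} r \<partial>lborel)"
        by (rule nn_integral_cmult) measurable
      also have "(\<integral>\<^sup>+r. ennreal (r powr (\<alpha> - n / q)) * indicator {R..} r \<partial>lborel) = ennreal (R powr - \<beta> / \<beta>)"
        using \<beta> R by (subst nn_integral_powr_to_inf) (auto simp: \<beta>_def algebra_simps)
      also have "ennreal (C1 * Q) * ennreal (R powr - \<beta> / \<beta>) = ennreal (l / 3)"
        using C1 Q \<beta> R\<beta> by (subst ennreal_mult[symmetric]) auto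
      finally show ?thesis .
    qed
    have pot: "mean_potential \<alpha> p g x {0<..} \<le> ennreal (2 * l / 3) + X x" for x
    proof -
      have "mean_potential \<alpha> p g x {0<..} \<le> (\<integral>\<^sup>+r. (ennreal ((1 + \<omega>) * \<mu>) * (ennreal (r powr \<alpha>) * indicator {0<..<R} r)
         + ennreal (\<mu> powr (1 - p) * r powr (\<alpha> - n)) * H x r * indicator {0<..<R} r)
         + ennreal (r powr \<alpha> * ball_mean p g x r) * indicator {R..} r \<partial>lborel)"
        unfolding mean_potential_def
      proof (intro nn_integral_mono)
        fix r
        show "ennreal (r powr \<alpha> * ball_mean p g x r) * indicator {0<..} r
          \<le> (ennreal ((1 + \<omega>) * \<mu>) * (ennreal (r powr \<alpha>) * indicator {0<..<R} r)
         + ennreal (\<mu> powr (1 - p) * r powr (\<alpha> - n)) * H x r * indicator {0<..<R} r)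
         + ennreal (r powr \<alpha> * ball_mean p g x r) * indicator {R..} r"
          using near[of r x] R by (cases "0 < r"; cases "r < R") auto
      qed
      also have "\<dots> = (ennreal ((1 + \<omega>) * \<mu>) * (\<integral>\<^sup>+r. ennreal (r powr \<alpha>) * indicator {0<..<R} r \<partial>lborel) + X x)
         + (\<integral>\<^sup>+r. ennreal (r powr \<alpha> * ball_mean p g x r) * indicator {R..} r \<partial>lborel)"
        unfolding X_def by (simp add: nn_integral_add nn_integral_cmult)
      also have "(\<integral>\<^sup>+r. ennreal (r powr \<alpha>) * indicator {0<..<R} r \<partial>lborel) = ennreal (R powr (\<alpha> + 1) / (\<alpha> + 1))"
        using assms R by (intro nn_integral_powr_from_0) auto
      also have "ennreal ((1 + \<omega>) * \<mu>) * ennreal (R powr (\<alpha> + 1) / (\<alpha> + 1)) = ennreal (l / 3)"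
        unfolding \<mu>R[symmetric] using \<omega> \<mu> assms(5) by (subst ennreal_mult[symmetric]) auto
      also have "(ennreal (l / 3) + X x) + (\<integral>\<^sup>+r. ennreal (r powr \<alpha> * ball_mean p g x r) * indicator {R..} r \<partial>lborel)
        \<le> (ennreal (l / 3) + X x) + ennreal (l / 3)" by (intro add_left_mono far)
      also have "\<dots> = (ennreal (l / 3) + ennreal (l / 3)) + X x" by (simp add: add_ac)
      also have "ennreal (l / 3) + ennreal (l / 3) = ennreal (2 * l / 3)"
        using l by (simp flip: ennreal_plus)
      finally show ?thesis .
    qed
    \<comment> \<open>Two thirds of the level are already spent, so X must supply at least l /
      3.\<close>
    have sub: "{x. ennreal l < mean_potential \<alpha> p g x {0<..}} \<subseteq> {x \<in> UNIV. 1 \<le> ennreal (3 / l) * X x}"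
    proof (intro subsetI CollectI conjI UNIV_I)
      fix x assume "x \<in> {x. ennreal l < mean_potential \<alpha> p g x {0<..}}"
      then have "ennreal l \<le> ennreal (2 * l / 3) + X x"
        using less_le_trans[OF _ pot] by (auto intro: less_imp_le)
      then have "ennreal (2 * l / 3) + ennreal (l / 3) \<le> ennreal (2 * l / 3) + X x"
        using l by (simp flip: ennreal_plus)
      then have "ennreal (l / 3) \<le> X x" by (simp add: ennreal_add_left_cancel_le)
      then have "ennreal (3 / l) * ennreal (l / 3) \<le> ennreal (3 / l) * X x" by (rule mult_left_mono) simp
      then show "1 \<le> ennreal (3 / l) * X x" using l by (simp flip: ennreal_mult)
    qed
    have "emeasure lborel {x. ennreal l < mean_potential \<alpha> p g x {0<..}}
      \<le> emeasure lborel {x \<in> UNIV. 1 \<le> ennreal (3 / l) * X x}"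
      by (rule emeasure_mono[OF sub]) measurable
    also have "\<dots> \<le> ennreal (3 / l) * (\<integral>\<^sup>+x. X x * indicator UNIV x \<partial>lborel)"
      using nn_integral_Markov_inequality[where u = X and M = lborel and A = UNIV and c = "ennreal (3 / l)"]
      by simp
    also have "(\<integral>\<^sup>+x. X x * indicator UNIV x \<partial>lborel)
      = (\<integral>\<^sup>+r. \<integral>\<^sup>+x. ennreal (\<mu> powr (1 - p) * r powr (\<alpha> - n)) * H x r * indicator {0<..<R} r \<partial>lborel \<partial>lborel)"
      unfolding X_def by (simp, intro lborel_pair.Fubini') measurable
    \<comment> \<open>By translation invariance, H integrates over x to the volume of the ball times
      the integral of k; the factor r^n cancels the normalisation and leaves r^\<alpha>.\<close>
    also have "\<dots> = (\<integral>\<^sup>+r. ennreal (\<mu> powr (1 - p) * \<omega>) * (\<integral>\<^sup>+z. k z \<partial>lborel) * (ennreal (r powr \<alpha>) * indicator {0<..<R} r) \<partial>lborel)"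
    proof (rule nn_integral_cong)
      fix r :: real
      show "(\<integral>\<^sup>+x. ennreal (\<mu> powr (1 - p) * r powr (\<alpha> - n)) * H x r * indicator {0<..<R} r \<partial>lborel)
        = ennreal (\<mu> powr (1 - p) * \<omega>) * (\<integral>\<^sup>+z. k z \<partial>lborel) * (ennreal (r powr \<alpha>) * indicator {0<..<R} r)"
      proof (cases "0 < r \<and> r < R")
        case True
        have "(\<integral>\<^sup>+x. H x r \<partial>lborel) = (\<integral>\<^sup>+z. \<integral>\<^sup>+x. k (x - z) * indicator (ball 0 r) z \<partial>lborel \<partial>lborel)"
          unfolding H_def by (rule lborel_pair.Fubini') measurable
        also have "\<dots> = (\<integral>\<^sup>+z. (\<integral>\<^sup>+x. k x \<partial>lborel) * indicator (ball 0 r) (z::'a) \<partial>lborel)"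
          by (intro nn_integral_cong) (simp add: nn_integral_multc nn_integral_lborel_translate)
        also have "\<dots> = (\<integral>\<^sup>+x. k x \<partial>lborel) * emeasure lborel (ball (0::'a) r)"
          by (simp add: nn_integral_cmult)
        also have "emeasure lborel (ball (0::'a) r) = ennreal (r powr n * \<omega>)"
          using content_ball_scale[of 1 r "0::'a" 0] True by (simp add: emeasure_ball_eq powr_realpow n_def \<omega>_def)
        finally have HX: "(\<integral>\<^sup>+x. H x r \<partial>lborel) = (\<integral>\<^sup>+x. k x \<partial>lborel) * ennreal (r powr n * \<omega>)" .
        have "(\<integral>\<^sup>+x. ennreal (\<mu> powr (1 - p) * r powr (\<alpha> - n)) * H x r * indicator {0<..<R} r \<partial>lborel)
          = (ennreal (\<mu> powr (1 - p) * r powr (\<alpha> - n)) * ennreal (r powr n * \<omega>)) * (\<integral>\<^sup>+z. k z \<partial>lborel)"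
          using True by (simp add: nn_integral_cmult HX) (simp add: mult_ac)
        also have "ennreal (\<mu> powr (1 - p) * r powr (\<alpha> - n)) * ennreal (r powr n * \<omega>)
          = ennreal (\<mu> powr (1 - p) * \<omega> * (r powr (\<alpha> - n) * r powr n))"
          using \<omega> by (simp add: mult_ac flip: ennreal_mult)
        also have "r powr (\<alpha> - n) * r powr n = r powr \<alpha>" by (simp flip: powr_add)
        also have "ennreal (\<mu> powr (1 - p) * \<omega> * r powr \<alpha>) = ennreal (\<mu> powr (1 - p) * \<omega>) * ennreal (r powr \<alpha>)"
          using \<omega> by (simp add: ennreal_mult)
        finally show ?thesis using True by (simp add: mult_ac)
      qed auto
    qed
    also have "\<dots> = ennreal (\<mu> powr (1 - p) * \<omega>) * (\<integral>\<^sup>+z. k z \<partial>lborel) * ennreal (R powr (\<alpha> + 1) / (\<alpha> + 1))"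
      using assms R by (subst nn_integral_cmult) (auto simp: nn_integral_powr_from_0)
    also have "ennreal (3 / l) * \<dots> = ennreal (3 / l * (\<mu> powr (1 - p) * \<omega>) * (R powr (\<alpha> + 1) / (\<alpha> + 1))) * (\<integral>\<^sup>+z. k z \<partial>lborel)"
    proof -
      have "ennreal u * (ennreal v * K * ennreal t) = ennreal (u * v * t) * K"
        if "u \<ge> 0" "v \<ge> 0" "t \<ge> 0" for u v t K
        using that by (simp add: ennreal_mult mult_ac)
      then show ?thesis using l \<omega> assms(5) by simp
    qed
    \<comment> \<open>The same identity \<open>\<mu>R\<close> evaluates the constant from Markov's
      inequality: it is \<mu>^(-p) times \<omega> / (1 + \<omega>). The factor \<mu>^(-p) turns k
      into the p-th power of g / \<mu>.\<close>
    also have "\<dots> \<le> ennreal (\<mu> powr - p) * (\<integral>\<^sup>+z. k z \<partial>lborel)"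
    proof (intro mult_right_mono ennreal_leI)
      have "3 / l * (\<mu> powr (1 - p) * \<omega>) * (R powr (\<alpha> + 1) / (\<alpha> + 1))
        = \<mu> powr - p * (3 / l * (\<omega> / (1 + \<omega>)) * ((1 + \<omega>) * \<mu> * (R powr (\<alpha> + 1) / (\<alpha> + 1))))"
      proof -
        have "c * (m * P * w) * T = P * (c * (w / (1 + w)) * ((1 + w) * m * T))"
          if "1 + w \<noteq> 0" for c m P w T :: real
          using that by (simp add: field_simps)
        from this[of \<omega> "3 / l" \<mu> "\<mu> powr - p"] show ?thesis
          using \<mu> \<omega> by (simp add: powr_diff powr_minus divide_inverse)
      qed
      also have "\<dots> = \<mu> powr - p * (\<omega> / (1 + \<omega>))"
        unfolding \<mu>R using l \<omega> by (simp add: divide_simps)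
      also have "\<dots> \<le> \<mu> powr - p * 1" using \<omega> by (intro mult_left_mono) auto
      finally show "3 / l * (\<mu> powr (1 - p) * \<omega>) * (R powr (\<alpha> + 1) / (\<alpha> + 1)) \<le> \<mu> powr - p" by simp
    qed simp
    also have "\<dots> = (\<integral>\<^sup>+z. ennreal (\<mu> powr - p) * k z \<partial>lborel)"
      by (rule nn_integral_cmult[symmetric]) measurable
    also have "\<dots> = (\<integral>\<^sup>+z. ennreal ((g z / \<mu>) powr p) * indicator {z. \<mu> < g z} z \<partial>lborel)"
      using g0 \<mu> by (intro nn_integral_cong)
        (auto simp: k_def powr_divide powr_minus divide_inverse powr_mult inverse_powr indicator_def mult.commute ennreal_mult[symmetric])
    finally show "emeasure lborel {x. ennreal l < mean_potential \<alpha> p g x {0<..}}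
      \<le> (\<integral>\<^sup>+z. ennreal ((g z / (\<kappa> * l powr (1 + \<gamma>) * Q powr - \<gamma>)) powr p)
           * indicator {z. \<kappa> * l powr (1 + \<gamma>) * Q powr - \<gamma> < g z} z \<partial>lborel)"
      unfolding \<mu>_def .
  qed
qed

text \<open>The distribution estimate retains an integral of g instead of its norm alone, so the
  layer cake formula and Fubini give the strong bound directly. For fixed z the levels run up to
  \<open>lev (g z)\<close>, and integrating them produces a multiple of Q^(\<gamma> q) (g z)^q;
  integration in z adds Q^q, in total Q^s. Finiteness is a separate claim because
  \<open>enn2real\<close> sends infinity to 0.\<close>

lemma mean_potential_strong_type:
  fixes \<alpha> p q :: real
  defines "n \<equiv> real DIM('a::euclidean_space)"
  defines "\<gamma> \<equiv> (1 + \<alpha>) / (n / q - 1 - \<alpha>)"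
  assumes p: "1 < p" and pq: "p < q" and \<alpha>: "\<alpha> > -1" and aq: "1 + \<alpha> < n / q"
  shows "\<exists>C>0. \<forall>(g::'a \<Rightarrow> real) Q. continuous_on UNIV g \<longrightarrow> (\<forall>z. g z \<ge> 0) \<longrightarrow>
    (\<integral>\<^sup>+z. ennreal (g z powr q) \<partial>lborel) \<le> ennreal (Q powr q) \<longrightarrow> 0 < Q \<longrightarrow>
    (AE x in lborel. mean_potential \<alpha> p g x {0<..} < \<infinity>) \<and>
    (\<integral>\<^sup>+x. ennreal (enn2real (mean_potential \<alpha> p g x {0<..}) powr (q * (1 + \<gamma>))) \<partial>lborel)
      \<le> ennreal (C * Q powr (q * (1 + \<gamma>)))"
proof -
  have \<gamma>: "\<gamma> > 0" using \<alpha> aq by (simp add: \<gamma>_def)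
  define s where "s = q * (1 + \<gamma>)"
  have s: "s > 0" using p pq \<gamma> by (simp add: s_def)
  obtain \<kappa> where \<kappa>: "\<kappa> > 0" and distr: "\<And>(g::'a \<Rightarrow> real) Q l. continuous_on UNIV g \<Longrightarrow> (\<forall>z. g z \<ge> 0) \<Longrightarrow>
    (\<integral>\<^sup>+z. ennreal (g z powr q) \<partial>lborel) \<le> ennreal (Q powr q) \<Longrightarrow> 0 < Q \<Longrightarrow> 0 < l \<Longrightarrow>
    emeasure lborel {x. ennreal l < mean_potential \<alpha> p g x {0<..}}
      \<le> (\<integral>\<^sup>+z. ennreal ((g z / (\<kappa> * l powr (1 + \<gamma>) * Q powr - \<gamma>)) powr p)
           * indicator {z. \<kappa> * l powr (1 + \<gamma>) * Q powr - \<gamma> < g z} z \<partial>lborel)"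
    using mean_potential_distribution[where 'a = 'a, OF p less_imp_le[OF pq] \<alpha> aq[unfolded n_def]]
    unfolding \<gamma>_def n_def by blast
  \<comment> \<open>The fraction is s / ((q - p) (1 + \<gamma>)) from the integral over levels; the
    power of \<kappa> comes from expressing \<open>lev (g z)\<close> through g z.\<close>
  define C where "C = q / (q - p) * \<kappa> powr - q"
  have C: "C > 0" using p pq \<kappa> by (simp add: C_def)
  show ?thesis
  proof (intro exI[of _ C] conjI C allI impI)
    fix g :: "'a \<Rightarrow> real" and Q :: real
    assume cont: "continuous_on UNIV g" and g0: "\<forall>z. g z \<ge> 0"
      and gq: "(\<integral>\<^sup>+z. ennreal (g z powr q) \<partial>lborel) \<le> ennreal (Q powr q)" and Q: "0 < Q"
    have [measurable]: "g \<in> borel_measurable borel" using cont by (rule borel_measurable_continuous_onI)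
    define P where "P x = mean_potential \<alpha> p g x {0<..}" for x
    have [measurable]: "P \<in> borel_measurable borel" unfolding P_def by measurable
    define \<mu> where "\<mu> l = \<kappa> * l powr (1 + \<gamma>) * Q powr - \<gamma>" for l
    have \<mu>_pos: "\<mu> l > 0" if "l > 0" for l using that \<kappa> Q by (simp add: \<mu>_def)
    have [measurable]: "\<mu> \<in> borel_measurable borel" unfolding \<mu>_def by measurable
    \<comment> \<open>The inverse of the increasing function \<mu>: the level whose truncation
      height is u.\<close>
    define lev where "lev u = (u * Q powr \<gamma> / \<kappa>) powr (1 / (1 + \<gamma>))" for u
    have \<mu>_lev: "\<mu> (lev u) = u" if "u > 0" for u
    proof -
      have "lev u powr (1 + \<gamma>) = u * Q powr \<gamma> / \<kappa>"
        using that \<kappa> Q \<gamma> unfolding lev_def by (simp add: powr_powr)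
      then show ?thesis using \<kappa> Q by (simp add: \<mu>_def powr_minus)
    qed
    have lev_pos: "lev u > 0" if "u > 0" for u
      using that \<kappa> Q by (simp add: lev_def)
    have \<mu>_less_iff: "\<mu> l < u \<longleftrightarrow> l < lev u" if "l > 0" "u > 0" for l u
    proof -
      have mono: "\<mu> a < \<mu> b" if "0 < a" "a < b" for a b
        unfolding \<mu>_def using that \<kappa> Q \<gamma>
        by (intro mult_strict_right_mono mult_strict_left_mono powr_less_mono2) auto
      show ?thesis
        using mono[of l "lev u"] mono[of "lev u" l] \<mu>_lev[of u] lev_pos[of u] that
        by (metis less_irrefl less_trans not_less_iff_gr_or_eq)
    qed
    have distr': "emeasure lborel {x. ennreal l < P x}
      \<le> (\<integral>\<^sup>+z. ennreal ((g z / \<mu> l) powr p) * indicator {z. \<mu> l < g z} z \<partial>lborel)" if "l > 0" for l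
      unfolding P_def \<mu>_def using distr[OF cont g0 gq Q that] .
    \<comment> \<open>Here u solves u^(-q) Q^q = \<epsilon>; where g exceeds u, the p-th power of g
      / u is below its q-th power. The summand 0 matches the form expected by
      \<open>ennreal_le_epsilon\<close>.\<close>
    have inf_null: "emeasure lborel {x. P x = \<infinity>} \<le> 0 + ennreal \<epsilon>" if "\<epsilon> > 0" for \<epsilon>
    proof -
      define u where "u = Q * \<epsilon> powr - (1 / q)"
      have u: "u > 0" using Q that by (simp add: u_def)
      have "emeasure lborel {x. P x = \<infinity>} \<le> emeasure lborel {x. ennreal (lev u) < P x}"
        by (intro emeasure_mono) (auto simp: less_top[symmetric])
      also have "\<dots> \<le> (\<integral>\<^sup>+z. ennreal ((g z / u) powr p) * indicator {z. u < g z} z \<partial>lborel)"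
        using distr'[OF lev_pos[OF u]] by (simp add: \<mu>_lev[OF u])
      also have "\<dots> \<le> (\<integral>\<^sup>+z. ennreal (u powr - q) * ennreal (g z powr q) \<partial>lborel)"
      proof (intro nn_integral_mono)
        fix z
        show "ennreal ((g z / u) powr p) * indicator {z. u < g z} z \<le> ennreal (u powr - q) * ennreal (g z powr q)"
        proof (cases "u < g z")
          case True
          then have "(g z / u) powr p \<le> (g z / u) powr q" using u pq by (intro powr_mono) auto
          also have "\<dots> = u powr - q * g z powr q" using u g0 by (simp add: powr_mult inverse_powr powr_minus divide_inverse mult.commute)
          finally show ?thesis using True by (simp add: ennreal_leI flip: ennreal_mult)
        qed simp
      qed
      also have "\<dots> = ennreal (u powr - q) * (\<integral>\<^sup>+z. ennreal (g z powr q) \<partial>lborel)"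
        by (rule nn_integral_cmult) measurable
      also have "\<dots> \<le> ennreal (u powr - q) * ennreal (Q powr q)"
        using gq by (rule mult_left_mono) simp
      also have "\<dots> = ennreal \<epsilon>"
      proof -
        have "u powr - q = Q powr - q * \<epsilon>"
          using that Q p pq unfolding u_def by (subst powr_mult) (auto simp: powr_powr)
        then show ?thesis using Q that by (simp add: powr_minus flip: ennreal_mult)
      qed
      finally show ?thesis by simp
    qed
    have "emeasure lborel {x. P x = \<infinity>} \<le> 0"
      by (rule ennreal_le_epsilon) (use inf_null in auto)
    then have "{x. P x = \<infinity>} \<in> null_sets lborel"
      by (intro null_setsI) auto
    then have "AE x in lborel. x \<notin> {x. P x = \<infinity>}" by (rule AE_not_in)
    then show "AE x in lborel. mean_potential \<alpha> p g x {0<..} < \<infinity>"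
      unfolding P_def by (auto simp: less_top)
    define H where "H x = enn2real (P x)" for x
    have [measurable]: "H \<in> borel_measurable borel" unfolding H_def by measurable
    have H0: "H x \<ge> 0" for x by (simp add: H_def)
    have H_less: "ennreal l < P x" if "l < H x" "0 < l" for l x
    proof (cases "P x = \<infinity>")
      case False
      then have "P x = ennreal (H x)" by (simp add: H_def less_top)
      then show ?thesis using that by (simp add: ennreal_lessI)
    qed (simp add: less_top[symmetric])
    \<comment> \<open>This sign makes l^(s - p (1 + \<gamma>) - 1) integrable at l = 0; it is where
      p < q enters.\<close>
    have e3: "(q - p) * (1 + \<gamma>) > 0" using pq \<gamma> by (intro mult_pos_pos) auto
    have e: "q - p > 0" "s - p * (1 + \<gamma>) = (q - p) * (1 + \<gamma>)" "s - p * (1 + \<gamma>) > 0"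
      using pq e3 by (auto simp: s_def algebra_simps)
    have "(\<integral>\<^sup>+x. ennreal (H x powr s) \<partial>lborel)
      = (\<integral>\<^sup>+x. \<integral>\<^sup>+l. ennreal s * (ennreal (l powr (s - 1)) * indicator {0<..<H x} l) \<partial>lborel \<partial>lborel)"
      using s H0 by (intro nn_integral_cong)
        (simp add: nn_integral_cmult nn_integral_powr_from_0 flip: ennreal_mult)
    also have "\<dots> = (\<integral>\<^sup>+l. \<integral>\<^sup>+x. ennreal s * (ennreal (l powr (s - 1)) * indicator {0<..<H x} l) \<partial>lborel \<partial>lborel)"
      unfolding indicator_def greaterThanLessThan_iff by (rule lborel_pair.Fubini') measurable
    also have "\<dots> \<le> (\<integral>\<^sup>+l. ennreal (s * l powr (s - 1)) * indicator {0<..} l *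
        (\<integral>\<^sup>+z. ennreal ((g z / \<mu> l) powr p) * indicator {z. \<mu> l < g z} z \<partial>lborel) \<partial>lborel)"
    proof (intro nn_integral_mono)
      fix l :: real
      show "(\<integral>\<^sup>+x. ennreal s * (ennreal (l powr (s - 1)) * indicator {0<..<H x} l) \<partial>lborel)
        \<le> ennreal (s * l powr (s - 1)) * indicator {0<..} l *
        (\<integral>\<^sup>+z. ennreal ((g z / \<mu> l) powr p) * indicator {z. \<mu> l < g z} z \<partial>lborel)"
      proof (cases "l > 0")
        case True
        have "(\<integral>\<^sup>+x. ennreal s * (ennreal (l powr (s - 1)) * indicator {0<..<H x} l) \<partial>lborel)
          \<le> (\<integral>\<^sup>+x. ennreal (s * l powr (s - 1)) * indicator {x. ennreal l < P x} x \<partial>lborel)"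
          using True s H_less by (intro nn_integral_mono) (auto simp: indicator_def ennreal_mult)
        also have "\<dots> = ennreal (s * l powr (s - 1)) * emeasure lborel {x. ennreal l < P x}"
          by (simp add: nn_integral_cmult)
        also have "\<dots> \<le> ennreal (s * l powr (s - 1)) *
          (\<integral>\<^sup>+z. ennreal ((g z / \<mu> l) powr p) * indicator {z. \<mu> l < g z} z \<partial>lborel)"
          using distr'[OF True] by (rule mult_left_mono) simp
        finally show ?thesis using True by simp
      qed auto
    qed
    also have "\<dots> = (\<integral>\<^sup>+l. \<integral>\<^sup>+z. ennreal (s * l powr (s - 1)) * indicator {0<..} l *
        (ennreal ((g z / \<mu> l) powr p) * indicator {z. \<mu> l < g z} z) \<partial>lborel \<partial>lborel)"
      by (intro nn_integral_cong nn_integral_cmult[symmetric]) measurable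
    also have "\<dots> = (\<integral>\<^sup>+z. \<integral>\<^sup>+l. ennreal (s * l powr (s - 1)) * indicator {0<..} l *
        (ennreal ((g z / \<mu> l) powr p) * indicator {z. \<mu> l < g z} z) \<partial>lborel \<partial>lborel)"
      unfolding indicator_def mem_Collect_eq by (rule lborel_pair.Fubini') measurable
    also have "\<dots> = (\<integral>\<^sup>+z. ennreal (C * Q powr (\<gamma> * q)) * ennreal (g z powr q) \<partial>lborel)"
    proof (rule nn_integral_cong)
      fix z
      show "(\<integral>\<^sup>+l. ennreal (s * l powr (s - 1)) * indicator {0<..} l *
        (ennreal ((g z / \<mu> l) powr p) * indicator {z. \<mu> l < g z} z) \<partial>lborel)
        = ennreal (C * Q powr (\<gamma> * q)) * ennreal (g z powr q)"
      proof (cases "g z > 0")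
        case False
        then have "g z = 0" using g0 by (metis less_eq_real_def)
        have "ennreal (s * l powr (s - 1)) * indicator {0<..} l *
          (ennreal ((g z / \<mu> l) powr p) * indicator {z. \<mu> l < g z} z) = 0" for l
          using \<mu>_pos[of l] \<open>g z = 0\<close> by (cases "l > 0") (auto simp: indicator_def)
        then show ?thesis using \<open>g z = 0\<close> by simp
      next
        case True
        define A where "A = s * (g z * Q powr \<gamma> / \<kappa>) powr p"
        have A: "A \<ge> 0" using s by (simp add: A_def)
        have "(\<integral>\<^sup>+l. ennreal (s * l powr (s - 1)) * indicator {0<..} l *
          (ennreal ((g z / \<mu> l) powr p) * indicator {z. \<mu> l < g z} z) \<partial>lborel)
          = (\<integral>\<^sup>+l. ennreal A * (ennreal (l powr (s - p * (1 + \<gamma>) - 1)) * indicator {0<..<lev (g z)} l) \<partial>lborel)"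
        proof (rule nn_integral_cong)
          fix l :: real
          show "ennreal (s * l powr (s - 1)) * indicator {0<..} l *
            (ennreal ((g z / \<mu> l) powr p) * indicator {z. \<mu> l < g z} z)
            = ennreal A * (ennreal (l powr (s - p * (1 + \<gamma>) - 1)) * indicator {0<..<lev (g z)} l)"
          proof (cases "0 < l \<and> l < lev (g z)")
            case in_range: True
            have "g z / \<mu> l = g z * Q powr \<gamma> / \<kappa> * l powr - (1 + \<gamma>)"
              unfolding \<mu>_def powr_minus divide_inverse using Q by (simp add: mult_ac)
            then have "(g z / \<mu> l) powr p = (g z * Q powr \<gamma> / \<kappa> * l powr - (1 + \<gamma>)) powr p" by simp
            also have "\<dots> = (g z * Q powr \<gamma> / \<kappa>) powr p * l powr (- (1 + \<gamma>) * p)"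
              by (subst powr_mult) (simp add: powr_powr)
            finally have "s * l powr (s - 1) * (g z / \<mu> l) powr p = A * (l powr (s - 1) * l powr (- (1 + \<gamma>) * p))"
              by (simp add: A_def mult_ac)
            also have "l powr (s - 1) * l powr (- (1 + \<gamma>) * p) = l powr (s - p * (1 + \<gamma>) - 1)"
              by (simp add: powr_add[symmetric] algebra_simps)
            finally have "ennreal (s * l powr (s - 1)) * ennreal ((g z / \<mu> l) powr p)
              = ennreal A * ennreal (l powr (s - p * (1 + \<gamma>) - 1))"
              using s A by (simp flip: ennreal_mult)
            then show ?thesis using in_range \<mu>_less_iff[of l "g z"] True by simp
          qed (use \<mu>_less_iff[of l "g z"] True in \<open>auto simp: indicator_def\<close>)
        qed
        also have "\<dots> = ennreal A * ennreal (lev (g z) powr (s - p * (1 + \<gamma>)) / (s - p * (1 + \<gamma>)))"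
          using e lev_pos[OF True] by (simp add: nn_integral_cmult nn_integral_powr_from_0)
        also have "\<dots> = ennreal (A * (lev (g z) powr (s - p * (1 + \<gamma>)) / (s - p * (1 + \<gamma>))))"
          using A e by (simp flip: ennreal_mult)
        also have "lev (g z) powr (s - p * (1 + \<gamma>)) = (g z * Q powr \<gamma> / \<kappa>) powr (q - p)"
          unfolding e(2) lev_def using \<gamma> by (simp add: powr_powr)
        also have "A * ((g z * Q powr \<gamma> / \<kappa>) powr (q - p) / (s - p * (1 + \<gamma>)))
          = s / ((q - p) * (1 + \<gamma>)) * ((g z * Q powr \<gamma> / \<kappa>) powr p * (g z * Q powr \<gamma> / \<kappa>) powr (q - p))"
          unfolding e(2) A_def by simp
        also have "(g z * Q powr \<gamma> / \<kappa>) powr p * (g z * Q powr \<gamma> / \<kappa>) powr (q - p) = (g z * Q powr \<gamma> / \<kappa>) powr q"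
          by (simp flip: powr_add)
        also have "\<dots> = \<kappa> powr - q * Q powr (\<gamma> * q) * g z powr q"
          using \<kappa> Q True by (simp add: powr_mult powr_powr powr_minus divide_inverse inverse_powr mult_ac)
        also have "s / ((q - p) * (1 + \<gamma>)) = q / (q - p)" using \<gamma> by (simp add: s_def)
        also have "q / (q - p) * (\<kappa> powr - q * Q powr (\<gamma> * q) * g z powr q) = C * Q powr (\<gamma> * q) * g z powr q"
          by (simp add: C_def)
        finally show ?thesis using C by (simp add: ennreal_mult)
      qed
    qed
    also have "\<dots> = ennreal (C * Q powr (\<gamma> * q)) * (\<integral>\<^sup>+z. ennreal (g z powr q) \<partial>lborel)"
      by (rule nn_integral_cmult) measurable
    also have "\<dots> \<le> ennreal (C * Q powr (\<gamma> * q)) * ennreal (Q powr q)"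
      using gq by (rule mult_left_mono) simp
    also have "\<dots> = ennreal (C * Q powr s)"
      using C by (simp add: s_def algebra_simps powr_add flip: ennreal_mult)
    finally show "(\<integral>\<^sup>+x. ennreal (enn2real (mean_potential \<alpha> p g x {0<..}) powr (q * (1 + \<gamma>))) \<partial>lborel)
      \<le> ennreal (C * Q powr (q * (1 + \<gamma>)))"
      unfolding H_def P_def s_def .
  qed
qed

subsection \<open>Gradients and functions on the sphere\<close>

text \<open>\<open>grad\<close> is a definite description, while \<open>Ck\<close> speaks of
  directional derivatives. The candidate assembles the derivatives along \<open>Basis\<close>;
  uniqueness of the Frechet derivative identifies it with \<open>grad\<close>, and continuity is
  inherited from each summand.\<close>

lemma smooth_grad:
  fixes \<phi> :: "'a::euclidean_space \<Rightarrow> real"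
  assumes "smooth \<phi>"
  shows "(\<phi> has_derivative (\<lambda>h. grad \<phi> y \<bullet> h)) (at y)" and "continuous_on UNIV (grad \<phi>)"
proof -
  have "Ck (Suc 0) \<phi>" using assms by (auto simp: smooth_def)
  then have diff: "\<phi> differentiable (at x)" and cont: "continuous_on UNIV (\<lambda>x. frechet_derivative \<phi> (at x) v)" for x v
    by auto
  define D where "D x = (\<Sum>b\<in>Basis. frechet_derivative \<phi> (at x) b *\<^sub>R b)" for x
  have der: "(\<phi> has_derivative (\<lambda>h. D x \<bullet> h)) (at x)" for x
  proof -
    let ?f = "frechet_derivative \<phi> (at x)"
    have d: "(\<phi> has_derivative ?f) (at x)" using diff by (simp add: frechet_derivative_works)
    then have "linear ?f" by (rule has_derivative_linear)
    have "?f h = D x \<bullet> h" for h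
    proof -
      have "?f h = ?f (\<Sum>b\<in>Basis. (h \<bullet> b) *\<^sub>R b)" by (simp add: euclidean_representation)
      also have "\<dots> = (\<Sum>b\<in>Basis. (h \<bullet> b) *\<^sub>R ?f b)"
        using \<open>linear ?f\<close> by (simp add: linear_sum linear_scale)
      also have "\<dots> = D x \<bullet> h" 
        unfolding D_def inner_sum_left by (intro sum.cong) (auto simp: inner_commute mult.commute)
      finally show ?thesis .
    qed
    then show ?thesis using d by (metis (no_types, lifting) ext)
  qed
  have "grad \<phi> x = D x" for x
    unfolding grad_def
  proof (rule the_equality)
    show "GDERIV \<phi> x :> D x" using der by (simp add: gderiv_def inner_commute)
  next
    fix E assume "GDERIV \<phi> x :> E"
    then have "(\<lambda>h. h \<bullet> E) = (\<lambda>h. D x \<bullet> h)"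
      unfolding gderiv_def using der by (rule has_derivative_unique)
    then have "h \<bullet> E = h \<bullet> D x" for h by (metis inner_commute)
    then show "E = D x" using vector_eq_ldot by blast
  qed
  then have gD: "grad \<phi> = D" by auto
  show "(\<phi> has_derivative (\<lambda>h. grad \<phi> y \<bullet> h)) (at y)" unfolding gD by (rule der)
  show "continuous_on UNIV (grad \<phi>)" unfolding gD D_def by (intro continuous_intros cont)
qed

section \<open>Surface measure as cone measure, and extension of functions from the sphere\<close>

definition cone_measure :: "'a::euclidean_space measure" where
  "cone_measure = density (distr (restrict_space lborel (ball 0 1 - {0})) (restrict_space borel (sphere 0 1))
     (\<lambda>x. x /\<^sub>R norm x)) (\<lambda>_. ennreal (real DIM('a)))"

text \<open>Turning the scaling into a constant density makes the integration rules for densities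
  available.\<close>

lemma surface_measure_eq: "surface_measure = completion (cone_measure :: 'a::euclidean_space measure)"
proof -
  have "scale_measure c M = density M (\<lambda>_. c)" for c and M :: "'a measure"
    by (rule measure_eqI) (auto simp: emeasure_density nn_integral_cmult_indicator)
  then show ?thesis by (simp add: surface_measure_def cone_measure_def ennreal_of_nat_eq_real_of_nat)
qed

lemma sets_cone_measure[measurable_cong]: "sets cone_measure = sets (restrict_space borel (sphere (0::'a::euclidean_space) 1))"
  by (simp add: cone_measure_def)

text \<open>The extension homogeneous of degree 0. The origin is set apart because y / |y| evaluates
  to 0 there, which lies off the sphere.\<close>

definition radial_extension :: "('a::euclidean_space \<Rightarrow> 'b::zero) \<Rightarrow> 'a \<Rightarrow> 'b" where
  "radial_extension h y = (if y = 0 then 0 else h (y /\<^sub>R norm y))"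

lemma radial_extension_scale: "c > 0 \<Longrightarrow> radial_extension h (c *\<^sub>R y) = radial_extension h y"
  by (auto simp: radial_extension_def field_simps)

lemma radial_extension_measurable:
  fixes h :: "'a::euclidean_space \<Rightarrow> 'b::{topological_space, zero}"
  assumes h: "h \<in> borel_measurable cone_measure"
  shows "radial_extension h \<in> borel_measurable borel"
  unfolding radial_extension_def[abs_def]
proof (rule measurable_If_restrict_space_iff[THEN iffD2])
  show "{x \<in> space borel. x = (0::'a)} \<in> sets borel" by simp
  have "(\<lambda>y::'a. y /\<^sub>R norm y) \<in> restrict_space borel {x. x \<noteq> 0} \<rightarrow>\<^sub>M restrict_space borel (sphere 0 1)"
    by (intro measurable_restrict_space2 measurable_restrict_space1) (auto simp: space_restrict_space)
  moreover have "h \<in> borel_measurable (restrict_space borel (sphere 0 1))"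
    using h by (simp cong: measurable_cong_sets add: sets_cone_measure)
  ultimately show "(\<lambda>x. 0) \<in> borel_measurable (restrict_space borel {x::'a. x = 0}) \<and>
      (\<lambda>x. h (x /\<^sub>R norm x)) \<in> borel_measurable (restrict_space borel {x. x \<noteq> 0})"
    using measurable_compose by fastforce
qed

lemma nn_integral_cone_measure:
  fixes h :: "'a::euclidean_space \<Rightarrow> ennreal"
  assumes h: "h \<in> borel_measurable cone_measure"
  shows "(\<integral>\<^sup>+\<theta>. h \<theta> \<partial>cone_measure)
    = ennreal (real DIM('a)) * (\<integral>\<^sup>+y. radial_extension h y * indicator (ball 0 1) y \<partial>lborel)"
proof -
  have h': "h \<in> borel_measurable (restrict_space borel (sphere 0 1))"
    using h by (simp cong: measurable_cong_sets add: sets_cone_measure)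
  have "(\<integral>\<^sup>+\<theta>. h \<theta> \<partial>cone_measure) = ennreal (real DIM('a)) *
    (\<integral>\<^sup>+y. h (y /\<^sub>R norm y) \<partial>restrict_space lborel (ball 0 1 - {0}))"
    unfolding cone_measure_def using h'
    by (simp add: nn_integral_density nn_integral_cmult nn_integral_distr[OF radial_projection_measurable])
  also have "(\<integral>\<^sup>+y. h (y /\<^sub>R norm y) \<partial>restrict_space lborel (ball 0 1 - {0}))
    = (\<integral>\<^sup>+y. h (y /\<^sub>R norm y) * indicator (ball 0 1 - {0}) y \<partial>lborel)"
    by (rule nn_integral_restrict_space) simp
  also have "\<dots> = (\<integral>\<^sup>+y. radial_extension h y * indicator (ball 0 1) y \<partial>lborel)"
    by (intro nn_integral_cong) (auto simp: radial_extension_def indicator_def)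
  finally show ?thesis .
qed

lemma integral_cone_measure:
  fixes h :: "'a::euclidean_space \<Rightarrow> real"
  assumes h: "h \<in> borel_measurable cone_measure"
  shows "(\<integral>\<theta>. h \<theta> \<partial>cone_measure)
    = real DIM('a) * (\<integral>y. indicator (ball 0 1) y * radial_extension h y \<partial>lborel)"
proof -
  have h': "h \<in> borel_measurable (restrict_space borel (sphere 0 1))"
    using h by (simp cong: measurable_cong_sets add: sets_cone_measure)
  have "(\<integral>\<theta>. h \<theta> \<partial>cone_measure) = real DIM('a) *
    (\<integral>y. h (y /\<^sub>R norm y) \<partial>restrict_space lborel (ball 0 1 - {0}))"
    unfolding cone_measure_def using h'
    by (simp add: integral_density integral_distr[OF radial_projection_measurable h'])
  also have "(\<integral>y. h (y /\<^sub>R norm y) \<partial>restrict_space lborel (ball 0 1 - {0}))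
    = (\<integral>y. indicator (ball 0 1 - {0}) y *\<^sub>R h (y /\<^sub>R norm y) \<partial>lborel)"
    by (rule integral_restrict_space) simp
  also have "\<dots> = (\<integral>y. indicator (ball 0 1) y * radial_extension h y \<partial>lborel)"
    by (intro Bochner_Integration.integral_cong) (auto simp: radial_extension_def indicator_def)
  finally show ?thesis .
qed

text \<open>The cone over a null set of directions meets the unit ball in a null set, by the
  definition of the measure; homogeneity extends this to balls of every integer radius, which cover
  the space.\<close>

lemma AE_cone_measure_radial:
  fixes P :: "'a::euclidean_space \<Rightarrow> bool"
  assumes "AE \<theta> in cone_measure. P \<theta>"
  shows "AE y in lborel. y \<noteq> 0 \<longrightarrow> P (y /\<^sub>R norm y)"
proof -
  obtain N where N: "N \<in> null_sets cone_measure" "{\<theta> \<in> space cone_measure. \<not> P \<theta>} \<subseteq> N"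
    using assms by (auto elim!: AE_E)
  define h :: "'a \<Rightarrow> ennreal" where "h = radial_extension (indicator N)"
  have ind: "(indicator N :: 'a \<Rightarrow> ennreal) \<in> borel_measurable cone_measure" using N by auto
  then have h[measurable]: "h \<in> borel_measurable borel" unfolding h_def by (rule radial_extension_measurable)
  have "ennreal (real DIM('a)) * (\<integral>\<^sup>+y. h y * indicator (ball 0 1) y \<partial>lborel) = emeasure cone_measure N"
    unfolding h_def nn_integral_cone_measure[OF ind, symmetric] using N by (intro nn_integral_indicator) auto
  then have "(\<integral>\<^sup>+y. h y * indicator (ball 0 1) y \<partial>lborel) = 0"
    using N(1) by (auto simp: null_sets_def)
  then have "(\<integral>\<^sup>+y. h y * indicator (ball 0 (real (Suc k))) y \<partial>lborel) = 0" for k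
    by (subst homogeneous_ball_nn_integral[OF h]) (auto simp: h_def radial_extension_scale)
  then have "AE y in lborel. h y * indicator (ball 0 (real (Suc k))) y = 0" for k
    by (subst (asm) nn_integral_0_iff_AE) auto
  then have "AE y in lborel. \<forall>k. h y * indicator (ball 0 (real (Suc k))) y = 0"
    unfolding AE_all_countable by blast
  then show ?thesis
  proof eventually_elim
    case (elim y)
    obtain k where "norm y < real k" using reals_Archimedean2 by blast
    then have "y \<in> ball 0 (real (Suc k))" by simp
    with elim have "h y = 0" by (auto dest!: spec[of _ k] simp: indicator_def)
    then have "y /\<^sub>R norm y \<notin> N" if "y \<noteq> 0"
      using that by (auto simp: h_def radial_extension_def indicator_def split: if_splits)
    moreover have "y /\<^sub>R norm y \<in> space cone_measure" if "y \<noteq> 0"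
      using that by (simp add: cone_measure_def space_restrict_space)
    ultimately show ?case using N(2) by auto
  qed
qed

text \<open>\<open>\<Omega>\<close> is measurable only for the completed measure, so its radial
  extension need not be Borel. A Borel function equal to it almost everywhere is extended instead;
  both integrals over the sphere are unchanged.\<close>

lemma surface_function_representative:
  fixes \<Omega> :: "'a::euclidean_space \<Rightarrow> real"
  assumes "1 < \<rho>" and \<Omega>: "in_Lp surface_measure \<rho> \<Omega>" "(\<integral>\<theta>. \<Omega> \<theta> \<partial>surface_measure) = 0"
  obtains w W where "homogeneous_kernel w \<rho> W" "AE y in lborel. y \<noteq> 0 \<longrightarrow> \<Omega> (y /\<^sub>R norm y) = w y"
proof -
  have \<Omega>m: "\<Omega> \<in> borel_measurable (completion cone_measure)" and \<Omega>i: "integrable (completion cone_measure) (\<lambda>\<theta>. \<bar>\<Omega> \<theta>\<bar> powr \<rho>)"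
    using \<Omega> by (auto simp: in_Lp_def surface_measure_eq)
  obtain \<Omega>' where \<Omega>'[measurable]: "\<Omega>' \<in> borel_measurable cone_measure" and eq: "AE \<theta> in cone_measure. \<Omega> \<theta> = \<Omega>' \<theta>"
    using completion_ex_borel_measurable_real[OF \<Omega>m] by auto
  define w where "w = radial_extension \<Omega>'"
  have [measurable]: "w \<in> borel_measurable borel" unfolding w_def by (rule radial_extension_measurable) fact
  have "(\<integral>\<^sup>+\<theta>. ennreal (\<bar>\<Omega> \<theta>\<bar> powr \<rho>) \<partial>completion cone_measure) < \<infinity>"
    using \<Omega>i by (simp add: integrable_iff_bounded)
  also have "(\<integral>\<^sup>+\<theta>. ennreal (\<bar>\<Omega> \<theta>\<bar> powr \<rho>) \<partial>completion cone_measure) = (\<integral>\<^sup>+\<theta>. ennreal (\<bar>\<Omega>' \<theta>\<bar> powr \<rho>) \<partial>cone_measure)"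
    unfolding nn_integral_completion by (rule nn_integral_cong_AE) (use eq in eventually_elim, simp)
  also have "\<dots> = ennreal (real DIM('a)) *
      (\<integral>\<^sup>+y. radial_extension (\<lambda>\<theta>. ennreal (\<bar>\<Omega>' \<theta>\<bar> powr \<rho>)) y * indicator (ball 0 1) y \<partial>lborel)"
    by (rule nn_integral_cone_measure) measurable
  also have "(\<integral>\<^sup>+y. radial_extension (\<lambda>\<theta>. ennreal (\<bar>\<Omega>' \<theta>\<bar> powr \<rho>)) y * indicator (ball 0 1) y \<partial>lborel)
      = (\<integral>\<^sup>+y. ennreal (\<bar>w y\<bar> powr \<rho>) * indicator (ball 0 1) y \<partial>lborel)"
    by (intro nn_integral_cong) (auto simp: w_def radial_extension_def)
  finally have "(\<integral>\<^sup>+y. ennreal (\<bar>w y\<bar> powr \<rho>) * indicator (ball 0 1) y \<partial>lborel) < \<infinity>"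
    by (auto simp: ennreal_mult_less_top)
  then obtain W0 where W0: "W0 \<ge> 0" "(\<integral>\<^sup>+y. ennreal (\<bar>w y\<bar> powr \<rho>) * indicator (ball 0 1) y \<partial>lborel) = ennreal W0"
    by (auto simp: less_top_ennreal)
  have "0 = (\<integral>\<theta>. \<Omega> \<theta> \<partial>completion cone_measure)" using \<Omega> by (simp add: surface_measure_eq)
  also have "\<dots> = (\<integral>\<theta>. \<Omega>' \<theta> \<partial>completion cone_measure)"
    using \<Omega>m eq by (intro integral_cong_AE) (auto intro: measurable_completion AE_completion)
  also have "\<dots> = (\<integral>\<theta>. \<Omega>' \<theta> \<partial>cone_measure)" by (rule integral_completion) fact
  also have "\<dots> = real DIM('a) * (\<integral>y. indicator (ball 0 1) y * w y \<partial>lborel)"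
    unfolding w_def by (rule integral_cone_measure) fact
  finally have mean: "(\<integral>y. indicator (ball 0 1) y * w y \<partial>lborel) = 0" by simp
  show ?thesis
  \<comment> \<open>Adding 1 gives a positive bound even if the integral is 0.\<close>
  proof (rule that[of w "W0 + 1"])
    show "homogeneous_kernel w \<rho> (W0 + 1)"
    proof unfold_locales
      show "w (c *\<^sub>R y) = w y" if "c > 0" for c y
        using that by (simp add: w_def radial_extension_scale)
    qed (use W0 mean assms in \<open>auto intro!: ennreal_leI\<close>)
    show "AE y in lborel. y \<noteq> 0 \<longrightarrow> \<Omega> (y /\<^sub>R norm y) = w y"
      using AE_cone_measure_radial[OF eq] by eventually_elim (simp add: w_def radial_extension_def)
  qed
qed

subsection \<open>Principal values\<close>

text \<open>Continuity from above for the measure with density r^\<alpha> times the ball mean, which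
  is finite on the positive half-line.\<close>

lemma mean_potential_tail:
  fixes g :: "'a::euclidean_space \<Rightarrow> real"
  assumes [measurable]: "g \<in> borel_measurable borel"
    and fin: "mean_potential \<alpha> p g x {0<..} < \<infinity>" and "e > 0"
  obtains K where "K > 0" "mean_potential \<alpha> p g x ({0<..1 / K} \<union> {K..}) < ennreal e"
proof -
  have [measurable]: "(\<lambda>r. ball_mean p g x r) \<in> borel_measurable borel"
    by measurable
  define N where "N = density lborel (\<lambda>r. ennreal (r powr \<alpha> * ball_mean p g x r))"
  have N: "emeasure N A = mean_potential \<alpha> p g x A" if "A \<in> sets borel" for A
    using that unfolding N_def mean_potential_def by (subst emeasure_density) auto
  have sets_N[measurable_cong]: "sets N = sets borel" by (simp add: N_def)
  \<comment> \<open>These sets decrease to the empty set; the successor keeps the reciprocal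
    meaningful at k = 0.\<close>
  define A where "A k = {0<..1 / real (Suc k)} \<union> {real (Suc k)..}" for k
  have "decseq A"
    unfolding decseq_Suc_iff A_def by (auto intro: order_trans simp: field_simps)
  moreover have "(\<Inter>k. A k) = {}"
  proof (rule ccontr)
    assume "(\<Inter>k. A k) \<noteq> {}"
    then obtain r where r: "\<And>k. r \<in> A k" by blast
    from r[of 0] have "r > 0" by (auto simp: A_def)
    obtain k where k: "max r (1 / r) < real k" using reals_Archimedean2 by blast
    then have "1 / real (Suc k) < r"
      using \<open>r > 0\<close> by (simp add: field_simps)
    then show False using r[of k] k by (auto simp: A_def)
  qed
  moreover have "emeasure N (A k) \<noteq> \<infinity>" for k
  proof -
    have "emeasure N (A k) \<le> emeasure N {0<..}"
      by (intro emeasure_mono) (auto simp: A_def)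
    then show ?thesis using fin by (auto simp: N)
  qed
  moreover have "range A \<subseteq> sets N" by (auto simp: sets_N A_def)
  ultimately have "(\<lambda>k. emeasure N (A k)) \<longlonglongrightarrow> 0"
    using Lim_emeasure_decseq[of A N] by simp
  then have "\<forall>\<^sub>F k in sequentially. emeasure N (A k) < ennreal e"
    using \<open>e > 0\<close> by (intro order_tendstoD(2)) auto
  then obtain k where "emeasure N (A k) < ennreal e"
    by (meson eventually_sequentially order_refl)
  moreover have "A k \<in> sets borel" by (simp add: A_def)
  ultimately show ?thesis
    by (intro that[of "real (Suc k)"]) (auto simp: N[symmetric] A_def)
qed

lemma mean_potential_mono: "A \<subseteq> B \<Longrightarrow> mean_potential \<alpha> p g x A \<le> mean_potential \<alpha> p g x B"
  unfolding mean_potential_def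
  by (intro nn_integral_mono mult_left_mono) (auto simp: indicator_def)

context homogeneous_kernel
begin

text \<open>Splitting at radius 1 separates the inner from the outer limit. A change of either
  radius alters the integral by that over one annulus, which the bound charges to very small or very
  large radii, so the joint limit exists by the Cauchy criterion.\<close>

lemma annulus_integral_convergent:
  assumes cont: "continuous_on UNIV \<phi>" and [measurable]: "g \<in> borel_measurable borel"
    and C: "C > 0" and bound: "\<And>a b. 0 < a \<Longrightarrow> a < b \<Longrightarrow>
      ennreal \<bar>annulus_integral m \<phi> x a b\<bar> \<le> ennreal C * mean_potential \<alpha> p g x {a<..<2 * b}"
    and fin: "mean_potential \<alpha> p g x {0<..} < \<infinity>"
  shows "\<exists>l. ((\<lambda>(\<epsilon>, R). annulus_integral m \<phi> x \<epsilon> R) \<longlongrightarrow> l) (at_right 0 \<times>\<^sub>F at_top)"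
proof -
  let ?J = "annulus_integral m \<phi> x"
  let ?F = "at_right (0::real) \<times>\<^sub>F (at_top :: real filter)"
  have "cauchy_filter (filtermap (\<lambda>(\<epsilon>, R). ?J \<epsilon> R) ?F)"
    unfolding cauchy_filter_metric_filtermap
  proof (intro allI impI)
    fix e :: real assume "e > 0"
    then have "e / (2 * C) > 0" using C by simp
    from mean_potential_tail[OF _ fin this]
    obtain K where K: "K > 0" "mean_potential \<alpha> p g x ({0<..1 / K} \<union> {K..}) < ennreal (e / (2 * C))"
      by auto
    define L where "L = max K 1"
    \<comment> \<open>The bound for an annulus reaches out to twice its outer radius, hence 1 / (2
      K). The minimum with 1/2 here and the maximum with 1 in L keep the radius 1 between the two
      cut-offs.\<close>
    define d where "d = min (1 / (2 * K)) (1 / 2)"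
    have d: "d > 0" "2 * d \<le> 1 / K" "d < 1" using K by (auto simp: d_def min_def field_simps)
    have small: "\<bar>?J a b\<bar> < e / 2" if "0 < a" "a < b" "2 * b \<le> 1 / K \<or> K \<le> a" for a b
    proof -
      have "{a<..<2 * b} \<subseteq> {0<..1 / K} \<union> {K..}" using that by auto
      then have "mean_potential \<alpha> p g x {a<..<2 * b} < ennreal (e / (2 * C))"
        by (rule le_less_trans[OF mean_potential_mono K(2)])
      then have "ennreal C * mean_potential \<alpha> p g x {a<..<2 * b} < ennreal C * ennreal (e / (2 * C))"
        using C by (intro ennreal_mult_strict_left_mono) auto
      also have "\<dots> = ennreal (e / 2)" using C by (simp flip: ennreal_mult')
      finally have "ennreal \<bar>?J a b\<bar> < ennreal (e / 2)" by (rule le_less_trans[OF bound[OF that(1,2)]])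
      then show ?thesis by (simp add: ennreal_less_iff)
    qed
    have near: "\<bar>?J a 1 - ?J b 1\<bar> < e / 2" if "a \<in> {0<..<d}" "b \<in> {0<..<d}" for a b
    proof -
      have *: "\<bar>?J a 1 - ?J b 1\<bar> < e / 2" if "a \<in> {0<..<d}" "b \<in> {0<..<d}" "a < b" for a b
      proof -
        have "?J a 1 = ?J a b + ?J b 1" using that d by (intro annulus_integral_split cont) auto
        then show ?thesis using small[of a b] that d by auto
      qed
      show ?thesis using *[of a b] *[of b a] that \<open>e > 0\<close>
        by (cases a b rule: linorder_cases) (auto simp: abs_minus_commute)
    qed
    have far: "\<bar>?J 1 a - ?J 1 b\<bar> < e / 2" if "a > L" "b > L" for a b
    proof -
      have *: "\<bar>?J 1 a - ?J 1 b\<bar> < e / 2" if "a > L" "b > L" "a < b" for a b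
      proof -
        have "?J 1 b = ?J 1 a + ?J a b" using that by (intro annulus_integral_split cont) (auto simp: L_def)
        then show ?thesis using small[of a b] that by (auto simp: L_def)
      qed
      show ?thesis using *[of a b] *[of b a] that \<open>e > 0\<close>
        by (cases a b rule: linorder_cases) (auto simp: abs_minus_commute)
    qed
    show "\<exists>P. eventually P ?F \<and> (\<forall>u v. P u \<and> P v \<longrightarrow> dist (case u of (\<epsilon>, R) \<Rightarrow> ?J \<epsilon> R) (case v of (\<epsilon>, R) \<Rightarrow> ?J \<epsilon> R) < e)"
    proof (intro exI[of _ "\<lambda>u. fst u \<in> {0<..<d} \<and> L < snd u"] conjI allI impI)
      show "\<forall>\<^sub>F u in ?F. fst u \<in> {0<..<d} \<and> L < snd u"
        by (rule eventually_prodI[OF eventually_at_right_real[OF d(1)] eventually_gt_at_top])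
      fix u v :: "real \<times> real"
      assume *: "(fst u \<in> {0<..<d} \<and> L < snd u) \<and> fst v \<in> {0<..<d} \<and> L < snd v"
      have split: "?J a b = ?J a 1 + ?J 1 b" if "a \<in> {0<..<d}" "L < b" for a b
        using that d by (intro annulus_integral_split cont) (auto simp: L_def)
      have "dist (?J (fst u) (snd u)) (?J (fst v) (snd v)) < e"
        unfolding dist_real_def split[of "fst u" "snd u", OF conjunct1[OF conjunct1[OF *]] conjunct2[OF conjunct1[OF *]]]
          split[of "fst v" "snd v", OF conjunct1[OF conjunct2[OF *]] conjunct2[OF conjunct2[OF *]]]
        using near[of "fst u" "fst v"] far[of "snd u" "snd v"] * by linarith
      then show "dist (case u of (\<epsilon>, R) \<Rightarrow> ?J \<epsilon> R) (case v of (\<epsilon>, R) \<Rightarrow> ?J \<epsilon> R) < e"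
        by (simp add: case_prod_beta)
    qed
  qed
  moreover have "?F \<noteq> bot" by (simp add: prod_filter_eq_bot)
  ultimately have "\<exists>c. filtermap (\<lambda>(\<epsilon>, R). ?J \<epsilon> R) ?F \<le> nhds c"
    by (intro cauchy_filter_complete_converges[OF _ complete_UNIV]) (auto simp: filtermap_bot_iff)
  then show ?thesis by (simp add: filterlim_def)
qed

lemma T_integrand_AE_eq:
  assumes eq: "AE y in lborel. y \<noteq> 0 \<longrightarrow> \<Omega> (y /\<^sub>R norm y) = w y"
  shows "AE y in lebesgue. T_integrand \<Omega> \<alpha> \<phi> x y = w y * norm y powr - (real DIM('a) - \<alpha>) * \<phi> (x - y)"
proof (rule AE_completion)
  show "AE y in lborel. T_integrand \<Omega> \<alpha> \<phi> x y = w y * norm y powr - (real DIM('a) - \<alpha>) * \<phi> (x - y)"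
    using eq AE_lborel_singleton[of "0::'a"]
    unfolding T_integrand_def powr_minus divide_inverse by eventually_elim simp
qed

text \<open>On every annulus the integrand agrees almost everywhere with a Borel integrable one, so
  the integrability clause of \<open>has_pv\<close> holds by itself and Lebesgue integrals become
  Borel ones.\<close>

lemma has_pv_T_integrand_iff:
  fixes \<phi> :: "'a \<Rightarrow> real"
  assumes eq: "AE y in lborel. y \<noteq> 0 \<longrightarrow> \<Omega> (y /\<^sub>R norm y) = w y" and cont: "continuous_on UNIV \<phi>"
  shows "has_pv (T_integrand \<Omega> \<alpha> \<phi> x) l \<longleftrightarrow>
    ((\<lambda>(\<epsilon>, R). annulus_integral (real DIM('a) - \<alpha>) \<phi> x \<epsilon> R) \<longlongrightarrow> l) (at_right 0 \<times>\<^sub>F at_top)"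
proof -
  have [measurable]: "\<phi> \<in> borel_measurable borel" using cont by (rule borel_measurable_continuous_onI)
  have contx: "continuous_on UNIV (\<lambda>y. \<phi> (x - y))"
    by (rule continuous_on_compose2[OF cont]) (auto intro!: continuous_intros)
  let ?k = "\<lambda>y. w y * norm y powr - (real DIM('a) - \<alpha>) * \<phi> (x - y)"
  let ?T = "T_integrand \<Omega> \<alpha> \<phi> x"
  note AE_eq = T_integrand_AE_eq[OF eq, of \<alpha> \<phi> x]
  have km: "(\<lambda>y. indicator (annulus a b) y *\<^sub>R ?k y) \<in> borel_measurable lebesgue" for a b
    by (rule measurable_completion) measurable
  have AEi: "AE y in lebesgue. indicator (annulus a b) y *\<^sub>R ?k y = indicator (annulus a b) y *\<^sub>R ?T y" for a b
    using AE_eq by eventually_elim simp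
  have Tm: "(\<lambda>y. indicator (annulus a b) y *\<^sub>R ?T y) \<in> borel_measurable lebesgue" for a b
    by (rule borel_measurable_AE[OF km AEi])
  have int: "set_integrable lebesgue (annulus a b) ?T" if "a > 0" for a b
    unfolding set_integrable_def
  proof (rule integrable_cong_AE_imp[OF _ Tm])
    show "integrable lebesgue (\<lambda>y. indicator (annulus a b) y *\<^sub>R ?k y)"
      using annulus_integrable[OF that contx, of b "real DIM('a) - \<alpha>"] by (subst integrable_completion) auto
    show "AE y in lebesgue. indicator (annulus a b) y *\<^sub>R ?k y = indicator (annulus a b) y *\<^sub>R ?T y"
      by (rule AEi)
  qed
  have val: "(LINT y:annulus a b|lebesgue. ?T y) = annulus_integral (real DIM('a) - \<alpha>) \<phi> x a b" for a b
  proof -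
    have "(LINT y:annulus a b|lebesgue. ?T y) = (\<integral>y. indicator (annulus a b) y *\<^sub>R ?k y \<partial>lebesgue)"
      unfolding set_lebesgue_integral_def
      by (rule integral_cong_AE[OF Tm km]) (use AEi[of a b] in eventually_elim, rule sym)
    also have "\<dots> = annulus_integral (real DIM('a) - \<alpha>) \<phi> x a b"
      unfolding annulus_integral_def by (subst integral_completion) auto
    finally show ?thesis .
  qed
  show ?thesis
    unfolding has_pv_def using int val by (simp add: annulus_def)
qed

end

lemma pv_eq:
  assumes "has_pv f l"
  shows "pv f = l"
proof -
  have "at_right (0::real) \<times>\<^sub>F (at_top :: real filter) \<noteq> bot" by (simp add: prod_filter_eq_bot)
  then show ?thesis
    unfolding pv_def using assms by (intro the_equality) (auto simp: has_pv_def intro: tendsto_unique)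
qed

section \<open>Choice of the exponent p and assembly of the estimate\<close>

lemma exponent_choice:
  fixes n \<rho> q :: real
  assumes "1 < \<rho>" "n > 0" "1 < \<rho> * n / (\<rho> * n + \<rho> - n)" "\<rho> * n / (\<rho> * n + \<rho> - n) < q"
  obtains p where "1 < p" "p < q" "1 \<le> 1 / \<rho> + 1 / p" "1 / \<rho> + 1 / p < 1 + 1 / n"
proof -
  \<comment> \<open>Since 1/q0 = 1 + 1/n - 1/\<rho>, the bound p > q0 is the subcritical condition.
    Since 1/q0 exceeds 1 - 1/\<rho>, q0 lies below the conjugate exponent \<rho> / (\<rho> - 1),
    which leaves room for p below both this and q; p below the conjugate exponent gives 1 \<le>
    1/\<rho> + 1/p.\<close>
  define q0 where "q0 = \<rho> * n / (\<rho> * n + \<rho> - n)"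
  have "\<rho> * n - n > 0" using assms by simp
  then have D: "\<rho> * n + \<rho> - n > 0" using assms by linarith
  have q0: "1 / q0 = 1 + 1 / n - 1 / \<rho>"
    using assms D by (simp add: q0_def field_simps)
  have "q0 > 1" "q0 < q" using assms by (auto simp: q0_def)
  moreover have "q0 < \<rho> / (\<rho> - 1)"
    using assms D \<open>q0 > 1\<close> unfolding q0_def by (simp add: divide_simps) (simp add: algebra_simps)
  ultimately obtain p where p: "q0 < p" "p < min q (\<rho> / (\<rho> - 1))"
    using dense[of q0 "min q (\<rho> / (\<rho> - 1))"] by auto
  then have "p > 1" using \<open>q0 > 1\<close> by simp
  have "p * (\<rho> - 1) < \<rho>" using p assms by (simp add: field_simps)
  then have "1 \<le> 1 / \<rho> + 1 / p" using \<open>p > 1\<close> assms by (simp add: field_simps)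
  moreover have "1 / p < 1 / q0" using p \<open>q0 > 1\<close> by (intro divide_strict_left_mono) auto
  ultimately show ?thesis using that[of p] p \<open>p > 1\<close> q0 by auto
qed

text \<open>Wherever the potential P of the gradient is finite, the principal value exists and is at
  most C1 P, so the strong bound for P carries over. That bound needs a positive Q, so norms are
  estimated for every Q > Q0 and Q tends to the gradient norm Q0 at the end; this includes a
  vanishing gradient.\<close>

lemma rough_operator_gradient_bound:
  fixes \<Omega> :: "'a::euclidean_space \<Rightarrow> real" and \<alpha> \<rho> q s :: real
  defines "n \<equiv> real DIM('a)"
  assumes \<alpha>: "0 < \<alpha>" "\<alpha> < n" and \<rho>: "1 < \<rho>"
    and \<Omega>: "in_Lp surface_measure \<rho> \<Omega>" "(\<integral>\<theta>. \<Omega> \<theta> \<partial>surface_measure) = 0"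
    and q0: "1 < \<rho> * n / (\<rho> * n + \<rho> - n)" "\<rho> * n / (\<rho> * n + \<rho> - n) < q"
    and q: "q < n / (1 + \<alpha>)" and s: "s = q * n / (n - q * (1 + \<alpha>))"
  shows "\<exists>C>0. \<forall>\<phi> :: 'a \<Rightarrow> real. smooth \<phi> \<longrightarrow> in_Lp lebesgue q (grad \<phi>) \<longrightarrow>
    (AE x in lebesgue. \<exists>l. has_pv (T_integrand \<Omega> \<alpha> \<phi> x) l) \<and>
    in_Lp lebesgue s (T_op \<Omega> \<alpha> \<phi>) \<and>
    Lp_norm lebesgue s (T_op \<Omega> \<alpha> \<phi>) \<le> C * Lp_norm lebesgue q (grad \<phi>)"
proof -
  have n: "n > 0" by (simp add: n_def)
  obtain p where p: "1 < p" "p < q" "1 \<le> 1 / \<rho> + 1 / p" "1 / \<rho> + 1 / p < 1 + 1 / n"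
    using exponent_choice[OF \<rho> n q0] by blast
  have q1: "q > 1" using p by simp
  have aq: "1 + \<alpha> < n / q" using q q1 \<alpha> by (simp add: field_simps)
  define \<gamma> where "\<gamma> = (1 + \<alpha>) / (n / q - 1 - \<alpha>)"
  have \<gamma>: "\<gamma> > 0" using \<alpha> aq by (simp add: \<gamma>_def)
  have s_eq: "s = q * (1 + \<gamma>)"
  proof -
    have "n - q * (1 + \<alpha>) > 0" "n / q - 1 - \<alpha> > 0" using aq q1 by (auto simp: field_simps)
    moreover have "n - q * (1 + \<alpha>) = q * (n / q - 1 - \<alpha>)" using q1 by (simp add: field_simps)
    ultimately show ?thesis using q1 unfolding s \<gamma>_def by (simp add: field_simps)
  qed
  have s0: "s > 0" using q1 \<gamma> by (simp add: s_eq)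
  obtain w W where hk: "homogeneous_kernel w \<rho> W" and eq: "AE y in lborel. y \<noteq> 0 \<longrightarrow> \<Omega> (y /\<^sub>R norm y) = w y"
    using surface_function_representative[OF \<rho> \<Omega>] by blast
  interpret homogeneous_kernel w \<rho> W by (rule hk)
  obtain C1 where C1: "C1 > 0" and bound: "\<And>(\<phi>::'a \<Rightarrow> real) D x a b.
    (\<forall>y. (\<phi> has_derivative (\<lambda>h. D y \<bullet> h)) (at y)) \<Longrightarrow> continuous_on UNIV D \<Longrightarrow> 0 < a \<Longrightarrow> a < b \<Longrightarrow>
    ennreal \<bar>annulus_integral (n - \<alpha>) \<phi> x a b\<bar>
      \<le> ennreal C1 * mean_potential \<alpha> p (\<lambda>z. norm (D z)) x {a<..<2 * b}"
    using annulus_integral_le_mean_potential[OF p(1,3) p(4)[unfolded n_def], of \<alpha>] \<alpha> unfolding n_def by auto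
  have \<alpha>': "\<alpha> > -1" using \<alpha> by simp
  obtain C2 where C2: "C2 > 0" and strong: "\<And>(g::'a \<Rightarrow> real) Q. continuous_on UNIV g \<Longrightarrow> (\<forall>z. g z \<ge> 0) \<Longrightarrow>
    (\<integral>\<^sup>+z. ennreal (g z powr q) \<partial>lborel) \<le> ennreal (Q powr q) \<Longrightarrow> 0 < Q \<Longrightarrow>
    (AE x in lborel. mean_potential \<alpha> p g x {0<..} < \<infinity>) \<and>
    (\<integral>\<^sup>+x. ennreal (enn2real (mean_potential \<alpha> p g x {0<..}) powr s) \<partial>lborel) \<le> ennreal (C2 * Q powr s)"
    using mean_potential_strong_type[where 'a = 'a, OF p(1,2) \<alpha>' aq[unfolded n_def]]
    unfolding s_eq \<gamma>_def n_def by blast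
  \<comment> \<open>The s-th root of C1^s C2, the constant in the estimate of the integral of
    |T|^s.\<close>
  define C where "C = C1 * C2 powr (1 / s)"
  have C: "C > 0" using C1 C2 by (simp add: C_def)
  show ?thesis
  proof (intro exI[of _ C] conjI C allI impI)
    fix \<phi> :: "'a \<Rightarrow> real"
    assume \<phi>: "smooth \<phi>" and Lq: "in_Lp lebesgue q (grad \<phi>)"
    note der = smooth_grad(1)[OF \<phi>] and contD = smooth_grad(2)[OF \<phi>]
    have "\<phi> differentiable (at y)" for y using der unfolding differentiable_def by blast
    then have cont: "continuous_on UNIV \<phi>"
      by (simp add: continuous_on_eq_continuous_within differentiable_imp_continuous_within)
    then have [measurable]: "\<phi> \<in> borel_measurable borel" by (rule borel_measurable_continuous_onI)
    define g where "g z = norm (grad \<phi> z)" for z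
    have contg: "continuous_on UNIV g" unfolding g_def using contD by (rule continuous_on_norm)
    then have [measurable]: "g \<in> borel_measurable borel" by (rule borel_measurable_continuous_onI)
    define Q0 where "Q0 = Lp_norm lebesgue q (grad \<phi>)"
    have Q0: "Q0 \<ge> 0" by (simp add: Q0_def Lp_norm_def)
    have gQ: "(\<integral>\<^sup>+z. ennreal (g z powr q) \<partial>lborel) = ennreal (Q0 powr q)"
    proof -
      have "(\<integral>\<^sup>+z. ennreal (g z powr q) \<partial>lebesgue) = ennreal (\<integral>z. g z powr q \<partial>lebesgue)"
        using Lq by (intro nn_integral_eq_integral) (auto simp: in_Lp_def g_def)
      also have "(\<integral>z. g z powr q \<partial>lebesgue) = Q0 powr q"
        using q1 by (simp add: Q0_def Lp_norm_def g_def powr_powr)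
      finally show ?thesis by (simp add: nn_integral_completion)
    qed
    define P where "P x = mean_potential \<alpha> p g x {0<..}" for x
    have [measurable]: "P \<in> borel_measurable borel" unfolding P_def by measurable
    have strong': "(AE x in lborel. P x < \<infinity>) \<and> (\<integral>\<^sup>+x. ennreal (enn2real (P x) powr s) \<partial>lborel) \<le> ennreal (C2 * Q powr s)"
      if "Q > Q0" for Q
      unfolding P_def
    proof (rule strong[OF contg])
      have "Q0 powr q \<le> Q powr q" using that Q0 q1 by (intro powr_mono2) auto
      then show "(\<integral>\<^sup>+z. ennreal (g z powr q) \<partial>lborel) \<le> ennreal (Q powr q)" unfolding gQ by (rule ennreal_leI)
    qed (use that Q0 in \<open>auto simp: g_def\<close>)
    define J where "J x \<epsilon> R = annulus_integral (n - \<alpha>) \<phi> x \<epsilon> R" for x \<epsilon> R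
    have J_bound: "ennreal \<bar>J x a b\<bar> \<le> ennreal C1 * mean_potential \<alpha> p g x {a<..<2 * b}" if "0 < a" "a < b" for x a b
      unfolding J_def g_def by (rule bound) (use der contD that in auto)
    \<comment> \<open>A countable sequence of cut-offs suffices to bound the limit and to prove
      measurability. The second successor makes the inner radius strictly smaller already at k =
      0.\<close>
    define u where "u k = (1 / real (Suc k), real (Suc (Suc k)))" for k
    have u: "filterlim u (at_right 0 \<times>\<^sub>F at_top) sequentially"
      unfolding u_def
    proof (rule filterlim_Pair)
      show "filterlim (\<lambda>k. 1 / real (Suc k)) (at_right 0) sequentially"
        unfolding filterlim_at using LIMSEQ_inverse_real_of_nat by (auto simp: inverse_eq_divide)
      show "filterlim (\<lambda>k. real (Suc (Suc k))) at_top sequentially"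
        by (intro filterlim_compose[OF filterlim_real_sequentially] filterlim_compose[OF filterlim_Suc] filterlim_Suc)
    qed
    have pv: "\<exists>l. has_pv (T_integrand \<Omega> \<alpha> \<phi> x) l \<and> (\<lambda>k. J x (fst (u k)) (snd (u k))) \<longlonglongrightarrow> l \<and> \<bar>l\<bar> \<le> C1 * enn2real (P x)"
      if fin: "P x < \<infinity>" for x
    proof -
      obtain l where l: "((\<lambda>(\<epsilon>, R). J x \<epsilon> R) \<longlongrightarrow> l) (at_right 0 \<times>\<^sub>F at_top)"
        using annulus_integral_convergent[OF cont _ C1, of g "n - \<alpha>" x \<alpha> p] J_bound[of _ _ x] fin
        unfolding J_def P_def by auto
      then have "has_pv (T_integrand \<Omega> \<alpha> \<phi> x) l"
        unfolding has_pv_T_integrand_iff[OF eq cont] J_def n_def .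
      moreover have lim: "(\<lambda>k. J x (fst (u k)) (snd (u k))) \<longlonglongrightarrow> l"
        using filterlim_compose[OF l u] by (simp add: case_prod_beta)
      moreover have "\<bar>J x (fst (u k)) (snd (u k))\<bar> \<le> C1 * enn2real (P x)" for k
      proof -
        have "1 / real (Suc k) \<le> 1" by simp
        then have "fst (u k) < snd (u k)" unfolding u_def fst_conv snd_conv by linarith
        moreover have "0 < fst (u k)" by (simp add: u_def)
        ultimately have "ennreal \<bar>J x (fst (u k)) (snd (u k))\<bar>
          \<le> ennreal C1 * mean_potential \<alpha> p g x {fst (u k)<..<2 * snd (u k)}" by (intro J_bound)
        also have "\<dots> \<le> ennreal C1 * P x"
          unfolding P_def using \<open>0 < fst (u k)\<close> by (intro mult_left_mono mean_potential_mono) auto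
        also have "P x = ennreal (enn2real (P x))" using fin by simp
        also have "ennreal C1 * \<dots> = ennreal (C1 * enn2real (P x))" using C1 by (simp add: ennreal_mult)
        finally show ?thesis using C1 by (subst (asm) ennreal_le_iff) auto
      qed
      then have "\<bar>l\<bar> \<le> C1 * enn2real (P x)"
        by (intro LIMSEQ_le_const2[OF tendsto_rabs[OF lim]]) auto
      ultimately show ?thesis by blast
    qed
    have fin: "AE x in lborel. P x < \<infinity>" using strong'[of "Q0 + 1"] by simp
    show "AE x in lebesgue. \<exists>l. has_pv (T_integrand \<Omega> \<alpha> \<phi> x) l"
      by (rule AE_completion) (use fin in eventually_elim, use pv in blast)
    let ?T = "T_op \<Omega> \<alpha> \<phi>"
    have T: "(\<lambda>k. J x (fst (u k)) (snd (u k))) \<longlonglongrightarrow> ?T x" "\<bar>?T x\<bar> \<le> C1 * enn2real (P x)" if "P x < \<infinity>" for x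
      using pv[OF that] pv_eq unfolding T_op_def by auto
    \<comment> \<open>Each truncated integral is Borel in x and T is their limit almost everywhere
      along \<open>u\<close>; completeness of Lebesgue measure absorbs the exceptional set.\<close>
    have Tm: "?T \<in> borel_measurable lebesgue"
    proof (rule borel_measurable_AE)
      have Jm: "(\<lambda>x. J x a b) \<in> borel_measurable borel" for a b
        unfolding J_def annulus_integral_def by measurable
      show "(\<lambda>x. lim (\<lambda>k. J x (fst (u k)) (snd (u k)))) \<in> borel_measurable lebesgue"
        by (rule measurable_completion) (use Jm in \<open>auto intro!: borel_measurable_lim_metric\<close>)
      show "AE x in lebesgue. lim (\<lambda>k. J x (fst (u k)) (snd (u k))) = ?T x"
        by (rule AE_completion) (use fin in eventually_elim, use T(1) in \<open>auto intro: limI\<close>)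
    qed
    have Ts: "(\<integral>\<^sup>+x. ennreal (\<bar>?T x\<bar> powr s) \<partial>lebesgue) \<le> ennreal (C1 powr s * (C2 * Q powr s))" if "Q > Q0" for Q
    proof -
      have "(\<integral>\<^sup>+x. ennreal (\<bar>?T x\<bar> powr s) \<partial>lebesgue)
        \<le> (\<integral>\<^sup>+x. ennreal (C1 powr s) * ennreal (enn2real (P x) powr s) \<partial>lebesgue)"
      proof (rule nn_integral_mono_AE, rule AE_completion)
        show "AE x in lborel. ennreal (\<bar>?T x\<bar> powr s) \<le> ennreal (C1 powr s) * ennreal (enn2real (P x) powr s)"
          using fin
        proof eventually_elim
          case (elim x)
          have "\<bar>?T x\<bar> powr s \<le> (C1 * enn2real (P x)) powr s"
            using T(2)[OF elim] s0 by (intro powr_mono2) auto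
          then show ?case by (simp add: powr_mult ennreal_leI flip: ennreal_mult)
        qed
      qed
      also have "\<dots> = ennreal (C1 powr s) * (\<integral>\<^sup>+x. ennreal (enn2real (P x) powr s) \<partial>lborel)"
        by (simp add: nn_integral_completion nn_integral_cmult)
      also have "\<dots> \<le> ennreal (C1 powr s) * ennreal (C2 * Q powr s)"
        using strong'[OF that] by (intro mult_left_mono) auto
      finally show ?thesis using C2 by (simp add: ennreal_mult)
    qed
    have Ti: "integrable lebesgue (\<lambda>x. \<bar>?T x\<bar> powr s)"
    proof (rule integrableI_bounded)
      show "(\<lambda>x. \<bar>?T x\<bar> powr s) \<in> borel_measurable lebesgue" using Tm by measurable
      show "(\<integral>\<^sup>+x. ennreal (norm (\<bar>?T x\<bar> powr s)) \<partial>lebesgue) < \<infinity>"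
        using le_less_trans[OF Ts[of "Q0 + 1"]] by simp
    qed
    then show "in_Lp lebesgue s ?T" using Tm by (simp add: in_Lp_def)
    have T_le: "Lp_norm lebesgue s ?T \<le> C * Q" if "Q > Q0" for Q
    proof -
      have "ennreal (\<integral>x. \<bar>?T x\<bar> powr s \<partial>lebesgue) \<le> ennreal (C1 powr s * (C2 * Q powr s))"
        using Ts[OF that] nn_integral_eq_integral[OF Ti] by simp
      then have "(\<integral>x. \<bar>?T x\<bar> powr s \<partial>lebesgue) \<le> C1 powr s * (C2 * Q powr s)"
        using C2 by (subst (asm) ennreal_le_iff) auto
      then have "Lp_norm lebesgue s ?T \<le> (C1 powr s * (C2 * Q powr s)) powr (1 / s)"
        unfolding Lp_norm_def real_norm_def using s0 by (intro powr_mono2) auto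
      also have "\<dots> = C * Q" using C1 C2 Q0 that s0 by (simp add: C_def powr_mult powr_powr)
      finally show ?thesis .
    qed
    \<comment> \<open>Dividing by C > 0 isolates Q, so that the infimum over Q > Q0 can be
      taken.\<close>
    have "Lp_norm lebesgue s ?T / C \<le> Q" if "Q > Q0" for Q
      using T_le[OF that] C by (simp add: pos_divide_le_eq mult.commute)
    then have "Lp_norm lebesgue s ?T / C \<le> Q0" by (rule dense_ge)
    then show "Lp_norm lebesgue s ?T \<le> C * Lp_norm lebesgue q (grad \<phi>)"
      using C by (simp add: Q0_def field_simps)
  qed
qed

theorem proposition4p1:
  fixes \<Omega> :: "real ^ 'n \<Rightarrow> real"
    and n \<alpha> \<rho> q s :: real
  defines "n \<equiv> real CARD('n)"
  assumes "CARD('n) \<ge> 2"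
    and "0 < \<alpha>" and "\<alpha> < n - 1"
    and "1 < \<rho>" and "\<rho> < n"
    and "in_Lp surface_measure \<rho> \<Omega>"
    and "(\<integral>\<theta>. \<Omega> \<theta> \<partial>surface_measure) = 0"
    and "1 < \<rho> * n / (\<rho> * n + \<rho> - n)"
    and "\<rho> * n / (\<rho> * n + \<rho> - n) < q"
    and "q < n / (1 + \<alpha>)"
    and "s = q * n / (n - q * (1 + \<alpha>))"
  shows "s > 1 \<and>
    (\<exists>C>0. \<forall>\<phi> :: real ^ 'n \<Rightarrow> real.
       smooth \<phi> \<longrightarrow> in_Lp lebesgue q (grad \<phi>) \<longrightarrow>
         (AE x in lebesgue. \<exists>l. has_pv (T_integrand \<Omega> \<alpha> \<phi> x) l) \<and>
         in_Lp lebesgue s (T_op \<Omega> \<alpha> \<phi>) \<and>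
         Lp_norm lebesgue s (T_op \<Omega> \<alpha> \<phi>) \<le> C * Lp_norm lebesgue q (grad \<phi>))"
proof
  have "q > 1" using assms by simp
  moreover have "n - q * (1 + \<alpha>) > 0" using assms by (simp add: field_simps)
  moreover have "n - q * (1 + \<alpha>) < q * n"
  proof -
    have "n \<le> q * n" using \<open>q > 1\<close> by (simp add: n_def)
    moreover have "q * (1 + \<alpha>) > 0" using \<open>q > 1\<close> assms by simp
    ultimately show ?thesis by linarith
  qed
  ultimately show "s > 1" unfolding \<open>s = _\<close> by (simp add: less_divide_eq)
  have "n = real DIM(real ^ 'n)" by (simp add: n_def)
  then show "\<exists>C>0. \<forall>\<phi> :: real ^ 'n \<Rightarrow> real.
       smooth \<phi> \<longrightarrow> in_Lp lebesgue q (grad \<phi>) \<longrightarrow>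
         (AE x in lebesgue. \<exists>l. has_pv (T_integrand \<Omega> \<alpha> \<phi> x) l) \<and>
         in_Lp lebesgue s (T_op \<Omega> \<alpha> \<phi>) \<and>
         Lp_norm lebesgue s (T_op \<Omega> \<alpha> \<phi>) \<le> C * Lp_norm lebesgue q (grad \<phi>)"
    using assms by (intro rough_operator_gradient_bound[of \<alpha> \<rho> \<Omega> q s]) auto
qed

end
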